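(* Let $c>0$ be the wave speed and let $D$, $E$ be the matrices of the SBP-P-SAT discretization defined in the context. The semi-discrete scheme $$\mathbf w_{tt}=D\mathbf w+E\mathbf w_t+f(t)\mathbf d_s,\quad t>0,$$ for $\mathbf w(t)=\begin{bmatrix}\mathbf v^+(t)\\ \mathbf v^-(t)\end{bmatrix}\in\mathbb R^N$ is stable (in the sense of the energy method, as defined in the context): for $f\equiv 0$ every solution satisfies $\frac{d}{dt}(E^++E^-)\le 0$, where $E^\pm\ge 0$ are the discrete energies defined in the context.
   Context: One-dimensional SBP operators. For an interval discretized by $m$ equidistant points (in each coordinate direction the operators depend on the number of points and the spacing; the same symbols are used in all directions), $H$ is a diagonal matrix with positive diagonal (the norm matrix), $e_l=[1,0,\dots,0]^\top$, $e_r=[0,\dots,0,1]^\top$, and $I_m$ is the $m\times m$ identity. $D_1\approx\partial/\partial x$ satisfies $HD_1+D_1^\top H=-e_le_l^\top+e_re_r^\top$. For a coefficient vector $\mathbf c\in\mathbb R^m$, $D_2^{(\mathbf c)}\approx\partial_x c\,\partial_x$ satisfies $HD_2^{(\mathbf c)}=-M^{(\mathbf c)}-(e_l^\top\mathbf c)e_ld_l^\top+(e_r^\top\mathbf c)e_rd_r^\top$, $M^{(\mathbf c)}=D_1^\top H\,\mathrm{diag}(\mathbf c)D_1+R^{(\mathbf c)}$, with $R^{(\mathbf c)}$ symmetric, and positive semidefinite when $\mathbf c$ has nonnegative entries; $d_l^\top=e_l^\top\hat D_1$, $d_r^\top=e_r^\top\hat D_1$, where the first and last rows of the matrix $\hat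 D_1$ approximate $\partial/\partial x$. $D_2=D_2^{(\mathbf 1)}$, $R=R^{(\mathbf 1)}$, $\mathbf 1$ the all-ones vector. For a matrix $A$, $(\mathbf u,\mathbf v)_A=\mathbf u^\top A\mathbf v$, $\|\mathbf u\|_A^2=(\mathbf u,\mathbf u)_A$. Operators on the rectangle $\Omega^+$ ($N^+=m_x^+m_y^+$ points, column-major ordering): $D_x^+=D_1\otimes I_{m_y^+}$, $D_y^+=I_{m_x^+}\otimes D_1$, $D_L^+=D_2\otimes I_{m_y^+}+I_{m_x^+}\otimes D_2$, $H_x^+=H\otimes I_{m_y^+}$, $H_y^+=I_{m_x^+}\otimes H$, $H^+=H_x^+H_y^+$, $e_w^+=e_l^\top\otimes I_{m_y^+}$, $e_e^+=e_r^\top\otimes I_{m_y^+}$, $e_s^+=I_{m_x^+}\otimes e_l^\top$, $e_n^+=I_{m_x^+}\otimes e_r^\top$, $d_w^+=-(d_l^\top\otimes I_{m_y^+})$, $d_e^+=d_r^\top\otimes I_{m_y^+}$, $d_s^+=-(I_{m_x^+}\otimes d_l^\top)$, $d_n^+=I_{m_x^+}\otimes d_r^\top$; $H_k^+$ ($k=w,e,s,n$) is the one-dimensional norm matrix $H$ in the direction along side $k$; $R^+=(R\otimes I_{m_y^+})H_y^++(I_{m_x^+}\otimes R)H_x^+$. Operators on the curvilinear block $\Omega_p^-$ (image of $[0,1]^2$ with coordinates $(\xi,\eta)$, $N^-=m_\xi^-m_\eta^-$ points, column-major ordering): $D_\xi^-=D_1\otimes I_{m_\eta^-}$, $D_\eta^-=I_{m_\xi^-}\otimes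 D_1$, $\hat D_\xi^-=\hat D_1\otimes I_{m_\eta^-}$, $\hat D_\eta^-=I_{m_\xi^-}\otimes\hat D_1$, $H_\xi^-=H\otimes I_{m_\eta^-}$, $H_\eta^-=I_{m_\xi^-}\otimes H$, $e_w^-=e_l^\top\otimes I_{m_\eta^-}$, $e_e^-=e_r^\top\otimes I_{m_\eta^-}$, $e_s^-=I_{m_\xi^-}\otimes e_l^\top$, $e_n^-=I_{m_\xi^-}\otimes e_r^\top$. With $\mathbf x,\mathbf y\in\mathbb R^{N^-}$ the physical grid coordinates, define the diagonal matrices $\mathbf X_\xi=\mathrm{diag}(D_\xi^-\mathbf x)$, $\mathbf X_\eta=\mathrm{diag}(D_\eta^-\mathbf x)$, $\mathbf Y_\xi=\mathrm{diag}(D_\xi^-\mathbf y)$, $\mathbf Y_\eta=\mathrm{diag}(D_\eta^-\mathbf y)$, $\mathbf J=\mathbf X_\xi\mathbf Y_\eta-\mathbf X_\eta\mathbf Y_\xi$ (assumed to have positive diagonal), $\alpha_1=\mathbf J^{-1}(\mathbf X_\eta^2+\mathbf Y_\eta^2)$, $\beta=-\mathbf J^{-1}(\mathbf X_\xi\mathbf X_\eta+\mathbf Y_\xi\mathbf Y_\eta)$, $\alpha_2=\mathbf J^{-1}(\mathbf X_\xi^2+\mathbf Y_\xi^2)$, $\mathbf W_1=\sqrt{\mathbf X_\xi^2+\mathbf Y_\xi^2}$, $\mathbf W_2=\sqrt{\mathbf X_\eta^2+\mathbf Y_\eta^2}$ (elementwise on the diagonals). $D_{\xi\xi}^{(\alpha_1)}$,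 $R_\xi^{(\alpha_1)}$ (resp. $D_{\eta\eta}^{(\alpha_2)}$, $R_\eta^{(\alpha_2)}$) are built grid line by grid line in the $\xi$- (resp. $\eta$-) direction from $D_2^{(\mathbf c)}$, $R^{(\mathbf c)}$ with $\mathbf c$ the values of the diagonal of $\alpha_1$ (resp. $\alpha_2$) on that line. Then $D_x^-=\mathbf J^{-1}(\mathbf Y_\eta D_\xi^--\mathbf Y_\xi D_\eta^-)$, $D_y^-=\mathbf J^{-1}(-\mathbf X_\eta D_\xi^-+\mathbf X_\xi D_\eta^-)$, $D_L^-=\mathbf J^{-1}(D_{\xi\xi}^{(\alpha_1)}+D_\eta^-\beta D_\xi^-+D_\xi^-\beta D_\eta^-+D_{\eta\eta}^{(\alpha_2)})$, $d_w^-=-e_w^-\mathbf W_2^{-1}(\alpha_1e_w^{-\top}e_w^-\hat D_\xi^-+\beta e_w^{-\top}e_w^-D_\eta^-)$, $d_e^-=e_e^-\mathbf W_2^{-1}(\alpha_1e_e^{-\top}e_e^-\hat D_\xi^-+\beta e_e^{-\top}e_e^-D_\eta^-)$, $d_s^-=-e_s^-\mathbf W_1^{-1}(\alpha_2e_s^{-\top}e_s^-\hat D_\eta^-+\beta e_s^{-\top}e_s^-D_\xi^-)$, $d_n^-=e_n^-\mathbf W_1^{-1}(\alpha_2e_n^{-\top}e_n^-\hat D_\eta^-+\beta e_n^{-\top}e_n^-D_\xi^-)$ (here $e_k^{-\top}$ is the transpose of $e_k^-$), $H^-=H_\xi^-H_\eta^-\mathbf J$, $H_k^-=He_k^-\mathbf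 W_2e_k^{-\top}$ for $k=w,e$ and $H_k^-=He_k^-\mathbf W_1e_k^{-\top}$ for $k=s,n$ ($H$ the one-dimensional norm along side $k$), $R^-=R_\xi^{(\alpha_1)}H_\eta^-+R_\eta^{(\alpha_2)}H_\xi^-$. The blocks are conforming at the interface (south side of $\Omega^+$, north side of $\Omega_p^-$): $m_x^+=m_\xi^-$ and $H_s^+=H_n^-$. Global scheme. $N=N^++N^-$, $\bar H=\begin{bmatrix}H^+&0\\0&H^-\end{bmatrix}$, $L=\begin{bmatrix}e_n^+&0\\ e_s^+&-e_n^-\end{bmatrix}$, $P=I-\bar H^{-1}L^\top(L\bar H^{-1}L^\top)^{-1}L$, $$D=c^2P\left(\begin{bmatrix}D_L^+&0\\0&D_L^-\end{bmatrix}+SAT_{BC_1}+SAT_{IC}\right)P,\qquad E=c\,P\,SAT_{BC_2}P,$$ $$SAT_{BC_1}=-\bar H^{-1}\left(\sum_{k=w,e}\begin{bmatrix}e_k^{+\top}H_k^+d_k^+&0\\0&e_k^{-\top}H_k^-d_k^-\end{bmatrix}+\begin{bmatrix}0&0\\0&e_s^{-\top}H_s^-d_s^-\end{bmatrix}\right),$$ $$SAT_{BC_2}=-\bar H^{-1}\sum_{k=w,e}\begin{bmatrix}e_k^{+\top}H_k^+e_k^+&0\\0&e_k^{-\top}H_k^-e_k^-\end{bmatrix},\qquad SAT_{IC}=-\bar H^{-1}\begin{bmatrix}e_s^{+\top}H_s^+d_s^+&e_s^{+\top}H_s^+d_n^-\\0&0\end{bmatrix}.$$ $\mathbf d_s\in\mathbb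 R^N$ is a fixed discrete point source vector and $f$ a given scalar function of time. Stability (energy method). Data do not influence stability, so $f\equiv0$ is considered. Writing $P\mathbf w=\begin{bmatrix}\tilde{\mathbf v}^+\\\tilde{\mathbf v}^-\end{bmatrix}$, the discrete energies are $$E^\pm=\|\mathbf v_t^\pm\|^2_{H^\pm}+c^2\|D_x^\pm\tilde{\mathbf v}^\pm\|^2_{H^\pm}+c^2\|D_y^\pm\tilde{\mathbf v}^\pm\|^2_{H^\pm}+c^2\|\tilde{\mathbf v}^\pm\|^2_{R^\pm}.$$ The scheme is called stable if $E^\pm\ge0$ and $E^++E^-$ is non-increasing in time for all solutions with $f\equiv 0$. *)

theory Defs
  imports Complex_Main "Jordan_Normal_Form.Gauss_Jordan_Elimination"
begin

section \<open>Matrices\<close>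

text \<open>The inverse of an invertible square matrix; only ever applied to such matrices.\<close>

definition minv :: "real mat \<Rightarrow> real mat" where
  "minv A = the (mat_inverse A)"

definition kron :: "real mat \<Rightarrow> real mat \<Rightarrow> real mat" (infixl \<open>\<otimes>\<^sub>k\<close> 70) where
  "A \<otimes>\<^sub>k B = mat (dim_row A * dim_row B) (dim_col A * dim_col B)
     (\<lambda>(p, q). A $$ (p div dim_row B, q div dim_col B) * B $$ (p mod dim_row B, q mod dim_col B))"

definition diagv :: "real vec \<Rightarrow> real mat" where
  "diagv v = mat_diag (dim_vec v) (\<lambda>i. v $ i)"

definition block_diag2 :: "real mat \<Rightarrow> real mat \<Rightarrow> real mat" where
  "block_diag2 A B =
     four_block_mat A (0\<^sub>m (dim_row A) (dim_col B)) (0\<^sub>m (dim_row B) (dim_col A)) B"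

definition ip :: "real mat \<Rightarrow> real vec \<Rightarrow> real vec \<Rightarrow> real" where
  "ip A u v = u \<bullet> (A *\<^sub>v v)"

definition sqnorm :: "real mat \<Rightarrow> real vec \<Rightarrow> real" where
  "sqnorm A u = ip A u u"

section \<open>One-dimensional SBP operators\<close>

record sbp_ops =
  npts :: nat
  H1 :: "real mat"
  D1 :: "real mat"
  D1hat :: "real mat"
  D2c :: "real vec \<Rightarrow> real mat"
  R1c :: "real vec \<Rightarrow> real mat"

text \<open>The boundary functionals are row matrices: \<open>elT\<close> and \<open>dlT\<close> are
  $e_l^\top$ and $d_l^\top$, so that $e_l$ itself is \<open>(elT S)\<^sup>T\<close>.\<close>

definition elT :: "sbp_ops \<Rightarrow> real mat" where
  "elT S = mat_of_rows (npts S) [unit_vec (npts S) 0]"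

definition erT :: "sbp_ops \<Rightarrow> real mat" where
  "erT S = mat_of_rows (npts S) [unit_vec (npts S) (npts S - 1)]"

definition dlT :: "sbp_ops \<Rightarrow> real mat" where
  "dlT S = elT S * D1hat S"

definition drT :: "sbp_ops \<Rightarrow> real mat" where
  "drT S = erT S * D1hat S"

definition M1c :: "sbp_ops \<Rightarrow> real vec \<Rightarrow> real mat" where
  "M1c S c = (D1 S)\<^sup>T * H1 S * diagv c * D1 S + R1c S c"

definition ones :: "nat \<Rightarrow> real vec" where
  "ones m = vec m (\<lambda>_. 1)"

definition D2 :: "sbp_ops \<Rightarrow> real mat" where
  "D2 S = D2c S (ones (npts S))"

definition R1 :: "sbp_ops \<Rightarrow> real mat" where
  "R1 S = R1c S (ones (npts S))"

text \<open>The relations below are all that is assumed of the operators: no accuracy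
  conditions are imposed, and the grid spacing enters only through the operators.\<close>

definition is_sbp :: "sbp_ops \<Rightarrow> bool" where
  "is_sbp S \<longleftrightarrow> (let m = npts S in
     0 < m \<and>
     H1 S \<in> carrier_mat m m \<and> diagonal_mat (H1 S) \<and> (\<forall>i<m. 0 < H1 S $$ (i, i)) \<and>
     D1 S \<in> carrier_mat m m \<and> D1hat S \<in> carrier_mat m m \<and>
     H1 S * D1 S + (D1 S)\<^sup>T * H1 S = - ((elT S)\<^sup>T * elT S) + (erT S)\<^sup>T * erT S \<and>
     (\<forall>c \<in> carrier_vec m.
        D2c S c \<in> carrier_mat m m \<and> R1c S c \<in> carrier_mat m m \<and>
        H1 S * D2c S c =
          - M1c S c - (unit_vec m 0 \<bullet> c) \<cdot>\<^sub>m ((elT S)\<^sup>T * dlT S)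
          + (unit_vec m (m - 1) \<bullet> c) \<cdot>\<^sub>m ((erT S)\<^sup>T * drT S) \<and>
        (R1c S c)\<^sup>T = R1c S c \<and>
        ((\<forall>i<m. 0 \<le> c $ i) \<longrightarrow> (\<forall>v \<in> carrier_vec m. 0 \<le> sqnorm (R1c S c) v))))"

section \<open>Tensor-product grids\<close>

text \<open>The first direction is $x$ resp. $\xi$, the second $y$ resp. $\eta$. In column-major
  ordering the grid point with indices $(i,j)$ has number \<open>i * n2 G + j\<close>. Each direction
  carries its own operators.\<close>

record tensor_grid =
  ops1 :: sbp_ops
  ops2 :: sbp_ops

record curv_grid = tensor_grid +
  xs :: "real vec"
  ys :: "real vec"

abbreviation n1 :: "'a tensor_grid_scheme \<Rightarrow> nat" where "n1 G \<equiv> npts (ops1 G)"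
abbreviation n2 :: "'a tensor_grid_scheme \<Rightarrow> nat" where "n2 G \<equiv> npts (ops2 G)"

definition npoints :: "'a tensor_grid_scheme \<Rightarrow> nat" where
  "npoints G = n1 G * n2 G"

definition dir1 :: "'a tensor_grid_scheme \<Rightarrow> real mat \<Rightarrow> real mat" where
  "dir1 G A = A \<otimes>\<^sub>k 1\<^sub>m (n2 G)"

definition dir2 :: "'a tensor_grid_scheme \<Rightarrow> real mat \<Rightarrow> real mat" where
  "dir2 G A = 1\<^sub>m (n1 G) \<otimes>\<^sub>k A"

definition D_fst :: "'a tensor_grid_scheme \<Rightarrow> real mat" where "D_fst G = dir1 G (D1 (ops1 G))"
definition D_snd :: "'a tensor_grid_scheme \<Rightarrow> real mat" where "D_snd G = dir2 G (D1 (ops2 G))"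
definition H_fst :: "'a tensor_grid_scheme \<Rightarrow> real mat" where "H_fst G = dir1 G (H1 (ops1 G))"
definition H_snd :: "'a tensor_grid_scheme \<Rightarrow> real mat" where "H_snd G = dir2 G (H1 (ops2 G))"

definition e_w :: "'a tensor_grid_scheme \<Rightarrow> real mat" where "e_w G = dir1 G (elT (ops1 G))"
definition e_e :: "'a tensor_grid_scheme \<Rightarrow> real mat" where "e_e G = dir1 G (erT (ops1 G))"
definition e_s :: "'a tensor_grid_scheme \<Rightarrow> real mat" where "e_s G = dir2 G (elT (ops2 G))"
definition e_n :: "'a tensor_grid_scheme \<Rightarrow> real mat" where "e_n G = dir2 G (erT (ops2 G))"

section \<open>The rectangle\<close>

definition DLp :: "tensor_grid \<Rightarrow> real mat" where
  "DLp G = dir1 G (D2 (ops1 G)) + dir2 G (D2 (ops2 G))"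

definition Hp :: "tensor_grid \<Rightarrow> real mat" where
  "Hp G = H_fst G * H_snd G"

definition dp_w :: "tensor_grid \<Rightarrow> real mat" where "dp_w G = - dir1 G (dlT (ops1 G))"
definition dp_e :: "tensor_grid \<Rightarrow> real mat" where "dp_e G = dir1 G (drT (ops1 G))"
definition dp_s :: "tensor_grid \<Rightarrow> real mat" where "dp_s G = - dir2 G (dlT (ops2 G))"
definition dp_n :: "tensor_grid \<Rightarrow> real mat" where "dp_n G = dir2 G (drT (ops2 G))"

definition Hp_w :: "tensor_grid \<Rightarrow> real mat" where "Hp_w G = H1 (ops2 G)"
definition Hp_e :: "tensor_grid \<Rightarrow> real mat" where "Hp_e G = H1 (ops2 G)"
definition Hp_s :: "tensor_grid \<Rightarrow> real mat" where "Hp_s G = H1 (ops1 G)"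
definition Hp_n :: "tensor_grid \<Rightarrow> real mat" where "Hp_n G = H1 (ops1 G)"

definition Rp :: "tensor_grid \<Rightarrow> real mat" where
  "Rp G = dir1 G (R1 (ops1 G)) * H_snd G + dir2 G (R1 (ops2 G)) * H_fst G"

section \<open>The curvilinear block\<close>

definition X_xi :: "curv_grid \<Rightarrow> real mat" where "X_xi G = diagv (D_fst G *\<^sub>v xs G)"
definition X_eta :: "curv_grid \<Rightarrow> real mat" where "X_eta G = diagv (D_snd G *\<^sub>v xs G)"
definition Y_xi :: "curv_grid \<Rightarrow> real mat" where "Y_xi G = diagv (D_fst G *\<^sub>v ys G)"
definition Y_eta :: "curv_grid \<Rightarrow> real mat" where "Y_eta G = diagv (D_snd G *\<^sub>v ys G)"

definition Jac :: "curv_grid \<Rightarrow> real mat" where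
  "Jac G = X_xi G * Y_eta G - X_eta G * Y_xi G"

definition alpha1 :: "curv_grid \<Rightarrow> real mat" where
  "alpha1 G = minv (Jac G) * (X_eta G * X_eta G + Y_eta G * Y_eta G)"

definition beta :: "curv_grid \<Rightarrow> real mat" where
  "beta G = - (minv (Jac G) * (X_xi G * X_eta G + Y_xi G * Y_eta G))"

definition alpha2 :: "curv_grid \<Rightarrow> real mat" where
  "alpha2 G = minv (Jac G) * (X_xi G * X_xi G + Y_xi G * Y_xi G)"

text \<open>Since \<open>sqrt 0 = 0\<close>, mapping over all entries keeps these matrices diagonal.\<close>

definition W1 :: "curv_grid \<Rightarrow> real mat" where
  "W1 G = map_mat sqrt (X_xi G * X_xi G + Y_xi G * Y_xi G)"

definition W2 :: "curv_grid \<Rightarrow> real mat" where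
  "W2 G = map_mat sqrt (X_eta G * X_eta G + Y_eta G * Y_eta G)"

text \<open>\<open>lines1 G F A\<close> acts on the grid line with second index \<open>j\<close> as the one-dimensional
  matrix \<open>F c\<close>, where \<open>c\<close> lists the diagonal entries of \<open>A\<close> on that line, and does not
  couple different lines; \<open>lines2\<close> is the same in the second direction.\<close>

definition lines1 :: "curv_grid \<Rightarrow> (real vec \<Rightarrow> real mat) \<Rightarrow> real mat \<Rightarrow> real mat" where
  "lines1 G F A = mat (npoints G) (npoints G) (\<lambda>(p, q).
     if p mod n2 G = q mod n2 G
     then F (vec (n1 G) (\<lambda>i. A $$ (i * n2 G + p mod n2 G, i * n2 G + p mod n2 G)))
            $$ (p div n2 G, q div n2 G)
     else 0)"

definition lines2 :: "curv_grid \<Rightarrow> (real vec \<Rightarrow> real mat) \<Rightarrow> real mat \<Rightarrow> real mat" where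
  "lines2 G F A = mat (npoints G) (npoints G) (\<lambda>(p, q).
     if p div n2 G = q div n2 G
     then F (vec (n2 G) (\<lambda>j. A $$ (p div n2 G * n2 G + j, p div n2 G * n2 G + j)))
            $$ (p mod n2 G, q mod n2 G)
     else 0)"

definition D_xixi :: "curv_grid \<Rightarrow> real mat" where
  "D_xixi G = lines1 G (D2c (ops1 G)) (alpha1 G)"

definition D_etaeta :: "curv_grid \<Rightarrow> real mat" where
  "D_etaeta G = lines2 G (D2c (ops2 G)) (alpha2 G)"

definition R_xi :: "curv_grid \<Rightarrow> real mat" where
  "R_xi G = lines1 G (R1c (ops1 G)) (alpha1 G)"

definition R_eta :: "curv_grid \<Rightarrow> real mat" where
  "R_eta G = lines2 G (R1c (ops2 G)) (alpha2 G)"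

definition Dxm :: "curv_grid \<Rightarrow> real mat" where
  "Dxm G = minv (Jac G) * (Y_eta G * D_fst G - Y_xi G * D_snd G)"

definition Dym :: "curv_grid \<Rightarrow> real mat" where
  "Dym G = minv (Jac G) * (- X_eta G * D_fst G + X_xi G * D_snd G)"

definition DLm :: "curv_grid \<Rightarrow> real mat" where
  "DLm G = minv (Jac G) *
     (D_xixi G + D_snd G * beta G * D_fst G + D_fst G * beta G * D_snd G + D_etaeta G)"

definition Dhat_xi :: "curv_grid \<Rightarrow> real mat" where
  "Dhat_xi G = dir1 G (D1hat (ops1 G))"

definition Dhat_eta :: "curv_grid \<Rightarrow> real mat" where
  "Dhat_eta G = dir2 G (D1hat (ops2 G))"

definition dm_w :: "curv_grid \<Rightarrow> real mat" where
  "dm_w G = - (e_w G * minv (W2 G) *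
     (alpha1 G * (e_w G)\<^sup>T * e_w G * Dhat_xi G + beta G * (e_w G)\<^sup>T * e_w G * D_snd G))"

definition dm_e :: "curv_grid \<Rightarrow> real mat" where
  "dm_e G = e_e G * minv (W2 G) *
     (alpha1 G * (e_e G)\<^sup>T * e_e G * Dhat_xi G + beta G * (e_e G)\<^sup>T * e_e G * D_snd G)"

definition dm_s :: "curv_grid \<Rightarrow> real mat" where
  "dm_s G = - (e_s G * minv (W1 G) *
     (alpha2 G * (e_s G)\<^sup>T * e_s G * Dhat_eta G + beta G * (e_s G)\<^sup>T * e_s G * D_fst G))"

definition dm_n :: "curv_grid \<Rightarrow> real mat" where
  "dm_n G = e_n G * minv (W1 G) *
     (alpha2 G * (e_n G)\<^sup>T * e_n G * Dhat_eta G + beta G * (e_n G)\<^sup>T * e_n G * D_fst G)"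

definition Hm :: "curv_grid \<Rightarrow> real mat" where
  "Hm G = H_fst G * H_snd G * Jac G"

definition Hm_w :: "curv_grid \<Rightarrow> real mat" where
  "Hm_w G = H1 (ops2 G) * e_w G * W2 G * (e_w G)\<^sup>T"

definition Hm_e :: "curv_grid \<Rightarrow> real mat" where
  "Hm_e G = H1 (ops2 G) * e_e G * W2 G * (e_e G)\<^sup>T"

definition Hm_s :: "curv_grid \<Rightarrow> real mat" where
  "Hm_s G = H1 (ops1 G) * e_s G * W1 G * (e_s G)\<^sup>T"

definition Hm_n :: "curv_grid \<Rightarrow> real mat" where
  "Hm_n G = H1 (ops1 G) * e_n G * W1 G * (e_n G)\<^sup>T"

definition Rm :: "curv_grid \<Rightarrow> real mat" where
  "Rm G = R_xi G * H_snd G + R_eta G * H_fst G"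

definition is_curv_grid :: "curv_grid \<Rightarrow> bool" where
  "is_curv_grid G \<longleftrightarrow> is_sbp (ops1 G) \<and> is_sbp (ops2 G) \<and>
     xs G \<in> carrier_vec (npoints G) \<and> ys G \<in> carrier_vec (npoints G) \<and>
     (\<forall>i<npoints G. 0 < Jac G $$ (i, i))"

definition is_rect_grid :: "tensor_grid \<Rightarrow> bool" where
  "is_rect_grid G \<longleftrightarrow> is_sbp (ops1 G) \<and> is_sbp (ops2 G)"

text \<open>The interface is the south side of \<open>P\<close> and the north side of \<open>M\<close>.\<close>

definition conforming :: "tensor_grid \<Rightarrow> curv_grid \<Rightarrow> bool" where
  "conforming P M \<longleftrightarrow> n1 P = n1 M \<and> Hp_s P = Hm_n M"

section \<open>The global scheme\<close>

definition Ntot :: "tensor_grid \<Rightarrow> curv_grid \<Rightarrow> nat" where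
  "Ntot P M = npoints P + npoints M"

definition Hbar :: "tensor_grid \<Rightarrow> curv_grid \<Rightarrow> real mat" where
  "Hbar P M = block_diag2 (Hp P) (Hm M)"

definition Lmat :: "tensor_grid \<Rightarrow> curv_grid \<Rightarrow> real mat" where
  "Lmat P M = four_block_mat (e_n P) (0\<^sub>m (n1 P) (npoints M)) (e_s P) (- e_n M)"

definition Proj :: "tensor_grid \<Rightarrow> curv_grid \<Rightarrow> real mat" where
  "Proj P M = 1\<^sub>m (Ntot P M) -
     minv (Hbar P M) * (Lmat P M)\<^sup>T *
     minv (Lmat P M * minv (Hbar P M) * (Lmat P M)\<^sup>T) * Lmat P M"

definition SAT_BC1 :: "tensor_grid \<Rightarrow> curv_grid \<Rightarrow> real mat" where
  "SAT_BC1 P M = - (minv (Hbar P M) *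
     (block_diag2 ((e_w P)\<^sup>T * Hp_w P * dp_w P) ((e_w M)\<^sup>T * Hm_w M * dm_w M) +
      block_diag2 ((e_e P)\<^sup>T * Hp_e P * dp_e P) ((e_e M)\<^sup>T * Hm_e M * dm_e M) +
      block_diag2 (0\<^sub>m (npoints P) (npoints P)) ((e_s M)\<^sup>T * Hm_s M * dm_s M)))"

definition SAT_BC2 :: "tensor_grid \<Rightarrow> curv_grid \<Rightarrow> real mat" where
  "SAT_BC2 P M = - (minv (Hbar P M) *
     (block_diag2 ((e_w P)\<^sup>T * Hp_w P * e_w P) ((e_w M)\<^sup>T * Hm_w M * e_w M) +
      block_diag2 ((e_e P)\<^sup>T * Hp_e P * e_e P) ((e_e M)\<^sup>T * Hm_e M * e_e M)))"

definition SAT_IC :: "tensor_grid \<Rightarrow> curv_grid \<Rightarrow> real mat" where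
  "SAT_IC P M = - (minv (Hbar P M) *
     four_block_mat ((e_s P)\<^sup>T * Hp_s P * dp_s P) ((e_s P)\<^sup>T * Hp_s P * dm_n M)
       (0\<^sub>m (npoints M) (npoints P)) (0\<^sub>m (npoints M) (npoints M)))"

definition Dmat :: "real \<Rightarrow> tensor_grid \<Rightarrow> curv_grid \<Rightarrow> real mat" where
  "Dmat c P M = c\<^sup>2 \<cdot>\<^sub>m
     (Proj P M * (block_diag2 (DLp P) (DLm M) + SAT_BC1 P M + SAT_IC P M) * Proj P M)"

definition Emat :: "real \<Rightarrow> tensor_grid \<Rightarrow> curv_grid \<Rightarrow> real mat" where
  "Emat c P M = c \<cdot>\<^sub>m (Proj P M * SAT_BC2 P M * Proj P M)"

definition has_vec_deriv :: "nat \<Rightarrow> (real \<Rightarrow> real vec) \<Rightarrow> real vec \<Rightarrow> real \<Rightarrow> bool" where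
  "has_vec_deriv n u u' t \<longleftrightarrow> u' \<in> carrier_vec n \<and>
     (\<forall>i<n. ((\<lambda>s. u s $ i) has_real_derivative u' $ i) (at t))"

text \<open>\<open>w\<close> solves $w_{tt} = D w + E w_t + f(t)\,d_s$ for $t > 0$, with velocity \<open>wt\<close> $= w_t$.\<close>

definition scheme_solution ::
  "real \<Rightarrow> tensor_grid \<Rightarrow> curv_grid \<Rightarrow> (real \<Rightarrow> real) \<Rightarrow> real vec \<Rightarrow>
   (real \<Rightarrow> real vec) \<Rightarrow> (real \<Rightarrow> real vec) \<Rightarrow> bool" where
  "scheme_solution c P M f ds w wt \<longleftrightarrow>
     (\<forall>t>0. w t \<in> carrier_vec (Ntot P M) \<and>
        has_vec_deriv (Ntot P M) w (wt t) t \<and>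
        has_vec_deriv (Ntot P M) wt
          (Dmat c P M *\<^sub>v w t + Emat c P M *\<^sub>v wt t + f t \<cdot>\<^sub>v ds) t)"

section \<open>Discrete energies and stability\<close>

text \<open>The kinetic part uses the unprojected velocity, the potential part the projected solution.\<close>

definition energy_p :: "real \<Rightarrow> tensor_grid \<Rightarrow> curv_grid \<Rightarrow> real vec \<Rightarrow> real vec \<Rightarrow> real" where
  "energy_p c P M w wt =
     (let v = vec_first (Proj P M *\<^sub>v w) (npoints P) in
      sqnorm (Hp P) (vec_first wt (npoints P)) +
      c\<^sup>2 * sqnorm (Hp P) (D_fst P *\<^sub>v v) + c\<^sup>2 * sqnorm (Hp P) (D_snd P *\<^sub>v v) +
      c\<^sup>2 * sqnorm (Rp P) v)"

definition energy_m :: "real \<Rightarrow> tensor_grid \<Rightarrow> curv_grid \<Rightarrow> real vec \<Rightarrow> real vec \<Rightarrow> real" where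
  "energy_m c P M w wt =
     (let v = vec_last (Proj P M *\<^sub>v w) (npoints M) in
      sqnorm (Hm M) (vec_last wt (npoints M)) +
      c\<^sup>2 * sqnorm (Hm M) (Dxm M *\<^sub>v v) + c\<^sup>2 * sqnorm (Hm M) (Dym M *\<^sub>v v) +
      c\<^sup>2 * sqnorm (Rm M) v)"

definition energy_stable :: "real \<Rightarrow> tensor_grid \<Rightarrow> curv_grid \<Rightarrow> real vec \<Rightarrow> bool" where
  "energy_stable c P M ds \<longleftrightarrow>
     (\<forall>w wt. scheme_solution c P M (\<lambda>_. 0) ds w wt \<longrightarrow>
        (\<forall>t>0. 0 \<le> energy_p c P M (w t) (wt t) \<and> 0 \<le> energy_m c P M (w t) (wt t)) \<and>
        antimono_on {0<..} (\<lambda>t. energy_p c P M (w t) (wt t) + energy_m c P M (w t) (wt t)))"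

end

theory Submission
  imports Defs "Jordan_Normal_Form.Determinant"
begin

text \<open>
The proof is the discrete energy method. Write \<open>Y = P w_t\<close> and \<open>X = P w\<close> for the projected velocity
and solution, and \<open>A\<close> for the spatial operator before projection, so that
\<open>w_tt = c^2 P A X + c P SAT_BC2 Y\<close>. Differentiating the kinetic energy produces \<open>2 (w_t, w_tt)\<close> in the
norm of \<open>Hbar\<close>. The projection is orthogonal in that norm, so it may be moved from \<open>w_tt\<close> onto
\<open>w_t\<close>, and everything is tested against \<open>Y\<close>. By construction \<open>L Y = 0\<close>: the trace of \<open>Y\<close> vanishes on the
north side of the rectangle, and its traces on the two sides of the interface agree.

Summation by parts turns \<open>(Y, A X)\<close> into minus the symmetric form \<open>a(Y, X)\<close> whose square is the
potential energy, plus the normal fluxes through the eight sides of the two blocks. None of the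
fluxes survives. The SAT terms remove those on the west and east sides, on the south side of the
curvilinear block and on the south side of the rectangle; the one on the north side of the
rectangle is tested against zero; and the interface flux of the curvilinear block is cancelled by
the off-diagonal part of \<open>SAT_IC\<close>, because \<open>Y\<close> is continuous across the interface and the two blocks use the
same norm there. Hence \<open>(Y, A X) = - a(Y, X)\<close> (lemma \<open>spatial_form\<close>), which cancels against the
derivative \<open>2 c^2 a(Y, X)\<close> of the potential energy. What remains is \<open>2 c (Y, SAT_BC2 Y)\<close>, minus a sum of
weighted squares of the boundary values of \<open>Y\<close> on the west and east sides (\<open>damping_form\<close>).

Both blocks obey the same summation-by-parts formula (\<open>green\<close>), for an elliptic operator with
variable coefficients on a tensor grid: on the rectangle it is the Laplacian, and on the curvilinear block
its coefficients come from the metric. It is proved for functions of two indices, where it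
reduces to the one-dimensional identities on each grid line; \<open>green_rect\<close> and \<open>green_curv\<close> restate it for
the matrices of the scheme.
\<close>

section \<open>Inverses and diagonal matrices\<close>

lemma minv_inverse:
  assumes A: "A \<in> carrier_mat n n" and det: "det A \<noteq> 0"
  shows "minv A \<in> carrier_mat n n" and "A * minv A = 1\<^sub>m n" and "minv A * A = 1\<^sub>m n"
proof -
  have "mat_inverse A \<noteq> None"
    using mat_inverse(1)[OF A, of "()"] det_non_zero_imp_unit[OF A det, of "()"] by blast
  then obtain B where B: "mat_inverse A = Some B" by auto
  show "minv A \<in> carrier_mat n n" "A * minv A = 1\<^sub>m n" "minv A * A = 1\<^sub>m n"
    using mat_inverse(2)[OF A B] B by (auto simp: minv_def)
qed

lemma minv_eqI:
  assumes A: "A \<in> carrier_mat n n" and B: "B \<in> carrier_mat n n" and AB: "A * B = 1\<^sub>m n"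
  shows "minv A = B"
proof -
  have "det A * det B = 1"
    using det_mult[OF A B] AB by simp
  hence "det A \<noteq> 0" by auto
  note inv = minv_inverse[OF A this]
  have "minv A = minv A * (A * B)" using inv AB by simp
  also have "\<dots> = B" using assoc_mult_mat[OF inv(1) A B, symmetric] inv B by simp
  finally show ?thesis .
qed

lemma dim_mat_diag [simp]: "dim_row (mat_diag n f) = n" "dim_col (mat_diag n f) = n"
  by (simp_all add: mat_diag_def)

lemma mat_diag_cong: "(\<And>i. i < n \<Longrightarrow> f i = g i) \<Longrightarrow> mat_diag n f = mat_diag n g"
  by (auto simp: mat_diag_def)

lemma minv_mat_diag:
  fixes f :: "nat \<Rightarrow> real"
  assumes "\<And>i. i < n \<Longrightarrow> f i \<noteq> 0"
  shows "minv (mat_diag n f) = mat_diag n (\<lambda>i. inverse (f i))"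
proof (rule minv_eqI[of _ n])
  have "mat_diag n (\<lambda>i. f i * inverse (f i)) = mat_diag n (\<lambda>_. 1)"
    using assms by (intro mat_diag_cong) auto
  thus "mat_diag n f * mat_diag n (\<lambda>i. inverse (f i)) = 1\<^sub>m n" by simp
qed auto

lemma mat_diag_index: "i < n \<Longrightarrow> j < n \<Longrightarrow> mat_diag n f $$ (i, j) = (if i = j then f i else 0)"
  by (auto simp: mat_diag_def)

lemma mat_diag_arith:
  fixes f g :: "nat \<Rightarrow> real"
  shows "mat_diag n f + mat_diag n g = mat_diag n (\<lambda>i. f i + g i)"
    and "mat_diag n f - mat_diag n g = mat_diag n (\<lambda>i. f i - g i)"
    and "- mat_diag n f = mat_diag n (\<lambda>i. - f i)"
    and "map_mat sqrt (mat_diag n f) = mat_diag n (\<lambda>i. sqrt (f i))"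
  by (auto simp: mat_diag_def)

lemma mat_diag_mult_vec:
  fixes f :: "nat \<Rightarrow> real"
  assumes "v \<in> carrier_vec n"
  shows "mat_diag n f *\<^sub>v v = vec n (\<lambda>i. f i * v $ i)"
proof (rule eq_vecI)
  fix i assume "i < dim_vec (vec n (\<lambda>i. f i * v $ i))"
  hence i: "i < n" by simp
  have "(mat_diag n f *\<^sub>v v) $ i = (\<Sum>k\<in>{0..<n}. (if i = k then f k else 0) * v $ k)"
    using i assms by (auto simp: mat_diag_def scalar_prod_def)
  also have "\<dots> = (\<Sum>k\<in>{0..<n}. if i = k then f k * v $ k else 0)"
    by (intro sum.cong) auto
  also have "\<dots> = f i * v $ i" using i by (simp add: sum.delta)
  finally show "(mat_diag n f *\<^sub>v v) $ i = vec n (\<lambda>i. f i * v $ i) $ i" using i by simp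
qed (auto simp: mat_diag_def)

lemma diagv_eq_mat_diag: "diagv v = mat_diag (dim_vec v) (\<lambda>i. v $ i)"
  by (simp add: diagv_def)

lemma diagonal_mat_eq_mat_diag:
  "A \<in> carrier_mat n n \<Longrightarrow> diagonal_mat A \<Longrightarrow> A = mat_diag n (\<lambda>i. A $$ (i, i))"
  by (auto simp: mat_diag_def diagonal_mat_def)

lemma ip_mat_diag:
  fixes f :: "nat \<Rightarrow> real"
  assumes "u \<in> carrier_vec n" "v \<in> carrier_vec n"
  shows "ip (mat_diag n f) u v = (\<Sum>i<n. f i * (u $ i * v $ i))"
  unfolding ip_def mat_diag_mult_vec[OF assms(2)] scalar_prod_def
  using assms by (auto simp: lessThan_atLeast0 intro!: sum.cong)

lemma transpose_mult_scalar_prod: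
  fixes T :: "real mat"
  assumes "T \<in> carrier_mat k n" "u \<in> carrier_vec n" "z \<in> carrier_vec k"
  shows "u \<bullet> (T\<^sup>T *\<^sub>v z) = (T *\<^sub>v u) \<bullet> z"
  using transpose_vec_mult_scalar[OF assms] comm_scalar_prod[of u n "T\<^sup>T *\<^sub>v z"]
    comm_scalar_prod[of "T *\<^sub>v u" k z] assms
  by simp

lemma scalar_prod_self_eq_0:
  fixes z :: "real vec"
  assumes "z \<in> carrier_vec k" "z \<bullet> z = 0"
  shows "z = 0\<^sub>v k"
proof -
  have "(\<Sum>i\<in>{0..<k}. z $ i * z $ i) = 0" using assms by (auto simp: scalar_prod_def)
  hence "\<forall>i\<in>{0..<k}. z $ i * z $ i = 0" by (subst (asm) sum_nonneg_eq_0_iff) auto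
  thus ?thesis using assms by (intro eq_vecI) auto
qed

lemma zero_mat_mult_vec: "v \<in> carrier_vec n \<Longrightarrow> 0\<^sub>m k n *\<^sub>v v = (0\<^sub>v k :: real vec)"
  by (intro eq_vecI) auto

lemma scalar_prod_uminus_mult_vec:
  fixes A B :: "real mat"
  assumes "B \<in> carrier_mat k m" "A \<in> carrier_mat m n" "a \<in> carrier_vec k" "v \<in> carrier_vec n"
  shows "a \<bullet> (B *\<^sub>v (- A *\<^sub>v v)) = - (a \<bullet> (B *\<^sub>v (A *\<^sub>v v)))"
proof -
  have "B *\<^sub>v (- A *\<^sub>v v) = - (B *\<^sub>v (A *\<^sub>v v))"
    using assms by (intro eq_vecI) (auto simp: uminus_mult_mat_vec)
  thus ?thesis using assms by simp
qed

lemma mult_vec_assoc3: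
  fixes A B C :: "real mat"
  assumes "A \<in> carrier_mat a b" "B \<in> carrier_mat b c" "C \<in> carrier_mat c d" "v \<in> carrier_vec d"
  shows "(A * B * C) *\<^sub>v v = A *\<^sub>v (B *\<^sub>v (C *\<^sub>v v))"
  using assoc_mult_mat_vec[OF mult_carrier_mat[OF assms(1,2)] assms(3,4)]
    assoc_mult_mat_vec[OF assms(1,2) mult_mat_vec_carrier[OF assms(3,4)]] by simp

lemma mult_vec_assoc4:
  fixes A B C D :: "real mat"
  assumes "A \<in> carrier_mat a b" "B \<in> carrier_mat b c" "C \<in> carrier_mat c d" "D \<in> carrier_mat d e"
    "v \<in> carrier_vec e"
  shows "(A * B * C * D) *\<^sub>v v = A *\<^sub>v (B *\<^sub>v (C *\<^sub>v (D *\<^sub>v v)))"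
  using assoc_mult_mat_vec[OF mult_carrier_mat[OF mult_carrier_mat[OF assms(1,2)] assms(3)] assms(4,5)]
    mult_vec_assoc3[OF assms(1-3) mult_mat_vec_carrier[OF assms(4,5)]] by simp

lemma ip_add_mat:
  assumes "A \<in> carrier_mat n n" "B \<in> carrier_mat n n" "u \<in> carrier_vec n" "v \<in> carrier_vec n"
  shows "ip (A + B) u v = ip A u v + ip B u v"
  unfolding ip_def add_mult_distrib_mat_vec[OF assms(1,2,4)]
  using assms by (intro scalar_prod_add_distrib[of _ n]) auto

lemma form_add_mat:
  fixes A B :: "real mat"
  assumes "A \<in> carrier_mat n m" "B \<in> carrier_mat n m" "u \<in> carrier_vec n" "v \<in> carrier_vec m"
  shows "u \<bullet> ((A + B) *\<^sub>v v) = u \<bullet> (A *\<^sub>v v) + u \<bullet> (B *\<^sub>v v)"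
  unfolding add_mult_distrib_mat_vec[OF assms(1,2,4)]
  using assms by (intro scalar_prod_add_distrib[of _ n]) auto

lemma form_add_vec:
  fixes A :: "real mat"
  assumes "A \<in> carrier_mat n m" "u \<in> carrier_vec n" "v \<in> carrier_vec m" "w \<in> carrier_vec m"
  shows "u \<bullet> (A *\<^sub>v (v + w)) = u \<bullet> (A *\<^sub>v v) + u \<bullet> (A *\<^sub>v w)"
  unfolding mult_add_distrib_mat_vec[OF assms(1,3,4)]
  using assms by (intro scalar_prod_add_distrib[of _ n]) auto

section \<open>The oblique projection onto the kernel of the constraints\<close>

text \<open>
The operator \<open>Pr\<close> below is the orthogonal projection onto the kernel of \<open>L\<close> for the inner product
\<open>x \<bullet> (H y)\<close>. Two of its properties carry the energy estimate: its range satisfies the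
constraints, and it is self-adjoint for this inner product.
\<close>

locale constraint_projection =
  fixes n k :: nat and h :: "nat \<Rightarrow> real" and H L :: "real mat"
  assumes H_eq: "H = mat_diag n h" and h_pos: "\<And>i. i < n \<Longrightarrow> 0 < h i"
    and L: "L \<in> carrier_mat k n"
    and L_surj: "\<And>z. z \<in> carrier_vec k \<Longrightarrow> \<exists>x\<in>carrier_vec n. L *\<^sub>v x = z"
begin

abbreviation S :: "real mat" where "S \<equiv> L * minv H * L\<^sup>T"

definition Pr :: "real mat" where "Pr = 1\<^sub>m n - minv H * L\<^sup>T * minv S * L"

lemma minv_H: "minv H = mat_diag n (\<lambda>i. inverse (h i))"
  unfolding H_eq using h_pos by (intro minv_mat_diag) force

lemma H_carrier [simp]: "H \<in> carrier_mat n n" "minv H \<in> carrier_mat n n"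
  by (simp_all add: minv_H) (simp add: H_eq)

lemma H_mult_minv_H:
  assumes "x \<in> carrier_vec n"
  shows "H *\<^sub>v (minv H *\<^sub>v x) = x"
proof -
  have h: "h i \<noteq> 0" if "i < n" for i using h_pos[OF that] by auto
  have "H *\<^sub>v (minv H *\<^sub>v x) = mat_diag n h *\<^sub>v (mat_diag n (\<lambda>i. inverse (h i)) *\<^sub>v x)"
    by (simp only: minv_H) (simp only: H_eq)
  also have "\<dots> = x"
    using assms h by (intro eq_vecI) (auto simp: mat_diag_mult_vec)
  finally show ?thesis .
qed

lemma H_symmetric:
  assumes "x \<in> carrier_vec n" "y \<in> carrier_vec n"
  shows "x \<bullet> (H *\<^sub>v y) = (H *\<^sub>v x) \<bullet> y"
  unfolding H_eq using assms
  by (auto simp: mat_diag_mult_vec scalar_prod_def intro!: sum.cong)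

lemma minv_H_symmetric:
  assumes "x \<in> carrier_vec n" "y \<in> carrier_vec n"
  shows "x \<bullet> (minv H *\<^sub>v y) = (minv H *\<^sub>v x) \<bullet> y"
  unfolding minv_H using assms
  by (auto simp: mat_diag_mult_vec scalar_prod_def intro!: sum.cong)

lemma L_transpose [simp]: "L\<^sup>T \<in> carrier_mat n k"
  using L by simp

lemma S_carrier: "S \<in> carrier_mat k k"
  using mult_carrier_mat[OF mult_carrier_mat[OF L H_carrier(2)] L_transpose] .

lemma S_mult_vec:
  assumes "z \<in> carrier_vec k"
  shows "S *\<^sub>v z = L *\<^sub>v (minv H *\<^sub>v (L\<^sup>T *\<^sub>v z))"
  using assms L assoc_mult_mat_vec[OF mult_carrier_mat[OF L H_carrier(2)] L_transpose assms]
    assoc_mult_mat_vec[OF L H_carrier(2), of "L\<^sup>T *\<^sub>v z"] L_transpose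
    mult_mat_vec_carrier[OF L_transpose assms]
  by simp

text \<open>
If \<open>S z = 0\<close>, then testing with \<open>z\<close> shows that \<open>L\<^sup>T z\<close> has norm zero, so \<open>z\<close> is orthogonal
to the range of \<open>L\<close>, which is the whole space.
\<close>

lemma det_S: "det S \<noteq> 0"
proof
  assume "det S = 0"
  then obtain z where z: "z \<in> carrier_vec k" "z \<noteq> 0\<^sub>v k" "S *\<^sub>v z = 0\<^sub>v k"
    using det_0_iff_vec_prod_zero[OF S_carrier] by auto
  define y where "y = L\<^sup>T *\<^sub>v z"
  have y: "y \<in> carrier_vec n" unfolding y_def using z L by simp
  have "0 = z \<bullet> (L *\<^sub>v (minv H *\<^sub>v y))"
    using z S_mult_vec[OF z(1)] y_def by simp
  also have "\<dots> = y \<bullet> (minv H *\<^sub>v y)"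
    unfolding y_def
    by (rule transpose_vec_mult_scalar[symmetric, OF L _ z(1)])
       (use mult_mat_vec_carrier[OF H_carrier(2) y] in \<open>simp add: y_def\<close>)
  also have "\<dots> = (\<Sum>i<n. inverse (h i) * (y $ i * y $ i))"
    using ip_mat_diag[OF y y] by (simp add: ip_def minv_H)
  finally have "(\<Sum>i<n. inverse (h i) * (y $ i * y $ i)) = 0" by simp
  moreover have "0 \<le> inverse (h i) * (y $ i * y $ i)" if "i < n" for i
    using h_pos[OF that] by simp
  ultimately have "\<forall>i\<in>{..<n}. inverse (h i) * (y $ i * y $ i) = 0"
    by (subst (asm) sum_nonneg_eq_0_iff) auto
  hence "y = 0\<^sub>v n"
    using h_pos y by (intro eq_vecI) force+
  moreover obtain x where x: "x \<in> carrier_vec n" "L *\<^sub>v x = z" using L_surj z by auto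
  ultimately have "z \<bullet> z = 0"
    using transpose_vec_mult_scalar[OF L x(1) z(1)] y_def by simp
  thus False using scalar_prod_self_eq_0 z by blast
qed

lemmas minv_S = minv_inverse[OF S_carrier det_S]

lemma minv_S_symmetric:
  assumes x: "x \<in> carrier_vec k" and y: "y \<in> carrier_vec k"
  shows "x \<bullet> (minv S *\<^sub>v y) = (minv S *\<^sub>v x) \<bullet> y"
proof -
  define p where "p = minv S *\<^sub>v x"
  define q where "q = minv S *\<^sub>v y"
  have p: "p \<in> carrier_vec k" and q: "q \<in> carrier_vec k"
    unfolding p_def q_def using minv_S x y by auto
  have "S *\<^sub>v p = x" "S *\<^sub>v q = y"
    unfolding p_def q_def using assoc_mult_mat_vec[OF S_carrier minv_S(1)] minv_S(2) x y
    by (metis one_mult_mat_vec)+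
  hence X: "x = L *\<^sub>v (minv H *\<^sub>v (L\<^sup>T *\<^sub>v p))" and Y: "y = L *\<^sub>v (minv H *\<^sub>v (L\<^sup>T *\<^sub>v q))"
    using S_mult_vec p q by auto
  have c: "L\<^sup>T *\<^sub>v p \<in> carrier_vec n" "L\<^sup>T *\<^sub>v q \<in> carrier_vec n"
    "minv H *\<^sub>v (L\<^sup>T *\<^sub>v p) \<in> carrier_vec n" "minv H *\<^sub>v (L\<^sup>T *\<^sub>v q) \<in> carrier_vec n"
    using p q mult_mat_vec_carrier[OF L_transpose] mult_mat_vec_carrier[OF H_carrier(2)] by auto
  have "x \<bullet> q = (minv H *\<^sub>v (L\<^sup>T *\<^sub>v p)) \<bullet> (L\<^sup>T *\<^sub>v q)"
    using transpose_mult_scalar_prod[OF L c(3) q] X by simp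
  also have "\<dots> = (L\<^sup>T *\<^sub>v p) \<bullet> (minv H *\<^sub>v (L\<^sup>T *\<^sub>v q))"
    using minv_H_symmetric c by simp
  also have "\<dots> = p \<bullet> y"
    using transpose_vec_mult_scalar[OF L c(4) p] Y by simp
  finally show ?thesis unfolding p_def q_def .
qed

lemma Pr_carrier: "Pr \<in> carrier_mat n n"
  unfolding Pr_def
  by (rule minus_carrier_mat,
      rule mult_carrier_mat[OF mult_carrier_mat[OF mult_carrier_mat[OF H_carrier(2) L_transpose] minv_S(1)] L])

lemma Pr_mult_vec:
  assumes x: "x \<in> carrier_vec n"
  shows "Pr *\<^sub>v x = x - minv H *\<^sub>v (L\<^sup>T *\<^sub>v (minv S *\<^sub>v (L *\<^sub>v x)))"
proof -
  note c = mult_carrier_mat[OF H_carrier(2) L_transpose]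
  have Lx: "L *\<^sub>v x \<in> carrier_vec k" using L x by simp
  have SLx: "minv S *\<^sub>v (L *\<^sub>v x) \<in> carrier_vec k" using minv_S(1) Lx by simp
  have "Pr *\<^sub>v x = x - (minv H * L\<^sup>T * minv S * L) *\<^sub>v x"
    unfolding Pr_def
    using minus_mult_distrib_mat_vec[OF one_carrier_mat mult_carrier_mat[OF mult_carrier_mat[OF c minv_S(1)] L] x] x
    by simp
  thus ?thesis
    using assoc_mult_mat_vec[OF mult_carrier_mat[OF c minv_S(1)] L x]
      assoc_mult_mat_vec[OF c minv_S(1) Lx] assoc_mult_mat_vec[OF H_carrier(2) L_transpose SLx]
    by simp
qed

text \<open>
The correction subtracted by \<open>Pr\<close> has constraint value \<open>S (minv S) (L x) = L x\<close>.
\<close>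

lemma L_Pr:
  assumes x: "x \<in> carrier_vec n"
  shows "L *\<^sub>v (Pr *\<^sub>v x) = 0\<^sub>v k"
proof -
  define q where "q = minv S *\<^sub>v (L *\<^sub>v x)"
  have Lx: "L *\<^sub>v x \<in> carrier_vec k" using L x by simp
  have q: "q \<in> carrier_vec k" unfolding q_def using minv_S(1) Lx by simp
  have c: "minv H *\<^sub>v (L\<^sup>T *\<^sub>v q) \<in> carrier_vec n"
    using q mult_mat_vec_carrier[OF L_transpose] mult_mat_vec_carrier[OF H_carrier(2)] by auto
  have "L *\<^sub>v (Pr *\<^sub>v x) = L *\<^sub>v x - S *\<^sub>v q"
    unfolding Pr_mult_vec[OF x] q_def[symmetric] S_mult_vec[OF q]
    by (rule mult_minus_distrib_mat_vec[OF L x c])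
  also have "S *\<^sub>v q = L *\<^sub>v x"
    unfolding q_def using assoc_mult_mat_vec[OF S_carrier minv_S(1) Lx] minv_S(2) Lx
    by simp
  finally show ?thesis using Lx by simp
qed

text \<open>
The factor \<open>H\<close> absorbs the inverse norm in front of the correction, leaving the matrix
\<open>L\<^sup>T (minv S) L\<close>, which is symmetric because \<open>S\<close> is.
\<close>

lemma Pr_self_adjoint:
  assumes x: "x \<in> carrier_vec n" and y: "y \<in> carrier_vec n"
  shows "x \<bullet> (H *\<^sub>v (Pr *\<^sub>v y)) = (Pr *\<^sub>v x) \<bullet> (H *\<^sub>v y)"
proof -
  define q where "q x = minv S *\<^sub>v (L *\<^sub>v x)" for x
  have Lz: "L *\<^sub>v z \<in> carrier_vec k" if "z \<in> carrier_vec n" for z using L that by simp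
  have q: "q z \<in> carrier_vec k" if "z \<in> carrier_vec n" for z
    unfolding q_def using minv_S(1) Lz[OF that] by simp
  have Lq: "L\<^sup>T *\<^sub>v q z \<in> carrier_vec n" if "z \<in> carrier_vec n" for z
    using q[OF that] mult_mat_vec_carrier[OF L_transpose] by auto
  have c: "minv H *\<^sub>v (L\<^sup>T *\<^sub>v q z) \<in> carrier_vec n" if "z \<in> carrier_vec n" for z
    using Lq[OF that] mult_mat_vec_carrier[OF H_carrier(2)] by auto
  have Hz: "H *\<^sub>v z \<in> carrier_vec n" if "z \<in> carrier_vec n" for z
    using that mult_mat_vec_carrier[OF H_carrier(1)] by auto
  have "H *\<^sub>v (Pr *\<^sub>v y) = H *\<^sub>v y - L\<^sup>T *\<^sub>v q y"
    unfolding Pr_mult_vec[OF y] q_def[symmetric]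
    using mult_minus_distrib_mat_vec[OF H_carrier(1) y c[OF y]] H_mult_minv_H[OF Lq[OF y]] by simp
  hence "x \<bullet> (H *\<^sub>v (Pr *\<^sub>v y)) = x \<bullet> (H *\<^sub>v y) - x \<bullet> (L\<^sup>T *\<^sub>v q y)"
    using scalar_prod_minus_distrib[OF x Hz[OF y] Lq[OF y]] by simp
  also have "x \<bullet> (L\<^sup>T *\<^sub>v q y) = (L *\<^sub>v x) \<bullet> q y"
    by (rule transpose_mult_scalar_prod[OF L x q[OF y]])
  also have "\<dots> = q x \<bullet> (L *\<^sub>v y)"
    unfolding q_def by (rule minv_S_symmetric[OF Lz[OF x] Lz[OF y]])
  also have "\<dots> = (L\<^sup>T *\<^sub>v q x) \<bullet> y"
    by (rule transpose_vec_mult_scalar[OF L y q[OF x], symmetric])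
  also have "\<dots> = (minv H *\<^sub>v (L\<^sup>T *\<^sub>v q x)) \<bullet> (H *\<^sub>v y)"
    using H_symmetric[OF c[OF x] y] H_mult_minv_H[OF Lq[OF x]] by simp
  finally show ?thesis
    unfolding Pr_mult_vec[OF x] q_def[symmetric]
    using minus_scalar_prod_distrib[OF x c[OF x] Hz[OF y]] by simp
qed

end

section \<open>Summation by parts on a line\<close>

text \<open>
Action of a one-dimensional operator on functions of one index. Grid lines in either direction of a
two-dimensional grid can then be treated alike, without extracting subvectors.
\<close>

definition line_op :: "nat \<Rightarrow> real mat \<Rightarrow> (nat \<Rightarrow> real) \<Rightarrow> nat \<Rightarrow> real" where
  "line_op n A f i = (\<Sum>k<n. A $$ (i, k) * f k)"

lemma line_op_cong:
  "(\<And>k. k < n \<Longrightarrow> f k = g k) \<Longrightarrow> line_op n A f i = line_op n A g i"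
  by (simp add: line_op_def)

lemma line_op_zero [simp]: "line_op n A (\<lambda>_. 0) i = 0"
  by (simp add: line_op_def)

definition norm_weight :: "sbp_ops \<Rightarrow> nat \<Rightarrow> real" where
  "norm_weight S i = H1 S $$ (i, i)"

locale sbp =
  fixes S :: sbp_ops
  assumes is_sbp: "is_sbp S"
begin

abbreviation m where "m \<equiv> npts S"
abbreviation h where "h \<equiv> norm_weight S"

lemma npts_pos: "0 < m"
  and H1_carrier: "H1 S \<in> carrier_mat m m" and H1_diagonal: "diagonal_mat (H1 S)"
  and norm_weight_pos: "i < m \<Longrightarrow> 0 < h i"
  and D1_carrier: "D1 S \<in> carrier_mat m m" and D1hat_carrier: "D1hat S \<in> carrier_mat m m"
  and D1_sbp: "H1 S * D1 S + (D1 S)\<^sup>T * H1 S = - ((elT S)\<^sup>T * elT S) + (erT S)\<^sup>T * erT S"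
  using is_sbp unfolding is_sbp_def Let_def norm_weight_def by auto

lemma D2c_carrier: "c \<in> carrier_vec m \<Longrightarrow> D2c S c \<in> carrier_mat m m"
  and R1c_carrier: "c \<in> carrier_vec m \<Longrightarrow> R1c S c \<in> carrier_mat m m"
  and D2c_sbp: "c \<in> carrier_vec m \<Longrightarrow> H1 S * D2c S c =
          - M1c S c - (unit_vec m 0 \<bullet> c) \<cdot>\<^sub>m ((elT S)\<^sup>T * dlT S)
          + (unit_vec m (m - 1) \<bullet> c) \<cdot>\<^sub>m ((erT S)\<^sup>T * drT S)"
  and R1c_symmetric: "c \<in> carrier_vec m \<Longrightarrow> (R1c S c)\<^sup>T = R1c S c"
  and R1c_psd: "c \<in> carrier_vec m \<Longrightarrow> (\<And>i. i < m \<Longrightarrow> 0 \<le> c $ i) \<Longrightarrow> v \<in> carrier_vec m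
      \<Longrightarrow> 0 \<le> sqnorm (R1c S c) v"
  using is_sbp unfolding is_sbp_def Let_def by auto

lemma H1_eq: "H1 S = mat_diag m h"
proof -
  have "h = (\<lambda>i. H1 S $$ (i, i))" by (simp add: fun_eq_iff norm_weight_def)
  thus ?thesis using diagonal_mat_eq_mat_diag[OF H1_carrier H1_diagonal] by simp
qed

lemma elT_carrier: "elT S \<in> carrier_mat 1 m" and erT_carrier: "erT S \<in> carrier_mat 1 m"
  by (auto simp: elT_def erT_def)

lemma elT_index: "k < m \<Longrightarrow> elT S $$ (0, k) = (if k = 0 then 1 else 0)"
  and erT_index: "k < m \<Longrightarrow> erT S $$ (0, k) = (if k = m - 1 then 1 else 0)"
  using npts_pos by (auto simp: elT_def erT_def mat_of_rows_def)

lemma trace_mult_index: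
  fixes T A :: "real mat"
  assumes T: "T \<in> carrier_mat 1 m" and E: "\<And>k. k < m \<Longrightarrow> T $$ (0, k) = (if k = b then 1 else 0)"
    and b: "b < m" and A: "A \<in> carrier_mat m n" and j: "j < n"
  shows "(T * A) $$ (0, j) = A $$ (b, j)"
proof -
  have "(T * A) $$ (0, j) = (\<Sum>k\<in>{0..<m}. (if k = b then 1 else 0) * A $$ (k, j))"
    using T A j E by (auto simp: scalar_prod_def intro!: sum.cong)
  also have "\<dots> = (\<Sum>k\<in>{0..<m}. if k = b then A $$ (k, j) else 0)"
    by (intro sum.cong) auto
  also have "\<dots> = A $$ (b, j)" using b by (simp add: sum.delta)
  finally show ?thesis .
qed

lemma dlT_carrier: "dlT S \<in> carrier_mat 1 m" and drT_carrier: "drT S \<in> carrier_mat 1 m"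
  using mult_carrier_mat[OF elT_carrier D1hat_carrier] mult_carrier_mat[OF erT_carrier D1hat_carrier]
  by (simp_all add: dlT_def drT_def)

lemma dlT_index: "j < m \<Longrightarrow> dlT S $$ (0, j) = D1hat S $$ (0, j)"
  and drT_index: "j < m \<Longrightarrow> drT S $$ (0, j) = D1hat S $$ (m - 1, j)"
  unfolding dlT_def drT_def
  using trace_mult_index[OF elT_carrier elT_index npts_pos D1hat_carrier]
    trace_mult_index[OF erT_carrier erT_index _ D1hat_carrier] npts_pos
  by simp_all

lemma trace_transpose_mult_index:
  assumes "T \<in> carrier_mat 1 m" "T' \<in> carrier_mat 1 m" "i < m" "j < m"
  shows "(T\<^sup>T * T') $$ (i, j) = T $$ (0, i) * T' $$ (0, j)"
  using assms by (auto simp: scalar_prod_def)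

lemma line_op_elT: "line_op m (elT S) f 0 = f 0"
  and line_op_erT: "line_op m (erT S) f 0 = f (m - 1)"
  and line_op_dlT: "line_op m (dlT S) f 0 = line_op m (D1hat S) f 0"
  and line_op_drT: "line_op m (drT S) f 0 = line_op m (D1hat S) f (m - 1)"
  using npts_pos
  by (simp_all add: line_op_def elT_index erT_index dlT_index drT_index if_distrib[of "\<lambda>x. x * _"]
        cong: if_cong)

lemma sum_boundary:
  "(\<Sum>i<m. \<Sum>j<m. f i * (elT S $$ (0, i) * g j)) = f 0 * (\<Sum>j<m. g j)"
  "(\<Sum>i<m. \<Sum>j<m. f i * (erT S $$ (0, i) * g j)) = f (m - 1) * (\<Sum>j<m. g j)"
  for f g :: "nat \<Rightarrow> real"
proof -
  have "(\<Sum>i<m. \<Sum>j<m. f i * (T $$ (0, i) * g j)) = f b * (\<Sum>j<m. g j)"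
    if E: "\<And>k. k < m \<Longrightarrow> T $$ (0, k) = (if k = b then 1 else 0)" and b: "b < m" for T b
  proof -
    have "(\<Sum>i<m. \<Sum>j<m. f i * (T $$ (0, i) * g j)) = (\<Sum>i<m. if i = b then f i * (\<Sum>j<m. g j) else 0)"
      using E by (intro sum.cong) (auto simp: sum_distrib_left)
    also have "\<dots> = f b * (\<Sum>j<m. g j)" using b by (simp add: sum.delta)
    finally show ?thesis .
  qed
  from this[OF elT_index npts_pos] this[OF erT_index] npts_pos
  show "(\<Sum>i<m. \<Sum>j<m. f i * (elT S $$ (0, i) * g j)) = f 0 * (\<Sum>j<m. g j)"
    "(\<Sum>i<m. \<Sum>j<m. f i * (erT S $$ (0, i) * g j)) = f (m - 1) * (\<Sum>j<m. g j)"
    by simp_all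
qed

lemma D1_sbp_index:
  assumes i: "i < m" and j: "j < m"
  shows "h i * D1 S $$ (i, j) + D1 S $$ (j, i) * h j =
    - (elT S $$ (0, i) * elT S $$ (0, j)) + erT S $$ (0, i) * erT S $$ (0, j)"
proof -
  have "(H1 S * D1 S) $$ (i, j) = h i * D1 S $$ (i, j)"
    using i j unfolding H1_eq by (subst mat_diag_mult_left[OF D1_carrier]) simp
  moreover have "((D1 S)\<^sup>T * H1 S) $$ (i, j) = D1 S $$ (j, i) * h j"
    using i j D1_carrier unfolding H1_eq by (subst mat_diag_mult_right[of _ m]) auto
  moreover have "(H1 S * D1 S + (D1 S)\<^sup>T * H1 S) $$ (i, j) =
      (H1 S * D1 S) $$ (i, j) + ((D1 S)\<^sup>T * H1 S) $$ (i, j)"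
    using i j D1_carrier H1_carrier by simp
  moreover have "(- ((elT S)\<^sup>T * elT S) + (erT S)\<^sup>T * erT S) $$ (i, j) =
      - (elT S $$ (0, i) * elT S $$ (0, j)) + erT S $$ (0, i) * erT S $$ (0, j)"
    using i j elT_carrier erT_carrier
    by (simp add: trace_transpose_mult_index[symmetric, OF elT_carrier elT_carrier i j]
        trace_transpose_mult_index[symmetric, OF erT_carrier erT_carrier i j])
  ultimately show ?thesis using D1_sbp by simp
qed

lemma D1_by_parts:
  "(\<Sum>i<m. h i * (f i * line_op m (D1 S) g i)) =
     - (\<Sum>i<m. h i * (line_op m (D1 S) f i * g i)) - f 0 * g 0 + f (m - 1) * g (m - 1)"
proof -
  have "(\<Sum>i<m. h i * (f i * line_op m (D1 S) g i)) = (\<Sum>i<m. \<Sum>j<m. f i * g j * (h i * D1 S $$ (i, j)))"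
    by (simp add: line_op_def sum_distrib_left mult_ac)
  moreover have "(\<Sum>i<m. h i * (line_op m (D1 S) f i * g i)) =
      (\<Sum>i<m. \<Sum>j<m. f i * g j * (D1 S $$ (j, i) * h j))"
    unfolding line_op_def sum_distrib_left sum_distrib_right
    by (subst sum.swap) (simp add: mult_ac)
  ultimately have "(\<Sum>i<m. h i * (f i * line_op m (D1 S) g i)) + (\<Sum>i<m. h i * (line_op m (D1 S) f i * g i)) =
      (\<Sum>i<m. \<Sum>j<m. f i * g j * (h i * D1 S $$ (i, j) + D1 S $$ (j, i) * h j))"
    by (simp add: sum.distrib distrib_left)
  also have "\<dots> = - (\<Sum>i<m. \<Sum>j<m. f i * (elT S $$ (0, i) * (elT S $$ (0, j) * g j)))
      + (\<Sum>i<m. \<Sum>j<m. f i * (erT S $$ (0, i) * (erT S $$ (0, j) * g j)))"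
    unfolding sum_negf[symmetric] sum.distrib[symmetric]
  proof (intro sum.cong refl)
    fix i j assume "i \<in> {..<m}" "j \<in> {..<m}"
    hence E: "h i * D1 S $$ (i, j) + D1 S $$ (j, i) * h j =
      - (elT S $$ (0, i) * elT S $$ (0, j)) + erT S $$ (0, i) * erT S $$ (0, j)"
      by (intro D1_sbp_index) auto
    show "f i * g j * (h i * D1 S $$ (i, j) + D1 S $$ (j, i) * h j) =
      - (f i * (elT S $$ (0, i) * (elT S $$ (0, j) * g j))) + f i * (erT S $$ (0, i) * (erT S $$ (0, j) * g j))"
      unfolding E by (simp add: algebra_simps)
  qed
  also have "\<dots> = - f 0 * g 0 + f (m - 1) * g (m - 1)"
    unfolding sum_boundary using line_op_elT[of g] line_op_erT[of g] by (simp add: line_op_def)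
  finally show ?thesis by simp
qed

lemma D2c_sbp_index:
  assumes c: "c \<in> carrier_vec m" and i: "i < m" and j: "j < m"
  shows "h i * D2c S c $$ (i, j) =
    - (\<Sum>k<m. h k * c $ k * (D1 S $$ (k, i) * D1 S $$ (k, j))) - R1c S c $$ (i, j)
    - c $ 0 * (elT S $$ (0, i) * D1hat S $$ (0, j))
    + c $ (m - 1) * (erT S $$ (0, i) * D1hat S $$ (m - 1, j))"
proof -
  have dc: "diagv c = mat_diag m (\<lambda>k. c $ k)" using c by (simp add: diagv_eq_mat_diag)
  have T: "(D1 S)\<^sup>T \<in> carrier_mat m m" using D1_carrier by simp
  have DH: "(D1 S)\<^sup>T * mat_diag m f \<in> carrier_mat m m" for f
    by (rule mult_carrier_mat[OF T]) simp
  have "(D1 S)\<^sup>T * H1 S * diagv c = (D1 S)\<^sup>T * mat_diag m (\<lambda>k. h k * c $ k)"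
    unfolding H1_eq dc by (subst assoc_mult_mat[OF T mat_diag_dim mat_diag_dim]) simp
  also have "\<dots> = mat m m (\<lambda>(i, k). D1 S $$ (k, i) * (h k * c $ k))"
    using D1_carrier by (subst mat_diag_mult_right[OF T]) auto
  finally have E: "(D1 S)\<^sup>T * H1 S * diagv c = mat m m (\<lambda>(i, k). D1 S $$ (k, i) * (h k * c $ k))" .
  have "((D1 S)\<^sup>T * H1 S * diagv c * D1 S) $$ (i, j) =
      (\<Sum>k<m. h k * c $ k * (D1 S $$ (k, i) * D1 S $$ (k, j)))"
    unfolding E using i j D1_carrier
    by (auto simp: scalar_prod_def lessThan_atLeast0 intro!: sum.cong)
  moreover have C: "(D1 S)\<^sup>T * H1 S * diagv c * D1 S \<in> carrier_mat m m"
    unfolding E using D1_carrier by (intro mult_carrier_mat[of _ m m]) auto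
  ultimately have M: "M1c S c $$ (i, j) =
      (\<Sum>k<m. h k * c $ k * (D1 S $$ (k, i) * D1 S $$ (k, j))) + R1c S c $$ (i, j)"
    and Mc: "M1c S c \<in> carrier_mat m m"
    using i j R1c_carrier[OF c] by (auto simp: M1c_def)
  have "(H1 S * D2c S c) $$ (i, j) = h i * D2c S c $$ (i, j)"
    using i j unfolding H1_eq by (subst mat_diag_mult_left[OF D2c_carrier[OF c]]) simp
  moreover have "unit_vec m 0 \<bullet> c = c $ 0" "unit_vec m (m - 1) \<bullet> c = c $ (m - 1)"
    using c npts_pos by (auto intro: scalar_prod_left_unit)
  moreover have "((elT S)\<^sup>T * dlT S) $$ (i, j) = elT S $$ (0, i) * D1hat S $$ (0, j)"
    "((erT S)\<^sup>T * drT S) $$ (i, j) = erT S $$ (0, i) * D1hat S $$ (m - 1, j)"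
    using i j trace_transpose_mult_index[OF elT_carrier dlT_carrier i j]
      trace_transpose_mult_index[OF erT_carrier drT_carrier i j] dlT_index drT_index by simp_all
  moreover have "(elT S)\<^sup>T * dlT S \<in> carrier_mat m m" "(erT S)\<^sup>T * drT S \<in> carrier_mat m m"
    using elT_carrier dlT_carrier erT_carrier drT_carrier by (auto intro!: mult_carrier_mat[of _ m 1])
  moreover have "(- M1c S c - a \<cdot>\<^sub>m A + b \<cdot>\<^sub>m B) $$ (i, j) =
      - M1c S c $$ (i, j) - a * A $$ (i, j) + b * B $$ (i, j)"
    if "A \<in> carrier_mat m m" "B \<in> carrier_mat m m" for a b A B
    using that Mc i j by simp
  ultimately show ?thesis
    using D2c_sbp[OF c] M by simp
qed

text \<open>
The discrete counterpart of integrating \<open>f (c g')'\<close> by parts. The remainder \<open>R1c\<close> has no continuous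
analogue; it stays in the energy, where nonnegative coefficients make it positive semidefinite.
\<close>

lemma D2c_by_parts:
  assumes c: "c \<in> carrier_vec m"
  shows "(\<Sum>i<m. h i * (f i * line_op m (D2c S c) g i)) =
     - (\<Sum>i<m. h i * (c $ i * (line_op m (D1 S) f i * line_op m (D1 S) g i)))
     - (\<Sum>i<m. f i * line_op m (R1c S c) g i)
     - f 0 * (c $ 0 * line_op m (D1hat S) g 0)
     + f (m - 1) * (c $ (m - 1) * line_op m (D1hat S) g (m - 1))"
proof -
  have "(\<Sum>i<m. h i * (f i * line_op m (D2c S c) g i)) =
      (\<Sum>i<m. \<Sum>j<m. f i * g j * (h i * D2c S c $$ (i, j)))"
    by (simp add: line_op_def sum_distrib_left mult_ac)
  also have "\<dots> = (\<Sum>i<m. \<Sum>j<m. - (f i * g j * (\<Sum>k<m. h k * c $ k * (D1 S $$ (k, i) * D1 S $$ (k, j))))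
       - f i * (R1c S c $$ (i, j) * g j)
       - f i * (elT S $$ (0, i) * (c $ 0 * D1hat S $$ (0, j) * g j))
       + f i * (erT S $$ (0, i) * (c $ (m - 1) * D1hat S $$ (m - 1, j) * g j)))"
    by (intro sum.cong refl) (simp add: D2c_sbp_index[OF c] algebra_simps)
  also have "\<dots> = - (\<Sum>i<m. \<Sum>j<m. f i * g j * (\<Sum>k<m. h k * c $ k * (D1 S $$ (k, i) * D1 S $$ (k, j))))
       - (\<Sum>i<m. \<Sum>j<m. f i * (R1c S c $$ (i, j) * g j))
       - (\<Sum>i<m. \<Sum>j<m. f i * (elT S $$ (0, i) * (c $ 0 * D1hat S $$ (0, j) * g j)))
       + (\<Sum>i<m. \<Sum>j<m. f i * (erT S $$ (0, i) * (c $ (m - 1) * D1hat S $$ (m - 1, j) * g j)))"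
    by (simp only: sum.distrib sum_subtractf sum_negf)
  also have "(\<Sum>i<m. \<Sum>j<m. f i * g j * (\<Sum>k<m. h k * c $ k * (D1 S $$ (k, i) * D1 S $$ (k, j)))) =
      (\<Sum>k<m. \<Sum>i<m. \<Sum>j<m. h k * c $ k * ((D1 S $$ (k, i) * f i) * (D1 S $$ (k, j) * g j)))"
  proof -
    define F where "F i j k = h k * c $ k * ((D1 S $$ (k, i) * f i) * (D1 S $$ (k, j) * g j))" for i j k
    have "(\<Sum>i<m. \<Sum>j<m. f i * g j * (\<Sum>k<m. h k * c $ k * (D1 S $$ (k, i) * D1 S $$ (k, j)))) =
        (\<Sum>i<m. \<Sum>j<m. \<Sum>k<m. F i j k)"
      by (simp add: F_def sum_distrib_left mult_ac)
    also have "\<dots> = (\<Sum>i<m. \<Sum>k<m. \<Sum>j<m. F i j k)"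
      by (rule sum.cong[OF refl sum.swap])
    also have "\<dots> = (\<Sum>k<m. \<Sum>i<m. \<Sum>j<m. F i j k)" by (rule sum.swap)
    finally show ?thesis unfolding F_def .
  qed
  also have "\<dots> = (\<Sum>k<m. h k * (c $ k * (line_op m (D1 S) f k * line_op m (D1 S) g k)))"
    unfolding line_op_def sum_product by (simp add: sum_distrib_left mult_ac)
  finally show ?thesis
    unfolding sum_boundary by (simp add: line_op_def sum_distrib_left mult_ac)
qed

lemma R1c_form_symmetric:
  assumes c: "c \<in> carrier_vec m"
  shows "(\<Sum>i<m. f i * line_op m (R1c S c) g i) = (\<Sum>i<m. g i * line_op m (R1c S c) f i)"
proof -
  have R: "R1c S c $$ (i, j) = R1c S c $$ (j, i)" if "i < m" "j < m" for i j
    using arg_cong[OF R1c_symmetric[OF c], of "\<lambda>A. A $$ (i, j)"] R1c_carrier[OF c] that by simp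
  have "(\<Sum>i<m. f i * line_op m (R1c S c) g i) = (\<Sum>i<m. \<Sum>j<m. f i * (R1c S c $$ (i, j) * g j))"
    by (simp add: line_op_def sum_distrib_left)
  also have "\<dots> = (\<Sum>j<m. \<Sum>i<m. f i * (R1c S c $$ (i, j) * g j))" by (rule sum.swap)
  also have "\<dots> = (\<Sum>i<m. g i * line_op m (R1c S c) f i)"
    by (auto simp: line_op_def sum_distrib_left R mult_ac intro!: sum.cong)
  finally show ?thesis .
qed

lemma R1c_form_nonneg:
  assumes c: "c \<in> carrier_vec m" "\<And>i. i < m \<Longrightarrow> 0 \<le> c $ i"
  shows "0 \<le> (\<Sum>i<m. f i * line_op m (R1c S c) f i)"
proof -
  have "(\<Sum>i<m. f i * line_op m (R1c S c) f i) = sqnorm (R1c S c) (vec m f)"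
    using R1c_carrier[OF c(1)]
    by (auto simp: sqnorm_def ip_def scalar_prod_def line_op_def lessThan_atLeast0 intro!: sum.cong)
  thus ?thesis using R1c_psd[OF c, of "vec m f"] by simp
qed

end

section \<open>Summation by parts on a tensor-product grid\<close>

text \<open>
Multiplies a one-dimensional identity by the quadrature weight of its grid line.
\<close>

lemma scale_by_parts:
  fixes y e p q r s :: real
  shows "e = - p - q - r + s \<Longrightarrow> y * e = - (y * p) - y * q - y * r + y * s"
    and "e = - p - r + s \<Longrightarrow> y * e = - (y * p) - y * r + y * s"
  by (simp_all only: right_diff_distrib distrib_left mult_minus_right)

locale sbp_grid =
  fixes G :: "'z tensor_grid_scheme"
  assumes sbp_ops1: "is_sbp (ops1 G)" and sbp_ops2: "is_sbp (ops2 G)"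
begin

sublocale x: sbp "ops1 G" by standard (rule sbp_ops1)
sublocale y: sbp "ops2 G" by standard (rule sbp_ops2)

abbreviation N where "N \<equiv> npoints G"

definition dx :: "(nat \<Rightarrow> nat \<Rightarrow> real) \<Rightarrow> nat \<Rightarrow> nat \<Rightarrow> real" where
  "dx u i j = line_op x.m (D1 (ops1 G)) (\<lambda>k. u k j) i"

definition dy :: "(nat \<Rightarrow> nat \<Rightarrow> real) \<Rightarrow> nat \<Rightarrow> nat \<Rightarrow> real" where
  "dy u i j = line_op y.m (D1 (ops2 G)) (\<lambda>k. u i k) j"

definition dxhat :: "(nat \<Rightarrow> nat \<Rightarrow> real) \<Rightarrow> nat \<Rightarrow> nat \<Rightarrow> real" where
  "dxhat u i j = line_op x.m (D1hat (ops1 G)) (\<lambda>k. u k j) i"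

definition dyhat :: "(nat \<Rightarrow> nat \<Rightarrow> real) \<Rightarrow> nat \<Rightarrow> nat \<Rightarrow> real" where
  "dyhat u i j = line_op y.m (D1hat (ops2 G)) (\<lambda>k. u i k) j"

text \<open>
The operator \<open>(a v_x)_x + (b v_x)_y + (b v_y)_x + (c v_y)_y\<close>, with the compact second-derivative
operators for the unmixed terms.
\<close>

definition elliptic ::
  "(nat \<Rightarrow> nat \<Rightarrow> real) \<Rightarrow> (nat \<Rightarrow> nat \<Rightarrow> real) \<Rightarrow> (nat \<Rightarrow> nat \<Rightarrow> real) \<Rightarrow> (nat \<Rightarrow> nat \<Rightarrow> real) \<Rightarrow> nat \<Rightarrow> nat \<Rightarrow> real"
  where
  "elliptic a b c v i j =
     line_op x.m (D2c (ops1 G) (vec x.m (\<lambda>k. a k j))) (\<lambda>k. v k j) i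
     + dy (\<lambda>i j. b i j * dx v i j) i j + dx (\<lambda>i j. b i j * dy v i j) i j
     + line_op y.m (D2c (ops2 G) (vec y.m (\<lambda>k. c i k))) (\<lambda>k. v i k) j"

definition grid_sum :: "(nat \<Rightarrow> nat \<Rightarrow> real) \<Rightarrow> real" where
  "grid_sum F = (\<Sum>i<x.m. \<Sum>j<y.m. x.h i * y.h j * F i j)"

definition remainder_form ::
  "(nat \<Rightarrow> nat \<Rightarrow> real) \<Rightarrow> (nat \<Rightarrow> nat \<Rightarrow> real) \<Rightarrow> (nat \<Rightarrow> nat \<Rightarrow> real) \<Rightarrow> (nat \<Rightarrow> nat \<Rightarrow> real) \<Rightarrow> real" where
  "remainder_form a c u v =
     (\<Sum>j<y.m. y.h j * (\<Sum>i<x.m. u i j * line_op x.m (R1c (ops1 G) (vec x.m (\<lambda>k. a k j))) (\<lambda>k. v k j) i))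
     + (\<Sum>i<x.m. x.h i * (\<Sum>j<y.m. u i j * line_op y.m (R1c (ops2 G) (vec y.m (\<lambda>k. c i k))) (\<lambda>k. v i k) j))"

definition energy_form ::
  "(nat \<Rightarrow> nat \<Rightarrow> real) \<Rightarrow> (nat \<Rightarrow> nat \<Rightarrow> real) \<Rightarrow> (nat \<Rightarrow> nat \<Rightarrow> real) \<Rightarrow> (nat \<Rightarrow> nat \<Rightarrow> real) \<Rightarrow> (nat \<Rightarrow> nat \<Rightarrow> real) \<Rightarrow> real"
  where
  "energy_form a b c u v =
     grid_sum (\<lambda>i j. a i j * (dx u i j * dx v i j)
       + b i j * (dx u i j * dy v i j + dy u i j * dx v i j)
       + c i j * (dy u i j * dy v i j)) + remainder_form a c u v"

text \<open>
The conormal flux \<open>a v_x + b v_y\<close> through the grid column \<open>k\<close>, tested with \<open>u\<close>. As in the scheme, the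
normal derivative uses \<open>D1hat\<close> and the tangential one uses \<open>D1\<close>. Only \<open>k = 0\<close> and the last column occur.
\<close>

definition xflux where
  "xflux a b k u v = (\<Sum>j<y.m. y.h j * (u k j * (a k j * dxhat v k j + b k j * dy v k j)))"

definition yflux where
  "yflux b c k u v = (\<Sum>i<x.m. x.h i * (u i k * (c i k * dyhat v i k + b i k * dx v i k)))"

lemma grid_sum_columns: "grid_sum F = (\<Sum>j<y.m. y.h j * (\<Sum>i<x.m. x.h i * F i j))"
  unfolding grid_sum_def by (subst sum.swap) (simp add: sum_distrib_left mult_ac)

lemma grid_sum_rows: "grid_sum F = (\<Sum>i<x.m. x.h i * (\<Sum>j<y.m. y.h j * F i j))"
  unfolding grid_sum_def by (simp add: sum_distrib_left mult_ac)

lemma grid_sum_add: "grid_sum (\<lambda>i j. F i j + F' i j) = grid_sum F + grid_sum F'"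
  by (simp add: grid_sum_def sum.distrib distrib_left)

lemma grid_sum_cong:
  "(\<And>i j. i < x.m \<Longrightarrow> j < y.m \<Longrightarrow> F i j = F' i j) \<Longrightarrow> grid_sum F = grid_sum F'"
  by (simp add: grid_sum_def)

lemma grid_sum_nonneg:
  "(\<And>i j. i < x.m \<Longrightarrow> j < y.m \<Longrightarrow> 0 \<le> F i j) \<Longrightarrow> 0 \<le> grid_sum F"
  unfolding grid_sum_def
  by (intro sum_nonneg mult_nonneg_nonneg) (auto intro: less_imp_le x.norm_weight_pos y.norm_weight_pos)

lemma elliptic_x_by_parts:
  "grid_sum (\<lambda>i j. u i j * line_op x.m (D2c (ops1 G) (vec x.m (\<lambda>k. a k j))) (\<lambda>k. v k j) i) =
     - grid_sum (\<lambda>i j. a i j * (dx u i j * dx v i j))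
     - (\<Sum>j<y.m. y.h j * (\<Sum>i<x.m. u i j * line_op x.m (R1c (ops1 G) (vec x.m (\<lambda>k. a k j))) (\<lambda>k. v k j) i))
     - (\<Sum>j<y.m. y.h j * (u 0 j * (a 0 j * dxhat v 0 j)))
     + (\<Sum>j<y.m. y.h j * (u (x.m - 1) j * (a (x.m - 1) j * dxhat v (x.m - 1) j)))"
  unfolding grid_sum_columns sum_negf[symmetric] sum_subtractf[symmetric] sum.distrib[symmetric]
proof (intro sum.cong refl)
  fix j
  show "y.h j * (\<Sum>i<x.m. x.h i * (u i j * line_op x.m (D2c (ops1 G) (vec x.m (\<lambda>k. a k j))) (\<lambda>k. v k j) i)) =
     - (y.h j * (\<Sum>i<x.m. x.h i * (a i j * (dx u i j * dx v i j))))
     - y.h j * (\<Sum>i<x.m. u i j * line_op x.m (R1c (ops1 G) (vec x.m (\<lambda>k. a k j))) (\<lambda>k. v k j) i)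
     - y.h j * (u 0 j * (a 0 j * dxhat v 0 j))
     + y.h j * (u (x.m - 1) j * (a (x.m - 1) j * dxhat v (x.m - 1) j))"
    using x.D2c_by_parts[of "vec x.m (\<lambda>k. a k j)" "\<lambda>k. u k j" "\<lambda>k. v k j"] x.npts_pos
    by (intro scale_by_parts) (simp add: dx_def dxhat_def)
qed

lemma elliptic_y_by_parts:
  "grid_sum (\<lambda>i j. u i j * line_op y.m (D2c (ops2 G) (vec y.m (\<lambda>k. c i k))) (\<lambda>k. v i k) j) =
     - grid_sum (\<lambda>i j. c i j * (dy u i j * dy v i j))
     - (\<Sum>i<x.m. x.h i * (\<Sum>j<y.m. u i j * line_op y.m (R1c (ops2 G) (vec y.m (\<lambda>k. c i k))) (\<lambda>k. v i k) j))
     - (\<Sum>i<x.m. x.h i * (u i 0 * (c i 0 * dyhat v i 0)))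
     + (\<Sum>i<x.m. x.h i * (u i (y.m - 1) * (c i (y.m - 1) * dyhat v i (y.m - 1))))"
  unfolding grid_sum_rows sum_negf[symmetric] sum_subtractf[symmetric] sum.distrib[symmetric]
proof (intro sum.cong refl)
  fix i
  show "x.h i * (\<Sum>j<y.m. y.h j * (u i j * line_op y.m (D2c (ops2 G) (vec y.m (\<lambda>k. c i k))) (\<lambda>k. v i k) j)) =
     - (x.h i * (\<Sum>j<y.m. y.h j * (c i j * (dy u i j * dy v i j))))
     - x.h i * (\<Sum>j<y.m. u i j * line_op y.m (R1c (ops2 G) (vec y.m (\<lambda>k. c i k))) (\<lambda>k. v i k) j)
     - x.h i * (u i 0 * (c i 0 * dyhat v i 0))
     + x.h i * (u i (y.m - 1) * (c i (y.m - 1) * dyhat v i (y.m - 1)))"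
    using y.D2c_by_parts[of "vec y.m (\<lambda>k. c i k)" "\<lambda>k. u i k" "\<lambda>k. v i k"] y.npts_pos
    by (intro scale_by_parts) (simp add: dy_def dyhat_def)
qed

lemma dx_by_parts:
  "grid_sum (\<lambda>i j. u i j * dx g i j) =
     - grid_sum (\<lambda>i j. dx u i j * g i j)
     - (\<Sum>j<y.m. y.h j * (u 0 j * g 0 j)) + (\<Sum>j<y.m. y.h j * (u (x.m - 1) j * g (x.m - 1) j))"
  unfolding grid_sum_columns sum_negf[symmetric] sum_subtractf[symmetric] sum.distrib[symmetric]
  using x.D1_by_parts[of "\<lambda>k. u k _" "\<lambda>k. g k _"]
  by (intro sum.cong refl scale_by_parts(2)) (simp add: dx_def)

lemma dy_by_parts:
  "grid_sum (\<lambda>i j. u i j * dy g i j) =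
     - grid_sum (\<lambda>i j. dy u i j * g i j)
     - (\<Sum>i<x.m. x.h i * (u i 0 * g i 0)) + (\<Sum>i<x.m. x.h i * (u i (y.m - 1) * g i (y.m - 1)))"
  unfolding grid_sum_rows sum_negf[symmetric] sum_subtractf[symmetric] sum.distrib[symmetric]
  using y.D1_by_parts[of "\<lambda>k. u _ k" "\<lambda>k. g _ k"]
  by (intro sum.cong refl scale_by_parts(2)) (simp add: dy_def)

text \<open>
Green's formula. Each unmixed term contributes one entry of the energy density and a normal flux;
the two mixed terms exchange the derivatives and so contribute the symmetric cross term and the
tangential fluxes.
\<close>

lemma green:
  "grid_sum (\<lambda>i j. u i j * elliptic a b c v i j) =
     - energy_form a b c u v - xflux a b 0 u v + xflux a b (x.m - 1) u v
     - yflux b c 0 u v + yflux b c (y.m - 1) u v"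
proof -
  have "grid_sum (\<lambda>i j. u i j * elliptic a b c v i j) =
      grid_sum (\<lambda>i j. u i j * line_op x.m (D2c (ops1 G) (vec x.m (\<lambda>k. a k j))) (\<lambda>k. v k j) i)
      + grid_sum (\<lambda>i j. u i j * dy (\<lambda>i j. b i j * dx v i j) i j)
      + grid_sum (\<lambda>i j. u i j * dx (\<lambda>i j. b i j * dy v i j) i j)
      + grid_sum (\<lambda>i j. u i j * line_op y.m (D2c (ops2 G) (vec y.m (\<lambda>k. c i k))) (\<lambda>k. v i k) j)"
    unfolding grid_sum_add[symmetric] elliptic_def by (simp add: distrib_left)
  moreover have "energy_form a b c u v =
      grid_sum (\<lambda>i j. a i j * (dx u i j * dx v i j)) + grid_sum (\<lambda>i j. dy u i j * (b i j * dx v i j))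
      + grid_sum (\<lambda>i j. dx u i j * (b i j * dy v i j)) + grid_sum (\<lambda>i j. c i j * (dy u i j * dy v i j))
      + remainder_form a c u v"
    unfolding grid_sum_add[symmetric] energy_form_def by (simp add: algebra_simps)
  ultimately show ?thesis
    unfolding elliptic_x_by_parts elliptic_y_by_parts dx_by_parts dy_by_parts remainder_form_def xflux_def yflux_def
    by (simp add: sum.distrib distrib_left)
qed

lemma remainder_form_symmetric: "remainder_form a c u v = remainder_form a c v u"
  unfolding remainder_form_def
  using x.R1c_form_symmetric[of "vec x.m (\<lambda>k. a k _)" "\<lambda>k. u k _" "\<lambda>k. v k _"]
    y.R1c_form_symmetric[of "vec y.m (\<lambda>k. c _ k)" "\<lambda>k. u _ k" "\<lambda>k. v _ k"]
  by simp

lemma remainder_form_nonneg: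
  assumes "\<And>i j. i < x.m \<Longrightarrow> j < y.m \<Longrightarrow> 0 \<le> a i j" "\<And>i j. i < x.m \<Longrightarrow> j < y.m \<Longrightarrow> 0 \<le> c i j"
  shows "0 \<le> remainder_form a c u u"
  unfolding remainder_form_def
  using assms x.norm_weight_pos y.norm_weight_pos
  by (intro add_nonneg_nonneg sum_nonneg mult_nonneg_nonneg x.R1c_form_nonneg y.R1c_form_nonneg)
     (auto intro: less_imp_le)

section \<open>Grid functions as vectors\<close>

definition grid_fn :: "real vec \<Rightarrow> nat \<Rightarrow> nat \<Rightarrow> real" where
  "grid_fn v i j = v $ (i * y.m + j)"

lemma index_less: "i < k \<Longrightarrow> j < n \<Longrightarrow> i * n + j < k * n" for i j k n :: nat
proof -
  assume "i < k" "j < n"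
  hence "i * n + j < Suc i * n" "Suc i * n \<le> k * n" by (simp, intro mult_le_mono1, simp)
  thus ?thesis by linarith
qed

lemma grid_index_less: "i < x.m \<Longrightarrow> j < y.m \<Longrightarrow> i * y.m + j < N"
  unfolding npoints_def by (rule index_less)

lemma grid_indexE:
  assumes "p < N"
  obtains i j where "i < x.m" "j < y.m" "p = i * y.m + j"
proof
  show "p div y.m < x.m" using assms y.npts_pos by (simp add: npoints_def less_mult_imp_div_less)
  show "p mod y.m < y.m" using y.npts_pos by simp
qed simp

lemma sum_index: "(\<Sum>p<k * n. F p) = (\<Sum>i<k. \<Sum>j<n. F (i * n + j))"
  for k n :: nat and F :: "nat \<Rightarrow> real"
proof (induction k)
  case (Suc k)
  have split: "(\<Sum>p<a + n. F p) = (\<Sum>p<a. F p) + (\<Sum>j<n. F (a + j))" for a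
    by (induction n) (simp_all add: add.assoc)
  have "(\<Sum>p<Suc k * n. F p) = (\<Sum>p<k * n + n. F p)" by (simp add: add.commute)
  also have "\<dots> = (\<Sum>p<k * n. F p) + (\<Sum>j<n. F (k * n + j))"
    by (rule split)
  finally show ?case using Suc by simp
qed simp

lemma scalar_prod_grid:
  assumes "u \<in> carrier_vec N" "v \<in> carrier_vec N"
  shows "u \<bullet> v = (\<Sum>i<x.m. \<Sum>j<y.m. grid_fn u i j * grid_fn v i j)"
  using assms
  by (simp add: scalar_prod_def lessThan_atLeast0[symmetric] npoints_def sum_index grid_fn_def)

lemma dir1_carrier: "A \<in> carrier_mat k x.m \<Longrightarrow> dir1 G A \<in> carrier_mat (k * y.m) N"
  and dir2_carrier: "B \<in> carrier_mat k y.m \<Longrightarrow> dir2 G B \<in> carrier_mat (x.m * k) N"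
  by (auto simp: dir1_def dir2_def kron_def npoints_def)

lemma dir1_index:
  assumes "A \<in> carrier_mat k x.m" "i < k" "j < y.m" "i' < x.m" "j' < y.m"
  shows "dir1 G A $$ (i * y.m + j, i' * y.m + j') = (if j = j' then A $$ (i, i') else 0)"
  using assms index_less[of i k j y.m] index_less[of i' x.m j' y.m]
  by (auto simp: dir1_def kron_def)

lemma dir2_index:
  assumes "B \<in> carrier_mat k y.m" "i < x.m" "j < k" "i' < x.m" "j' < y.m"
  shows "dir2 G B $$ (i * k + j, i' * y.m + j') = (if i = i' then B $$ (j, j') else 0)"
  using assms index_less[of i x.m j k] index_less[of i' x.m j' y.m]
  by (auto simp: dir2_def kron_def)

lemma mult_vec_grid_index:
  assumes "A \<in> carrier_mat k N" "v \<in> carrier_vec N" "p < k"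
  shows "(A *\<^sub>v v) $ p = (\<Sum>i<x.m. \<Sum>j<y.m. A $$ (p, i * y.m + j) * grid_fn v i j)"
  using assms grid_index_less
  by (simp add: scalar_prod_def lessThan_atLeast0[symmetric] npoints_def sum_index grid_fn_def)

lemma dir1_mult_vec:
  assumes A: "A \<in> carrier_mat k x.m" and v: "v \<in> carrier_vec N" and "i < k" "j < y.m"
  shows "(dir1 G A *\<^sub>v v) $ (i * y.m + j) = line_op x.m A (\<lambda>l. grid_fn v l j) i"
proof -
  have "(dir1 G A *\<^sub>v v) $ (i * y.m + j) =
      (\<Sum>i'<x.m. \<Sum>j'<y.m. if j = j' then A $$ (i, i') * grid_fn v i' j' else 0)"
    using assms by (subst mult_vec_grid_index[OF dir1_carrier[OF A] v])
      (simp_all add: index_less dir1_index[OF A] if_distrib[of "\<lambda>x. x * _"] cong: if_cong)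
  thus ?thesis using assms by (simp add: line_op_def)
qed

lemma dir2_mult_vec:
  assumes B: "B \<in> carrier_mat k y.m" and v: "v \<in> carrier_vec N" and "i < x.m" "j < k"
  shows "(dir2 G B *\<^sub>v v) $ (i * k + j) = line_op y.m B (\<lambda>l. grid_fn v i l) j"
proof -
  have "(dir2 G B *\<^sub>v v) $ (i * k + j) =
      (\<Sum>i'<x.m. \<Sum>j'<y.m. if i = i' then B $$ (j, j') * grid_fn v i' j' else 0)"
    using assms by (subst mult_vec_grid_index[OF dir2_carrier[OF B] v])
      (simp_all add: index_less dir2_index[OF B] if_distrib[of "\<lambda>x. x * _"] cong: if_cong)
  also have "\<dots> = (\<Sum>i'<x.m. if i = i' then \<Sum>j'<y.m. B $$ (j, j') * grid_fn v i' j' else 0)"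
    by (intro sum.cong) auto
  finally show ?thesis using assms by (simp add: line_op_def)
qed

lemma dir1_diag: "dir1 G (mat_diag x.m f) = mat_diag N (\<lambda>p. f (p div y.m))"
  and dir2_diag: "dir2 G (mat_diag y.m f) = mat_diag N (\<lambda>p. f (p mod y.m))"
proof (safe intro!: eq_matI)
  fix p q assume "p < dim_row (mat_diag N (\<lambda>p. f (p div y.m)))" "q < dim_col (mat_diag N (\<lambda>p. f (p div y.m)))"
  hence "p < N" "q < N" by (auto simp: mat_diag_def)
  then obtain i j i' j' where "i < x.m" "j < y.m" "p = i * y.m + j" "i' < x.m" "j' < y.m" "q = i' * y.m + j'"
    by (elim grid_indexE) blast
  thus "dir1 G (mat_diag x.m f) $$ (p, q) = mat_diag N (\<lambda>p. f (p div y.m)) $$ (p, q)"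
    using grid_index_less
    by (auto simp: dir1_index[of _ x.m] mat_diag_index)
       (metis div_mult_self3 mod_mult_self3 div_less add.right_neutral mod_less gr_implies_not_zero)+
next
  fix p q assume "p < dim_row (mat_diag N (\<lambda>p. f (p mod y.m)))" "q < dim_col (mat_diag N (\<lambda>p. f (p mod y.m)))"
  hence "p < N" "q < N" by (auto simp: mat_diag_def)
  then obtain i j i' j' where "i < x.m" "j < y.m" "p = i * y.m + j" "i' < x.m" "j' < y.m" "q = i' * y.m + j'"
    by (elim grid_indexE) blast
  thus "dir2 G (mat_diag y.m f) $$ (p, q) = mat_diag N (\<lambda>p. f (p mod y.m)) $$ (p, q)"
    using grid_index_less
    by (auto simp: dir2_index[of _ y.m] mat_diag_index)
       (metis div_mult_self3 mod_mult_self3 div_less add.right_neutral mod_less gr_implies_not_zero)+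
qed (auto simp: mat_diag_def dir1_def dir2_def kron_def npoints_def)

lemma H_fst_eq: "H_fst G = mat_diag N (\<lambda>p. x.h (p div y.m))"
  and H_snd_eq: "H_snd G = mat_diag N (\<lambda>p. y.h (p mod y.m))"
  by (simp_all add: H_fst_def H_snd_def x.H1_eq y.H1_eq dir1_diag dir2_diag)

lemma norm_pos: "p < N \<Longrightarrow> 0 < x.h (p div y.m) * y.h (p mod y.m)"
  using x.norm_weight_pos y.norm_weight_pos by (elim grid_indexE) auto

lemma grid_fn_diag_mult_vec:
  assumes "v \<in> carrier_vec N" "i < x.m" "j < y.m"
  shows "grid_fn (mat_diag N f *\<^sub>v v) i j = f (i * y.m + j) * grid_fn v i j"
  using assms grid_index_less by (simp add: grid_fn_def mat_diag_mult_vec)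

lemma ip_norm_diag:
  assumes "u \<in> carrier_vec N" "v \<in> carrier_vec N"
  shows "ip (H_fst G * H_snd G * mat_diag N f) u v =
    grid_sum (\<lambda>i j. f (i * y.m + j) * (grid_fn u i j * grid_fn v i j))"
  unfolding H_fst_eq H_snd_eq mat_diag_diag ip_mat_diag[OF assms] grid_sum_def
  unfolding npoints_def sum_index
  by (intro sum.cong refl) (simp add: grid_fn_def mult_ac)

lemma D_fst_carrier: "D_fst G \<in> carrier_mat N N" and D_snd_carrier: "D_snd G \<in> carrier_mat N N"
  unfolding D_fst_def D_snd_def
  using dir1_carrier[OF x.D1_carrier] dir2_carrier[OF y.D1_carrier] by (simp_all add: npoints_def)

lemma H_fst_carrier: "H_fst G \<in> carrier_mat N N" and H_snd_carrier: "H_snd G \<in> carrier_mat N N"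
  by (simp_all add: H_fst_eq H_snd_eq)

lemma grid_fn_D_fst:
  assumes "v \<in> carrier_vec N" "i < x.m" "j < y.m"
  shows "grid_fn (D_fst G *\<^sub>v v) i j = dx (grid_fn v) i j"
  unfolding D_fst_def grid_fn_def[of "_ *\<^sub>v _"] dx_def
  by (rule dir1_mult_vec[OF x.D1_carrier assms])

lemma grid_fn_D_snd:
  assumes "v \<in> carrier_vec N" "i < x.m" "j < y.m"
  shows "grid_fn (D_snd G *\<^sub>v v) i j = dy (grid_fn v) i j"
  unfolding D_snd_def grid_fn_def[of "_ *\<^sub>v _"] dy_def
  by (rule dir2_mult_vec[OF y.D1_carrier assms])

lemma dx_cong: "(\<And>i. i < x.m \<Longrightarrow> u i j = v i j) \<Longrightarrow> dx u i j = dx v i j"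
  and dy_cong: "(\<And>j. j < y.m \<Longrightarrow> u i j = v i j) \<Longrightarrow> dy u i j = dy v i j"
  by (auto simp: dx_def dy_def intro!: line_op_cong)

lemma trace1_carrier: "T \<in> carrier_mat 1 x.m \<Longrightarrow> dir1 G T \<in> carrier_mat y.m N"
  and trace2_carrier: "T \<in> carrier_mat 1 y.m \<Longrightarrow> dir2 G T \<in> carrier_mat x.m N"
  using dir1_carrier[of T 1] dir2_carrier[of T 1] by auto

lemma trace1_mult_vec:
  assumes "T \<in> carrier_mat 1 x.m" "v \<in> carrier_vec N" "j < y.m"
  shows "(dir1 G T *\<^sub>v v) $ j = line_op x.m T (\<lambda>l. grid_fn v l j) 0"
  using dir1_mult_vec[OF assms(1,2) _ assms(3), of 0] by simp

lemma trace2_mult_vec: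
  assumes "T \<in> carrier_mat 1 y.m" "v \<in> carrier_vec N" "i < x.m"
  shows "(dir2 G T *\<^sub>v v) $ i = line_op y.m T (\<lambda>l. grid_fn v i l) 0"
  using dir2_mult_vec[OF assms, of 0] by simp

lemma e_carrier:
  "e_w G \<in> carrier_mat y.m N" "e_e G \<in> carrier_mat y.m N"
  "e_s G \<in> carrier_mat x.m N" "e_n G \<in> carrier_mat x.m N"
  unfolding e_w_def e_e_def e_s_def e_n_def
  by (intro trace1_carrier trace2_carrier x.elT_carrier x.erT_carrier y.elT_carrier y.erT_carrier)+

lemma e_mult_vec:
  assumes "v \<in> carrier_vec N"
  shows "j < y.m \<Longrightarrow> (e_w G *\<^sub>v v) $ j = grid_fn v 0 j"
    and "j < y.m \<Longrightarrow> (e_e G *\<^sub>v v) $ j = grid_fn v (x.m - 1) j"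
    and "i < x.m \<Longrightarrow> (e_s G *\<^sub>v v) $ i = grid_fn v i 0"
    and "i < x.m \<Longrightarrow> (e_n G *\<^sub>v v) $ i = grid_fn v i (y.m - 1)"
  unfolding e_w_def e_e_def e_s_def e_n_def
  using trace1_mult_vec[OF x.elT_carrier assms] trace1_mult_vec[OF x.erT_carrier assms]
    trace2_mult_vec[OF y.elT_carrier assms] trace2_mult_vec[OF y.erT_carrier assms]
  by (simp_all add: x.line_op_elT x.line_op_erT y.line_op_elT y.line_op_erT)

lemma grid_fn_add: "u \<in> carrier_vec N \<Longrightarrow> v \<in> carrier_vec N \<Longrightarrow> i < x.m \<Longrightarrow> j < y.m \<Longrightarrow> grid_fn (u + v) i j = grid_fn u i j + grid_fn v i j"
  using grid_index_less by (simp add: grid_fn_def)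

lemma H1_scalar_prod_x:
  assumes "a \<in> carrier_vec x.m" "b \<in> carrier_vec x.m"
  shows "a \<bullet> (H1 (ops1 G) *\<^sub>v b) = (\<Sum>i<x.m. x.h i * (a $ i * b $ i))"
  using ip_mat_diag[OF assms] by (simp add: x.H1_eq ip_def)

lemma H1_scalar_prod_y:
  assumes "a \<in> carrier_vec y.m" "b \<in> carrier_vec y.m"
  shows "a \<bullet> (H1 (ops2 G) *\<^sub>v b) = (\<Sum>i<y.m. y.h i * (a $ i * b $ i))"
  using ip_mat_diag[OF assms] by (simp add: y.H1_eq ip_def)

text \<open>
A prescribed trace is attained by extending it constantly along the grid lines.
\<close>

lemma e_n_surjective:
  assumes "z \<in> carrier_vec x.m"
  shows "\<exists>v\<in>carrier_vec N. e_n G *\<^sub>v v = z"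
proof
  define v where "v = vec N (\<lambda>p. z $ (p div y.m))"
  show v: "v \<in> carrier_vec N" unfolding v_def by simp
  have "grid_fn v i (y.m - 1) = z $ i" if "i < x.m" for i
  proof -
    have "i * y.m + (y.m - 1) < N"
      using grid_index_less[OF that, of "y.m - 1"] y.npts_pos by simp
    moreover have "(i * y.m + (y.m - 1)) div y.m = i"
      using y.npts_pos by (subst div_mult_self3) simp_all
    ultimately show ?thesis by (simp add: v_def grid_fn_def)
  qed
  thus "e_n G *\<^sub>v v = z" using assms v e_carrier e_mult_vec(4)[OF v] by (intro eq_vecI) auto
qed

end

section \<open>Green's formula on the rectangle\<close>

locale rect_grid = sbp_grid P for P :: tensor_grid
begin

text \<open>
The polarization of the potential energy (up to the factor \<open>c^2\<close>).
\<close>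

definition rect_form :: "real vec \<Rightarrow> real vec \<Rightarrow> real" where
  "rect_form u v = ip (Hp P) (D_fst P *\<^sub>v u) (D_fst P *\<^sub>v v) + ip (Hp P) (D_snd P *\<^sub>v u) (D_snd P *\<^sub>v v)
     + ip (Rp P) u v"

lemma Hp_eq: "Hp P = mat_diag N (\<lambda>p. x.h (p div y.m) * y.h (p mod y.m))"
  by (simp add: Hp_def H_fst_eq H_snd_eq)

lemma ip_Hp:
  assumes "u \<in> carrier_vec N" "v \<in> carrier_vec N"
  shows "ip (Hp P) u v = grid_sum (\<lambda>i j. grid_fn u i j * grid_fn v i j)"
  using ip_norm_diag[OF assms, of "\<lambda>_. 1"] H_snd_carrier H_fst_carrier by (simp add: Hp_def)

lemma D2_carrier: "D2 (ops1 P) \<in> carrier_mat x.m x.m" "D2 (ops2 P) \<in> carrier_mat y.m y.m"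
  and R1_carrier: "R1 (ops1 P) \<in> carrier_mat x.m x.m" "R1 (ops2 P) \<in> carrier_mat y.m y.m"
  unfolding D2_def R1_def
  by (auto intro!: x.D2c_carrier y.D2c_carrier x.R1c_carrier y.R1c_carrier simp: ones_def)

lemma dir_carrier:
  "A \<in> carrier_mat x.m x.m \<Longrightarrow> dir1 P A \<in> carrier_mat N N"
  "B \<in> carrier_mat y.m y.m \<Longrightarrow> dir2 P B \<in> carrier_mat N N"
  using dir1_carrier[of A x.m] dir2_carrier[of B y.m] by (simp_all add: npoints_def)

lemma DLp_carrier: "DLp P \<in> carrier_mat N N"
  unfolding DLp_def using dir_carrier D2_carrier by (intro add_carrier_mat) auto

lemma grid_fn_DLp:
  assumes v: "v \<in> carrier_vec N" and ij: "i < x.m" "j < y.m"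
  shows "grid_fn (DLp P *\<^sub>v v) i j = elliptic (\<lambda>_ _. 1) (\<lambda>_ _. 0) (\<lambda>_ _. 1) (grid_fn v) i j"
proof -
  have "DLp P *\<^sub>v v = dir1 P (D2 (ops1 P)) *\<^sub>v v + dir2 P (D2 (ops2 P)) *\<^sub>v v"
    unfolding DLp_def using dir_carrier D2_carrier v by (intro add_mult_distrib_mat_vec[of _ N N]) auto
  moreover have "grid_fn (dir1 P (D2 (ops1 P)) *\<^sub>v v) i j = line_op x.m (D2 (ops1 P)) (\<lambda>k. grid_fn v k j) i"
    unfolding grid_fn_def[of "_ *\<^sub>v _"] by (rule dir1_mult_vec[OF D2_carrier(1) v ij])
  moreover have "grid_fn (dir2 P (D2 (ops2 P)) *\<^sub>v v) i j = line_op y.m (D2 (ops2 P)) (\<lambda>k. grid_fn v i k) j"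
    unfolding grid_fn_def[of "_ *\<^sub>v _"] by (rule dir2_mult_vec[OF D2_carrier(2) v ij])
  ultimately show ?thesis
    using v ij mult_mat_vec_carrier[OF dir_carrier(1)[OF D2_carrier(1)] v]
      mult_mat_vec_carrier[OF dir_carrier(2)[OF D2_carrier(2)] v]
    by (simp add: grid_fn_add elliptic_def D2_def ones_def dx_def dy_def)
qed

lemma Rp_carrier: "Rp P \<in> carrier_mat N N"
  unfolding Rp_def
  by (intro add_carrier_mat mult_carrier_mat[OF dir_carrier(2)[OF R1_carrier(2)] H_fst_carrier])

lemma ip_Rp:
  assumes u: "u \<in> carrier_vec N" and v: "v \<in> carrier_vec N"
  shows "ip (Rp P) u v = remainder_form (\<lambda>_ _. 1) (\<lambda>_ _. 1) (grid_fn u) (grid_fn v)"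
proof -
  note c1 = dir_carrier(1)[OF R1_carrier(1)] and c2 = dir_carrier(2)[OF R1_carrier(2)]
  have "ip (Rp P) u v = ip (dir1 P (R1 (ops1 P)) * H_snd P) u v + ip (dir2 P (R1 (ops2 P)) * H_fst P) u v"
    unfolding Rp_def
    by (rule ip_add_mat[OF mult_carrier_mat[OF c1 H_snd_carrier] mult_carrier_mat[OF c2 H_fst_carrier] u v])
  also have "ip (dir1 P (R1 (ops1 P)) * H_snd P) u v =
      (\<Sum>i<x.m. \<Sum>j<y.m. grid_fn u i j * (y.h j * line_op x.m (R1 (ops1 P)) (\<lambda>k. grid_fn v k j) i))"
  proof -
    have "grid_fn (dir1 P (R1 (ops1 P)) *\<^sub>v (H_snd P *\<^sub>v v)) i j = y.h j * line_op x.m (R1 (ops1 P)) (\<lambda>k. grid_fn v k j) i"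
      if ij: "i < x.m" "j < y.m" for i j
    proof -
      have "grid_fn (dir1 P (R1 (ops1 P)) *\<^sub>v (H_snd P *\<^sub>v v)) i j =
          line_op x.m (R1 (ops1 P)) (\<lambda>k. grid_fn (H_snd P *\<^sub>v v) k j) i"
        unfolding grid_fn_def[of "_ *\<^sub>v (_ *\<^sub>v _)"]
        by (rule dir1_mult_vec[OF R1_carrier(1) mult_mat_vec_carrier[OF H_snd_carrier v] ij])
      also have "\<dots> = line_op x.m (R1 (ops1 P)) (\<lambda>k. y.h j * grid_fn v k j) i"
        unfolding H_snd_eq using ij v by (intro line_op_cong) (simp add: grid_fn_diag_mult_vec)
      finally show ?thesis by (simp add: line_op_def sum_distrib_left mult_ac)
    qed
    thus ?thesis
      unfolding ip_def assoc_mult_mat_vec[OF c1 H_snd_carrier v]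
      using u mult_mat_vec_carrier[OF c1 mult_mat_vec_carrier[OF H_snd_carrier v]]
      by (simp add: scalar_prod_grid)
  qed
  also have "\<dots> = (\<Sum>j<y.m. y.h j * (\<Sum>i<x.m. grid_fn u i j * line_op x.m (R1 (ops1 P)) (\<lambda>k. grid_fn v k j) i))"
    by (subst sum.swap) (simp add: sum_distrib_left mult_ac)
  also have "ip (dir2 P (R1 (ops2 P)) * H_fst P) u v =
      (\<Sum>i<x.m. \<Sum>j<y.m. grid_fn u i j * (x.h i * line_op y.m (R1 (ops2 P)) (\<lambda>k. grid_fn v i k) j))"
  proof -
    have "grid_fn (dir2 P (R1 (ops2 P)) *\<^sub>v (H_fst P *\<^sub>v v)) i j = x.h i * line_op y.m (R1 (ops2 P)) (\<lambda>k. grid_fn v i k) j"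
      if ij: "i < x.m" "j < y.m" for i j
    proof -
      have "grid_fn (dir2 P (R1 (ops2 P)) *\<^sub>v (H_fst P *\<^sub>v v)) i j =
          line_op y.m (R1 (ops2 P)) (\<lambda>k. grid_fn (H_fst P *\<^sub>v v) i k) j"
        unfolding grid_fn_def[of "_ *\<^sub>v (_ *\<^sub>v _)"]
        by (rule dir2_mult_vec[OF R1_carrier(2) mult_mat_vec_carrier[OF H_fst_carrier v] ij])
      also have "\<dots> = line_op y.m (R1 (ops2 P)) (\<lambda>k. x.h i * grid_fn v i k) j"
        unfolding H_fst_eq using ij v by (intro line_op_cong) (simp add: grid_fn_diag_mult_vec)
      finally show ?thesis by (simp add: line_op_def sum_distrib_left mult_ac)
    qed
    thus ?thesis
      unfolding ip_def assoc_mult_mat_vec[OF c2 H_fst_carrier v]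
      using u mult_mat_vec_carrier[OF c2 mult_mat_vec_carrier[OF H_fst_carrier v]]
      by (simp add: scalar_prod_grid)
  qed
  also have "\<dots> = (\<Sum>i<x.m. x.h i * (\<Sum>j<y.m. grid_fn u i j * line_op y.m (R1 (ops2 P)) (\<lambda>k. grid_fn v i k) j))"
    by (simp add: sum_distrib_left mult_ac)
  finally show ?thesis by (simp add: remainder_form_def R1_def ones_def)
qed

lemma D_mult_carrier:
  "v \<in> carrier_vec N \<Longrightarrow> D_fst P *\<^sub>v v \<in> carrier_vec N"
  "v \<in> carrier_vec N \<Longrightarrow> D_snd P *\<^sub>v v \<in> carrier_vec N"
  using mult_mat_vec_carrier[OF D_fst_carrier] mult_mat_vec_carrier[OF D_snd_carrier] by auto

lemma rect_form_eq:
  assumes u: "u \<in> carrier_vec N" and v: "v \<in> carrier_vec N"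
  shows "rect_form u v = energy_form (\<lambda>_ _. 1) (\<lambda>_ _. 0) (\<lambda>_ _. 1) (grid_fn u) (grid_fn v)"
  unfolding rect_form_def energy_form_def ip_Rp[OF u v]
    ip_Hp[OF D_mult_carrier(1)[OF u] D_mult_carrier(1)[OF v]]
    ip_Hp[OF D_mult_carrier(2)[OF u] D_mult_carrier(2)[OF v]] grid_sum_add[symmetric]
  using u v by (auto simp: grid_fn_D_fst grid_fn_D_snd intro!: grid_sum_cong)

lemma sqnorm_Hp_nonneg: "u \<in> carrier_vec N \<Longrightarrow> 0 \<le> sqnorm (Hp P) u"
  by (auto simp: sqnorm_def ip_Hp intro!: grid_sum_nonneg)

lemma ip_Hp_symmetric:
  "u \<in> carrier_vec N \<Longrightarrow> v \<in> carrier_vec N \<Longrightarrow> ip (Hp P) u v = ip (Hp P) v u"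
  by (simp add: ip_Hp mult.commute)

lemma sqnorm_Rp_nonneg: "u \<in> carrier_vec N \<Longrightarrow> 0 \<le> sqnorm (Rp P) u"
  unfolding sqnorm_def by (auto simp: ip_Rp intro!: remainder_form_nonneg)

lemma ip_Rp_symmetric:
  "u \<in> carrier_vec N \<Longrightarrow> v \<in> carrier_vec N \<Longrightarrow> ip (Rp P) u v = ip (Rp P) v u"
  by (simp add: ip_Rp remainder_form_symmetric)

lemma dp_carrier:
  "dp_w P \<in> carrier_mat y.m N" "dp_e P \<in> carrier_mat y.m N"
  "dp_s P \<in> carrier_mat x.m N" "dp_n P \<in> carrier_mat x.m N"
  unfolding dp_w_def dp_e_def dp_s_def dp_n_def
  using trace1_carrier[OF x.dlT_carrier] trace1_carrier[OF x.drT_carrier]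
    trace2_carrier[OF y.dlT_carrier] trace2_carrier[OF y.drT_carrier] by simp_all

lemma dp_mult_vec:
  assumes v: "v \<in> carrier_vec N"
  shows "j < y.m \<Longrightarrow> (dp_w P *\<^sub>v v) $ j = - dxhat (grid_fn v) 0 j"
    and "j < y.m \<Longrightarrow> (dp_e P *\<^sub>v v) $ j = dxhat (grid_fn v) (x.m - 1) j"
    and "i < x.m \<Longrightarrow> (dp_s P *\<^sub>v v) $ i = - dyhat (grid_fn v) i 0"
    and "i < x.m \<Longrightarrow> (dp_n P *\<^sub>v v) $ i = dyhat (grid_fn v) i (y.m - 1)"
  unfolding dp_w_def dp_e_def dp_s_def dp_n_def dxhat_def dyhat_def
  using trace1_mult_vec[OF x.dlT_carrier v] trace1_mult_vec[OF x.drT_carrier v]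
    trace2_mult_vec[OF y.dlT_carrier v] trace2_mult_vec[OF y.drT_carrier v]
    trace1_carrier[OF x.dlT_carrier] trace2_carrier[OF y.dlT_carrier] v
  by (simp_all add: x.line_op_dlT x.line_op_drT y.line_op_dlT y.line_op_drT uminus_mult_mat_vec)

lemma flux_rect:
  assumes u: "u \<in> carrier_vec N" and v: "v \<in> carrier_vec N"
  shows "(e_w P *\<^sub>v u) \<bullet> (Hp_w P *\<^sub>v (dp_w P *\<^sub>v v)) = - xflux (\<lambda>_ _. 1) (\<lambda>_ _. 0) 0 (grid_fn u) (grid_fn v)"
    and "(e_e P *\<^sub>v u) \<bullet> (Hp_e P *\<^sub>v (dp_e P *\<^sub>v v)) = xflux (\<lambda>_ _. 1) (\<lambda>_ _. 0) (x.m - 1) (grid_fn u) (grid_fn v)"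
    and "(e_s P *\<^sub>v u) \<bullet> (Hp_s P *\<^sub>v (dp_s P *\<^sub>v v)) = - yflux (\<lambda>_ _. 0) (\<lambda>_ _. 1) 0 (grid_fn u) (grid_fn v)"
    and "(e_n P *\<^sub>v u) \<bullet> (Hp_n P *\<^sub>v (dp_n P *\<^sub>v v)) = yflux (\<lambda>_ _. 0) (\<lambda>_ _. 1) (y.m - 1) (grid_fn u) (grid_fn v)"
  unfolding Hp_w_def Hp_e_def Hp_s_def Hp_n_def xflux_def yflux_def
  using mult_mat_vec_carrier[OF e_carrier(1) u] mult_mat_vec_carrier[OF e_carrier(2) u]
    mult_mat_vec_carrier[OF e_carrier(3) u] mult_mat_vec_carrier[OF e_carrier(4) u]
    mult_mat_vec_carrier[OF dp_carrier(1) v] mult_mat_vec_carrier[OF dp_carrier(2) v]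
    mult_mat_vec_carrier[OF dp_carrier(3) v] mult_mat_vec_carrier[OF dp_carrier(4) v]
  by (simp_all add: H1_scalar_prod_x H1_scalar_prod_y e_mult_vec[OF u] dp_mult_vec[OF v] sum_negf[symmetric])

lemma green_rect:
  assumes u: "u \<in> carrier_vec N" and v: "v \<in> carrier_vec N"
  shows "ip (Hp P) u (DLp P *\<^sub>v v) = - rect_form u v
    + (e_w P *\<^sub>v u) \<bullet> (Hp_w P *\<^sub>v (dp_w P *\<^sub>v v)) + (e_e P *\<^sub>v u) \<bullet> (Hp_e P *\<^sub>v (dp_e P *\<^sub>v v))
    + (e_s P *\<^sub>v u) \<bullet> (Hp_s P *\<^sub>v (dp_s P *\<^sub>v v)) + (e_n P *\<^sub>v u) \<bullet> (Hp_n P *\<^sub>v (dp_n P *\<^sub>v v))"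
proof -
  have "ip (Hp P) u (DLp P *\<^sub>v v) =
      grid_sum (\<lambda>i j. grid_fn u i j * elliptic (\<lambda>_ _. 1) (\<lambda>_ _. 0) (\<lambda>_ _. 1) (grid_fn v) i j)"
    unfolding ip_Hp[OF u mult_mat_vec_carrier[OF DLp_carrier v]]
    by (intro grid_sum_cong) (simp add: grid_fn_DLp[OF v])
  thus ?thesis unfolding green flux_rect[OF u v] rect_form_eq[OF u v] by simp
qed

end

section \<open>Traces on a side of the grid\<close>

text \<open>
A restriction matrix picks the entries of a vector at the positions \<open>q r\<close> of the points of one side. All
four sides of the curvilinear block are instances, so the sandwiched products of restrictions and diagonal
matrices in its boundary operators are evaluated only once.
\<close>

locale point_trace =
  fixes n k :: nat and e :: "real mat" and q :: "nat \<Rightarrow> nat"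
  assumes e_carrier: "e \<in> carrier_mat k n" and q_inj: "inj_on q {..<k}" and q_less: "r < k \<Longrightarrow> q r < n"
    and e_index: "v \<in> carrier_vec n \<Longrightarrow> r < k \<Longrightarrow> (e *\<^sub>v v) $ r = v $ q r"
begin

lemma eT_carrier: "e\<^sup>T \<in> carrier_mat n k"
  using e_carrier by simp

text \<open>
The transpose puts a value back at the position it came from; injectivity of \<open>q\<close> ensures that no other
value lands there.
\<close>

lemma eT_index:
  assumes z: "z \<in> carrier_vec k" and r: "r < k"
  shows "(e\<^sup>T *\<^sub>v z) $ q r = z $ r"
proof -
  have "(e\<^sup>T *\<^sub>v z) $ q r = unit_vec n (q r) \<bullet> (e\<^sup>T *\<^sub>v z)"
    using e_carrier q_less[OF r] z by simp
  also have "\<dots> = (e *\<^sub>v unit_vec n (q r)) \<bullet> z"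
    by (rule transpose_mult_scalar_prod[OF e_carrier _ z]) simp
  also have "e *\<^sub>v unit_vec n (q r) = unit_vec k r"
  proof (rule eq_vecI)
    fix s assume "s < dim_vec (unit_vec k r)"
    hence s: "s < k" by simp
    have "q r = q s \<longleftrightarrow> r = s" using inj_onD[OF q_inj] s r by auto
    thus "(e *\<^sub>v unit_vec n (q r)) $ s = unit_vec k r $ s"
      using e_index[of "unit_vec n (q r)" s] s r q_less by auto
  qed (use e_carrier in simp)
  finally show ?thesis using z r by simp
qed

lemma coeff_trace_carrier:
  "A \<in> carrier_mat n n \<Longrightarrow> mat_diag n f * e\<^sup>T * e * A \<in> carrier_mat n n"
  by (rule mult_carrier_mat[OF mult_carrier_mat[OF mult_carrier_mat[OF mat_diag_dim eT_carrier] e_carrier]])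

lemma coeff_trace_index:
  assumes A: "A \<in> carrier_mat n n" and v: "v \<in> carrier_vec n" and r: "r < k"
  shows "((mat_diag n f * e\<^sup>T * e * A) *\<^sub>v v) $ q r = f (q r) * (A *\<^sub>v v) $ q r"
proof -
  have Av: "A *\<^sub>v v \<in> carrier_vec n" by (rule mult_mat_vec_carrier[OF A v])
  have eAv: "e *\<^sub>v (A *\<^sub>v v) \<in> carrier_vec k" by (rule mult_mat_vec_carrier[OF e_carrier Av])
  have c: "e\<^sup>T *\<^sub>v (e *\<^sub>v (A *\<^sub>v v)) \<in> carrier_vec n" by (rule mult_mat_vec_carrier[OF eT_carrier eAv])
  show ?thesis
    unfolding mult_vec_assoc4[OF mat_diag_dim eT_carrier e_carrier A v] mat_diag_mult_vec[OF c]
    using q_less[OF r] eT_index[OF eAv r] e_index[OF Av r] by simp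
qed

lemma conormal_carrier:
  assumes A: "A \<in> carrier_mat n n" and B: "B \<in> carrier_mat n n"
  shows "e * mat_diag n w * (mat_diag n f * e\<^sup>T * e * A + mat_diag n g * e\<^sup>T * e * B) \<in> carrier_mat k n"
  by (rule mult_carrier_mat[OF mult_carrier_mat[OF e_carrier mat_diag_dim]
        add_carrier_mat[OF coeff_trace_carrier[OF B]]])

lemma conormal_index:
  assumes A: "A \<in> carrier_mat n n" and B: "B \<in> carrier_mat n n" and v: "v \<in> carrier_vec n" and r: "r < k"
  shows "((e * mat_diag n w * (mat_diag n f * e\<^sup>T * e * A + mat_diag n g * e\<^sup>T * e * B)) *\<^sub>v v) $ r =
      w (q r) * (f (q r) * (A *\<^sub>v v) $ q r + g (q r) * (B *\<^sub>v v) $ q r)"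
proof -
  define S where "S = mat_diag n f * e\<^sup>T * e * A + mat_diag n g * e\<^sup>T * e * B"
  have S: "S \<in> carrier_mat n n" unfolding S_def by (rule add_carrier_mat[OF coeff_trace_carrier[OF B]])
  have Sv: "S *\<^sub>v v \<in> carrier_vec n" by (rule mult_mat_vec_carrier[OF S v])
  have "(S *\<^sub>v v) $ q r = f (q r) * (A *\<^sub>v v) $ q r + g (q r) * (B *\<^sub>v v) $ q r"
    unfolding S_def add_mult_distrib_mat_vec[OF coeff_trace_carrier[OF A] coeff_trace_carrier[OF B] v]
      coeff_trace_index[OF A v r, symmetric] coeff_trace_index[OF B v r, symmetric]
    using q_less[OF r] by (intro index_add_vec(1)) simp
  thus ?thesis
    unfolding S_def[symmetric] mult_vec_assoc3[OF e_carrier mat_diag_dim S v]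
    using e_index[OF mult_mat_vec_carrier[OF mat_diag_dim Sv] r] q_less[OF r] by (simp add: mat_diag_mult_vec[OF Sv])
qed

lemma side_norm_carrier:
  "mat_diag k h * e * mat_diag n w * e\<^sup>T \<in> carrier_mat k k"
  by (rule mult_carrier_mat[OF mult_carrier_mat[OF mult_carrier_mat[OF mat_diag_dim e_carrier] mat_diag_dim] eT_carrier])

lemma side_norm_index:
  assumes z: "z \<in> carrier_vec k" and r: "r < k"
  shows "((mat_diag k h * e * mat_diag n w * e\<^sup>T) *\<^sub>v z) $ r = h r * (w (q r) * z $ r)"
proof -
  have eTz: "e\<^sup>T *\<^sub>v z \<in> carrier_vec n" by (rule mult_mat_vec_carrier[OF eT_carrier z])
  have Wz: "mat_diag n w *\<^sub>v (e\<^sup>T *\<^sub>v z) \<in> carrier_vec n" by (rule mult_mat_vec_carrier[OF mat_diag_dim eTz])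
  have eWz: "e *\<^sub>v (mat_diag n w *\<^sub>v (e\<^sup>T *\<^sub>v z)) \<in> carrier_vec k" by (rule mult_mat_vec_carrier[OF e_carrier Wz])
  show ?thesis
    unfolding mult_vec_assoc4[OF mat_diag_dim e_carrier mat_diag_dim eT_carrier z] mat_diag_mult_vec[OF eWz]
    using r e_index[OF Wz r] q_less[OF r] eT_index[OF z r] by (simp add: mat_diag_mult_vec[OF eTz])
qed

lemma scalar_prod_side_norm:
  assumes "a \<in> carrier_vec k" "z \<in> carrier_vec k"
  shows "a \<bullet> ((mat_diag k h * e * mat_diag n w * e\<^sup>T) *\<^sub>v z) = (\<Sum>r<k. h r * (w (q r) * (a $ r * z $ r)))"
  using assms side_norm_index[OF assms(2), of _ h w] side_norm_carrier[of h w]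
  by (auto simp: scalar_prod_def lessThan_atLeast0 mult_ac simp del: index_mult_mat_vec intro!: sum.cong)

text \<open>
The arc-length factor \<open>w\<close> in the side norm cancels its inverse in the conormal derivative, so the
physical flux becomes the flux in reference coordinates that occurs in \<open>green\<close>.
\<close>

lemma flux_eq:
  assumes A: "A \<in> carrier_mat n n" and B: "B \<in> carrier_mat n n"
    and u: "u \<in> carrier_vec n" and v: "v \<in> carrier_vec n" and w: "\<forall>p<n. 0 < w p"
  shows "(e *\<^sub>v u) \<bullet> ((mat_diag k h * e * mat_diag n w * e\<^sup>T) *\<^sub>v
      ((e * mat_diag n (\<lambda>p. inverse (w p)) * (mat_diag n f * e\<^sup>T * e * A + mat_diag n g * e\<^sup>T * e * B)) *\<^sub>v v)) =
    (\<Sum>r<k. h r * (u $ q r * (f (q r) * (A *\<^sub>v v) $ q r + g (q r) * (B *\<^sub>v v) $ q r)))"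
proof -
  have cancel: "w (q r) * (a * (inverse (w (q r)) * t)) = a * t" if "r < k" for r a t
    using w q_less[OF that] by (auto simp: field_simps)
  show ?thesis
    unfolding scalar_prod_side_norm[OF mult_mat_vec_carrier[OF e_carrier u] mult_mat_vec_carrier[OF conormal_carrier[OF A B] v]]
    by (intro sum.cong refl) (simp only: lessThan_iff e_index[OF u] conormal_index[OF A B v] cancel)
qed

end

section \<open>Green's formula on the curvilinear block\<close>

locale curv_block = sbp_grid M for M :: curv_grid +
  assumes curv_grid: "is_curv_grid M"
begin

text \<open>
The diagonals of the metric matrices, as functions of the point number.
\<close>

definition x_xi where "x_xi p = (D_fst M *\<^sub>v xs M) $ p"
definition x_eta where "x_eta p = (D_snd M *\<^sub>v xs M) $ p"
definition y_xi where "y_xi p = (D_fst M *\<^sub>v ys M) $ p"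
definition y_eta where "y_eta p = (D_snd M *\<^sub>v ys M) $ p"

definition J where "J p = x_xi p * y_eta p - x_eta p * y_xi p"
definition a1 where "a1 p = inverse (J p) * (x_eta p * x_eta p + y_eta p * y_eta p)"
definition b where "b p = - (inverse (J p) * (x_xi p * x_eta p + y_xi p * y_eta p))"
definition a2 where "a2 p = inverse (J p) * (x_xi p * x_xi p + y_xi p * y_xi p)"
definition w1 where "w1 p = sqrt (x_xi p * x_xi p + y_xi p * y_xi p)"
definition w2 where "w2 p = sqrt (x_eta p * x_eta p + y_eta p * y_eta p)"

text \<open>
Turns a function of the point number into a function of the two grid indices.
\<close>

abbreviation grd :: "(nat \<Rightarrow> real) \<Rightarrow> nat \<Rightarrow> nat \<Rightarrow> real" where
  "grd f \<equiv> (\<lambda>i j. f (i * y.m + j))"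

definition curv_form :: "real vec \<Rightarrow> real vec \<Rightarrow> real" where
  "curv_form u v = ip (Hm M) (Dxm M *\<^sub>v u) (Dxm M *\<^sub>v v) + ip (Hm M) (Dym M *\<^sub>v u) (Dym M *\<^sub>v v)
     + ip (Rm M) u v"

lemma metric_eq:
  "X_xi M = mat_diag N x_xi" "X_eta M = mat_diag N x_eta" "Y_xi M = mat_diag N y_xi" "Y_eta M = mat_diag N y_eta"
  using D_fst_carrier D_snd_carrier
  unfolding X_xi_def X_eta_def Y_xi_def Y_eta_def diagv_eq_mat_diag
  by (auto simp: x_xi_def[abs_def] x_eta_def[abs_def] y_xi_def[abs_def] y_eta_def[abs_def])

lemma Jac_eq: "Jac M = mat_diag N J"
  by (simp add: Jac_def metric_eq mat_diag_arith J_def[abs_def])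

lemma J_pos: "p < N \<Longrightarrow> 0 < J p"
  using curv_grid by (auto simp: is_curv_grid_def Jac_eq mat_diag_index)

lemma J_pos_grid: "i < x.m \<Longrightarrow> j < y.m \<Longrightarrow> 0 < J (i * y.m + j)"
  by (intro J_pos grid_index_less)

lemma minv_Jac_eq: "minv (Jac M) = mat_diag N (\<lambda>p. inverse (J p))"
  unfolding Jac_eq using J_pos by (intro minv_mat_diag) force

lemma coeff_eq:
  "alpha1 M = mat_diag N a1" "beta M = mat_diag N b" "alpha2 M = mat_diag N a2"
  by (simp_all add: alpha1_def beta_def alpha2_def metric_eq minv_Jac_eq mat_diag_arith
      a1_def[abs_def] b_def[abs_def] a2_def[abs_def])

lemma W_eq: "W1 M = mat_diag N w1" "W2 M = mat_diag N w2"
  by (simp_all add: W1_def W2_def metric_eq mat_diag_arith w1_def[abs_def] w2_def[abs_def])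

text \<open>
A vanishing tangent vector would make the Jacobian zero.
\<close>

lemma w_pos:
  assumes "p < N"
  shows "0 < w1 p" "0 < w2 p"
proof -
  have "\<not> (x_xi p = 0 \<and> y_xi p = 0)" "\<not> (x_eta p = 0 \<and> y_eta p = 0)"
    using J_pos[OF assms] by (auto simp: J_def)
  thus "0 < w1 p" "0 < w2 p"
    by (auto simp: w1_def w2_def sum_squares_gt_zero_iff)
qed

lemma W_pos: "\<forall>p<N. 0 < w1 p" "\<forall>p<N. 0 < w2 p"
  using w_pos by auto

lemma minv_W_eq: "minv (W1 M) = mat_diag N (\<lambda>p. inverse (w1 p))" "minv (W2 M) = mat_diag N (\<lambda>p. inverse (w2 p))"
  unfolding W_eq using w_pos by (auto intro!: minv_mat_diag dest: order_less_imp_not_eq2)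

lemma coeff_nonneg: "p < N \<Longrightarrow> 0 \<le> a1 p" "p < N \<Longrightarrow> 0 \<le> a2 p"
  using J_pos by (auto simp: a1_def a2_def less_imp_le)

lemma Hm_eq: "Hm M = mat_diag N (\<lambda>p. x.h (p div y.m) * y.h (p mod y.m) * J p)"
  by (simp add: Hm_def H_fst_eq H_snd_eq Jac_eq)

lemma ip_Hm:
  assumes "u \<in> carrier_vec N" "v \<in> carrier_vec N"
  shows "ip (Hm M) u v = grid_sum (\<lambda>i j. grd J i j * (grid_fn u i j * grid_fn v i j))"
  using ip_norm_diag[OF assms, of J] by (simp add: Hm_def Jac_eq)

lemma lines_carrier: "lines1 M F A \<in> carrier_mat N N" "lines2 M F A \<in> carrier_mat N N"
  by (simp_all add: lines1_def lines2_def)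

lemma grid_fn_lines1:
  assumes v: "v \<in> carrier_vec N" and ij: "i < x.m" "j < y.m"
  shows "grid_fn (lines1 M F (mat_diag N a) *\<^sub>v v) i j =
    line_op x.m (F (vec x.m (\<lambda>k. grd a k j))) (\<lambda>k. grid_fn v k j) i"
proof -
  define c where "c j = vec x.m (\<lambda>k. grd a k j)" for j
  have c: "vec x.m (\<lambda>i. mat_diag N a $$ (i * y.m + j, i * y.m + j)) = c j" if "j < y.m" for j
    unfolding c_def using that grid_index_less by (intro eq_vecI) (auto simp: mat_diag_index)
  have "grid_fn (lines1 M F (mat_diag N a) *\<^sub>v v) i j =
      (\<Sum>k<x.m. \<Sum>l<y.m. lines1 M F (mat_diag N a) $$ (i * y.m + j, k * y.m + l) * grid_fn v k l)"
    unfolding grid_fn_def[of "_ *\<^sub>v _"]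
    by (rule mult_vec_grid_index[OF lines_carrier(1) v grid_index_less[OF ij]])
  also have "\<dots> = (\<Sum>k<x.m. \<Sum>l<y.m. if j = l then F (c j) $$ (i, k) * grid_fn v k l else 0)"
    using ij grid_index_less by (intro sum.cong refl) (simp add: lines1_def c)
  also have "\<dots> = line_op x.m (F (c j)) (\<lambda>k. grid_fn v k j) i"
    using ij by (simp add: line_op_def)
  finally show ?thesis unfolding c_def .
qed

lemma grid_fn_lines2:
  assumes v: "v \<in> carrier_vec N" and ij: "i < x.m" "j < y.m"
  shows "grid_fn (lines2 M F (mat_diag N a) *\<^sub>v v) i j =
    line_op y.m (F (vec y.m (\<lambda>k. grd a i k))) (\<lambda>k. grid_fn v i k) j"
proof -
  define c where "c i = vec y.m (\<lambda>k. grd a i k)" for i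
  have c: "vec y.m (\<lambda>k. mat_diag N a $$ (i * y.m + k, i * y.m + k)) = c i" if "i < x.m" for i
    unfolding c_def using that grid_index_less by (intro eq_vecI) (auto simp: mat_diag_index)
  have "grid_fn (lines2 M F (mat_diag N a) *\<^sub>v v) i j =
      (\<Sum>k<x.m. \<Sum>l<y.m. lines2 M F (mat_diag N a) $$ (i * y.m + j, k * y.m + l) * grid_fn v k l)"
    unfolding grid_fn_def[of "_ *\<^sub>v _"]
    by (rule mult_vec_grid_index[OF lines_carrier(2) v grid_index_less[OF ij]])
  also have "\<dots> = (\<Sum>k<x.m. if i = k then \<Sum>l<y.m. F (c i) $$ (j, l) * grid_fn v k l else 0)"
    using ij grid_index_less by (intro sum.cong refl) (simp add: lines2_def c)
  also have "\<dots> = line_op y.m (F (c i)) (\<lambda>k. grid_fn v i k) j"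
    using ij by (simp add: line_op_def)
  finally show ?thesis unfolding c_def .
qed

lemma D_mult_carrier:
  "v \<in> carrier_vec N \<Longrightarrow> D_fst M *\<^sub>v v \<in> carrier_vec N"
  "v \<in> carrier_vec N \<Longrightarrow> D_snd M *\<^sub>v v \<in> carrier_vec N"
  "v \<in> carrier_vec N \<Longrightarrow> mat_diag N f *\<^sub>v v \<in> carrier_vec N"
  using mult_mat_vec_carrier[OF D_fst_carrier] mult_mat_vec_carrier[OF D_snd_carrier]
    mult_mat_vec_carrier[OF mat_diag_dim, of v N f] by auto

lemma mixed_carrier:
  "D_snd M * mat_diag N f * D_fst M \<in> carrier_mat N N" "D_fst M * mat_diag N f * D_snd M \<in> carrier_mat N N"
  using mult_carrier_mat[OF mult_carrier_mat[OF D_snd_carrier mat_diag_dim] D_fst_carrier]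
    mult_carrier_mat[OF mult_carrier_mat[OF D_fst_carrier mat_diag_dim] D_snd_carrier] by auto

lemma grid_fn_mixed:
  assumes v: "v \<in> carrier_vec N" and ij: "i < x.m" "j < y.m"
  shows "grid_fn ((D_snd M * mat_diag N f * D_fst M) *\<^sub>v v) i j = dy (\<lambda>i j. grd f i j * dx (grid_fn v) i j) i j"
    and "grid_fn ((D_fst M * mat_diag N f * D_snd M) *\<^sub>v v) i j = dx (\<lambda>i j. grd f i j * dy (grid_fn v) i j) i j"
  unfolding mult_vec_assoc3[OF D_snd_carrier mat_diag_dim D_fst_carrier v]
    mult_vec_assoc3[OF D_fst_carrier mat_diag_dim D_snd_carrier v]
  using v ij
  by (auto simp: grid_fn_D_snd grid_fn_D_fst D_mult_carrier grid_fn_diag_mult_vec intro!: dx_cong dy_cong)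

lemma DLm_sum_carrier:
  "D_xixi M + D_snd M * beta M * D_fst M + D_fst M * beta M * D_snd M + D_etaeta M \<in> carrier_mat N N"
  unfolding D_xixi_def D_etaeta_def coeff_eq by (intro add_carrier_mat lines_carrier)

lemma DLm_carrier: "DLm M \<in> carrier_mat N N"
  unfolding DLm_def minv_Jac_eq by (rule mult_carrier_mat[OF mat_diag_dim DLm_sum_carrier])

lemma grid_fn_DLm:
  assumes v: "v \<in> carrier_vec N" and ij: "i < x.m" "j < y.m"
  shows "grid_fn (DLm M *\<^sub>v v) i j = inverse (grd J i j) * elliptic (grd a1) (grd b) (grd a2) (grid_fn v) i j"
proof -
  define A1 where "A1 = lines1 M (D2c (ops1 M)) (mat_diag N a1)"
  define A2 where "A2 = D_snd M * mat_diag N b * D_fst M"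
  define A3 where "A3 = D_fst M * mat_diag N b * D_snd M"
  define A4 where "A4 = lines2 M (D2c (ops2 M)) (mat_diag N a2)"
  have c: "A1 \<in> carrier_mat N N" "A2 \<in> carrier_mat N N" "A3 \<in> carrier_mat N N" "A4 \<in> carrier_mat N N"
    unfolding A1_def A2_def A3_def A4_def using lines_carrier mixed_carrier by auto
  have cv: "A *\<^sub>v v \<in> carrier_vec N" if "A \<in> carrier_mat N N" for A
    by (rule mult_mat_vec_carrier[OF that v])
  have s: "A1 + A2 + A3 + A4 \<in> carrier_mat N N" using c by simp
  have "(A1 + A2 + A3 + A4) *\<^sub>v v = A1 *\<^sub>v v + A2 *\<^sub>v v + A3 *\<^sub>v v + A4 *\<^sub>v v"
    using add_mult_distrib_mat_vec[of "A1 + A2 + A3" N N A4 v] add_mult_distrib_mat_vec[of "A1 + A2" N N A3 v]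
      add_mult_distrib_mat_vec[of A1 N N A2 v] c v by simp
  hence "grid_fn ((A1 + A2 + A3 + A4) *\<^sub>v v) i j = elliptic (grd a1) (grd b) (grd a2) (grid_fn v) i j"
    using cv[OF c(1)] cv[OF c(2)] cv[OF c(3)] cv[OF c(4)] ij
    by (simp add: grid_fn_add elliptic_def A1_def A2_def A3_def A4_def grid_fn_lines1[OF v ij] grid_fn_lines2[OF v ij] grid_fn_mixed[OF v ij])
  moreover have "DLm M = mat_diag N (\<lambda>p. inverse (J p)) * (A1 + A2 + A3 + A4)"
    by (simp add: DLm_def minv_Jac_eq D_xixi_def D_etaeta_def coeff_eq A1_def A2_def A3_def A4_def)
  ultimately show ?thesis
    using grid_fn_diag_mult_vec[OF cv[OF s] ij] assoc_mult_mat_vec[OF mat_diag_dim s v] by simp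
qed

lemma Rm_carrier: "Rm M \<in> carrier_mat N N"
  unfolding Rm_def R_eta_def by (intro add_carrier_mat mult_carrier_mat[OF lines_carrier(2) H_fst_carrier])

lemma ip_Rm:
  assumes u: "u \<in> carrier_vec N" and v: "v \<in> carrier_vec N"
  shows "ip (Rm M) u v = remainder_form (grd a1) (grd a2) (grid_fn u) (grid_fn v)"
proof -
  define A where "A = lines1 M (R1c (ops1 M)) (mat_diag N a1)"
  define B where "B = lines2 M (R1c (ops2 M)) (mat_diag N a2)"
  have c: "A \<in> carrier_mat N N" "B \<in> carrier_mat N N"
    unfolding A_def B_def by (simp_all add: lines_carrier)
  define RA where "RA j = R1c (ops1 M) (vec x.m (\<lambda>k. grd a1 k j))" for j
  define RB where "RB i = R1c (ops2 M) (vec y.m (\<lambda>k. grd a2 i k))" for i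
  have Hv: "H_fst M *\<^sub>v v \<in> carrier_vec N" "H_snd M *\<^sub>v v \<in> carrier_vec N"
    using mult_mat_vec_carrier[OF H_fst_carrier v] mult_mat_vec_carrier[OF H_snd_carrier v] by auto
  have "ip (Rm M) u v = ip (A * H_snd M) u v + ip (B * H_fst M) u v"
    unfolding Rm_def R_xi_def R_eta_def coeff_eq A_def[symmetric] B_def[symmetric]
    by (rule ip_add_mat[OF mult_carrier_mat[OF c(1) H_snd_carrier] mult_carrier_mat[OF c(2) H_fst_carrier] u v])
  also have "ip (A * H_snd M) u v = (\<Sum>i<x.m. \<Sum>j<y.m. grid_fn u i j * (y.h j * line_op x.m (RA j) (\<lambda>k. grid_fn v k j) i))"
  proof -
    have "grid_fn (A *\<^sub>v (H_snd M *\<^sub>v v)) i j = y.h j * line_op x.m (RA j) (\<lambda>k. grid_fn v k j) i"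
      if ij: "i < x.m" "j < y.m" for i j
    proof -
      have "grid_fn (A *\<^sub>v (H_snd M *\<^sub>v v)) i j = line_op x.m (RA j) (\<lambda>k. grid_fn (H_snd M *\<^sub>v v) k j) i"
        unfolding A_def RA_def by (rule grid_fn_lines1[OF Hv(2) ij])
      also have "\<dots> = line_op x.m (RA j) (\<lambda>k. y.h j * grid_fn v k j) i"
        unfolding H_snd_eq using ij v by (intro line_op_cong) (simp add: grid_fn_diag_mult_vec)
      finally show ?thesis by (simp add: line_op_def sum_distrib_left mult_ac)
    qed
    thus ?thesis
      unfolding ip_def assoc_mult_mat_vec[OF c(1) H_snd_carrier v]
      using u mult_mat_vec_carrier[OF c(1) Hv(2)] by (simp add: scalar_prod_grid)
  qed
  also have "\<dots> = (\<Sum>j<y.m. y.h j * (\<Sum>i<x.m. grid_fn u i j * line_op x.m (RA j) (\<lambda>k. grid_fn v k j) i))"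
    by (subst sum.swap) (simp add: sum_distrib_left mult_ac)
  also have "ip (B * H_fst M) u v = (\<Sum>i<x.m. \<Sum>j<y.m. grid_fn u i j * (x.h i * line_op y.m (RB i) (\<lambda>k. grid_fn v i k) j))"
  proof -
    have "grid_fn (B *\<^sub>v (H_fst M *\<^sub>v v)) i j = x.h i * line_op y.m (RB i) (\<lambda>k. grid_fn v i k) j"
      if ij: "i < x.m" "j < y.m" for i j
    proof -
      have "grid_fn (B *\<^sub>v (H_fst M *\<^sub>v v)) i j = line_op y.m (RB i) (\<lambda>k. grid_fn (H_fst M *\<^sub>v v) i k) j"
        unfolding B_def RB_def by (rule grid_fn_lines2[OF Hv(1) ij])
      also have "\<dots> = line_op y.m (RB i) (\<lambda>k. x.h i * grid_fn v i k) j"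
        unfolding H_fst_eq using ij v by (intro line_op_cong) (simp add: grid_fn_diag_mult_vec)
      finally show ?thesis by (simp add: line_op_def sum_distrib_left mult_ac)
    qed
    thus ?thesis
      unfolding ip_def assoc_mult_mat_vec[OF c(2) H_fst_carrier v]
      using u mult_mat_vec_carrier[OF c(2) Hv(1)] by (simp add: scalar_prod_grid)
  qed
  also have "\<dots> = (\<Sum>i<x.m. x.h i * (\<Sum>j<y.m. grid_fn u i j * line_op y.m (RB i) (\<lambda>k. grid_fn v i k) j))"
    by (simp add: sum_distrib_left mult_ac)
  finally show ?thesis by (simp add: remainder_form_def RA_def RB_def)
qed

lemma sqnorm_Hm_nonneg: "u \<in> carrier_vec N \<Longrightarrow> 0 \<le> sqnorm (Hm M) u"
  using J_pos_grid by (auto simp: sqnorm_def ip_Hm less_imp_le intro!: grid_sum_nonneg)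

lemma ip_Hm_symmetric:
  "u \<in> carrier_vec N \<Longrightarrow> v \<in> carrier_vec N \<Longrightarrow> ip (Hm M) u v = ip (Hm M) v u"
  by (simp add: ip_Hm mult.commute)

lemma sqnorm_Rm_nonneg: "u \<in> carrier_vec N \<Longrightarrow> 0 \<le> sqnorm (Rm M) u"
  unfolding sqnorm_def
  by (auto simp: ip_Rm intro!: remainder_form_nonneg coeff_nonneg grid_index_less)

lemma ip_Rm_symmetric:
  "u \<in> carrier_vec N \<Longrightarrow> v \<in> carrier_vec N \<Longrightarrow> ip (Rm M) u v = ip (Rm M) v u"
  by (simp add: ip_Rm remainder_form_symmetric)

lemma diag_D_carrier:
  "mat_diag N f * D_fst M \<in> carrier_mat N N" "mat_diag N f * D_snd M \<in> carrier_mat N N"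
  using mult_carrier_mat[OF mat_diag_dim D_fst_carrier] mult_carrier_mat[OF mat_diag_dim D_snd_carrier] by auto

lemma gradient_eq:
  "Dxm M = mat_diag N (\<lambda>p. inverse (J p)) * (mat_diag N y_eta * D_fst M + mat_diag N (\<lambda>p. - y_xi p) * D_snd M)"
  "Dym M = mat_diag N (\<lambda>p. inverse (J p)) * (mat_diag N (\<lambda>p. - x_eta p) * D_fst M + mat_diag N x_xi * D_snd M)"
proof -
  have "mat_diag N y_eta * D_fst M - mat_diag N y_xi * D_snd M =
      mat_diag N y_eta * D_fst M + mat_diag N (\<lambda>p. - y_xi p) * D_snd M"
    using D_fst_carrier D_snd_carrier
    by (auto simp: mat_diag_mult_left[of _ N N])
  thus "Dxm M = mat_diag N (\<lambda>p. inverse (J p)) * (mat_diag N y_eta * D_fst M + mat_diag N (\<lambda>p. - y_xi p) * D_snd M)"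
    by (simp add: Dxm_def metric_eq minv_Jac_eq)
qed (simp add: Dym_def metric_eq minv_Jac_eq mat_diag_arith)

lemma gradient_carrier: "Dxm M \<in> carrier_mat N N" "Dym M \<in> carrier_mat N N"
  unfolding gradient_eq
  by (intro mult_carrier_mat[OF mat_diag_dim] add_carrier_mat diag_D_carrier)+

lemma grid_fn_gradient:
  assumes v: "v \<in> carrier_vec N" and ij: "i < x.m" "j < y.m"
  shows "grid_fn (Dxm M *\<^sub>v v) i j = inverse (grd J i j) * (grd y_eta i j * dx (grid_fn v) i j - grd y_xi i j * dy (grid_fn v) i j)"
    and "grid_fn (Dym M *\<^sub>v v) i j = inverse (grd J i j) * (- grd x_eta i j * dx (grid_fn v) i j + grd x_xi i j * dy (grid_fn v) i j)"
proof -
  have *: "grid_fn ((mat_diag N r * (mat_diag N f * D_fst M + mat_diag N g * D_snd M)) *\<^sub>v v) i j =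
     r (i * y.m + j) * (f (i * y.m + j) * dx (grid_fn v) i j + g (i * y.m + j) * dy (grid_fn v) i j)" for r f g
    using v ij
    by (simp add: assoc_mult_mat_vec[OF mat_diag_dim add_carrier_mat[OF diag_D_carrier(2)] v]
       add_mult_distrib_mat_vec[OF diag_D_carrier v] assoc_mult_mat_vec[OF mat_diag_dim D_fst_carrier v]
       assoc_mult_mat_vec[OF mat_diag_dim D_snd_carrier v] grid_fn_diag_mult_vec D_mult_carrier grid_fn_add
       grid_fn_D_fst grid_fn_D_snd)
  show "grid_fn (Dxm M *\<^sub>v v) i j = inverse (grd J i j) * (grd y_eta i j * dx (grid_fn v) i j - grd y_xi i j * dy (grid_fn v) i j)"
    "grid_fn (Dym M *\<^sub>v v) i j = inverse (grd J i j) * (- grd x_eta i j * dx (grid_fn v) i j + grd x_xi i j * dy (grid_fn v) i j)"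
    unfolding gradient_eq * by simp_all
qed

text \<open>
The metric coefficients are those of the pulled-back gradient: expanding
\<open>J (u_x v_x + u_y v_y)\<close>, with the physical derivatives written in reference coordinates, gives the energy
density of \<open>energy_form\<close> at every grid point.
\<close>

lemma curv_form_eq:
  assumes u: "u \<in> carrier_vec N" and v: "v \<in> carrier_vec N"
  shows "curv_form u v = energy_form (grd a1) (grd b) (grd a2) (grid_fn u) (grid_fn v)"
proof -
  note gc = mult_mat_vec_carrier[OF gradient_carrier(1)] mult_mat_vec_carrier[OF gradient_carrier(2)]
  have id: "Jp * ((inverse Jp * (y_eta * ux - y_xi * uy)) * (inverse Jp * (y_eta * vx - y_xi * vy)))
      + Jp * ((inverse Jp * (- x_eta * ux + x_xi * uy)) * (inverse Jp * (- x_eta * vx + x_xi * vy)))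
    = inverse Jp * (x_eta * x_eta + y_eta * y_eta) * (ux * vx)
      + - (inverse Jp * (x_xi * x_eta + y_xi * y_eta)) * (ux * vy + uy * vx)
      + inverse Jp * (x_xi * x_xi + y_xi * y_xi) * (uy * vy)"
    if "0 < Jp" for Jp x_xi x_eta y_xi y_eta ux uy vx vy :: real
    using that by (simp add: field_simps)
  show ?thesis
    unfolding curv_form_def energy_form_def ip_Rm[OF u v] ip_Hm[OF gc(1)[OF u] gc(1)[OF v]] ip_Hm[OF gc(2)[OF u] gc(2)[OF v]]
      grid_sum_add[symmetric]
    unfolding add_right_cancel a1_def a2_def b_def
    by (intro grid_sum_cong) (simp only: grid_fn_gradient u v id[OF J_pos_grid])
qed

lemma hat_carrier: "Dhat_xi M \<in> carrier_mat N N" "Dhat_eta M \<in> carrier_mat N N"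
  unfolding Dhat_xi_def Dhat_eta_def
  using dir1_carrier[OF x.D1hat_carrier] dir2_carrier[OF y.D1hat_carrier] by (simp_all add: npoints_def)

lemma grid_fn_hat:
  assumes "v \<in> carrier_vec N" "i < x.m" "j < y.m"
  shows "grid_fn (Dhat_xi M *\<^sub>v v) i j = dxhat (grid_fn v) i j" "grid_fn (Dhat_eta M *\<^sub>v v) i j = dyhat (grid_fn v) i j"
  unfolding Dhat_xi_def Dhat_eta_def grid_fn_def[of "_ *\<^sub>v _"] dxhat_def dyhat_def
  using dir1_mult_vec[OF x.D1hat_carrier assms] dir2_mult_vec[OF y.D1hat_carrier assms] by auto

lemma grid_trace:
  "point_trace N y.m (e_w M) (\<lambda>j. 0 * y.m + j)"
  "point_trace N y.m (e_e M) (\<lambda>j. (x.m - 1) * y.m + j)"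
  "point_trace N x.m (e_s M) (\<lambda>i. i * y.m + 0)"
  "point_trace N x.m (e_n M) (\<lambda>i. i * y.m + (y.m - 1))"
proof -
  have inj: "inj_on (\<lambda>j. k * y.m + j) {..<y.m}" "inj_on (\<lambda>i. i * y.m + k) {..<x.m}" for k
    using y.npts_pos by (auto intro!: inj_onI)
  have l: "0 < x.m" "x.m - 1 < x.m" "0 < y.m" "y.m - 1 < y.m"
    using x.npts_pos y.npts_pos by auto
  note less = l(1,2)[THEN grid_index_less] grid_index_less[OF _ l(3)] grid_index_less[OF _ l(4)]
  show "point_trace N y.m (e_w M) (\<lambda>j. 0 * y.m + j)"
    by standard (rule e_carrier inj less e_mult_vec(1)[unfolded grid_fn_def] | assumption)+
  show "point_trace N y.m (e_e M) (\<lambda>j. (x.m - 1) * y.m + j)"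
    by standard (rule e_carrier inj less e_mult_vec(2)[unfolded grid_fn_def] | assumption)+
  show "point_trace N x.m (e_s M) (\<lambda>i. i * y.m + 0)"
    by standard (rule e_carrier inj less e_mult_vec(3)[unfolded grid_fn_def] | assumption)+
  show "point_trace N x.m (e_n M) (\<lambda>i. i * y.m + (y.m - 1))"
    by standard (rule e_carrier inj less e_mult_vec(4)[unfolded grid_fn_def] | assumption)+
qed

sublocale w: point_trace N y.m "e_w M" "\<lambda>j. 0 * y.m + j" by (rule grid_trace)
sublocale e: point_trace N y.m "e_e M" "\<lambda>j. (x.m - 1) * y.m + j" by (rule grid_trace)
sublocale s: point_trace N x.m "e_s M" "\<lambda>i. i * y.m + 0" by (rule grid_trace)
sublocale n: point_trace N x.m "e_n M" "\<lambda>i. i * y.m + (y.m - 1)" by (rule grid_trace)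

lemma Hm_side_eq:
  "Hm_w M = mat_diag y.m y.h * e_w M * mat_diag N w2 * (e_w M)\<^sup>T"
  "Hm_e M = mat_diag y.m y.h * e_e M * mat_diag N w2 * (e_e M)\<^sup>T"
  "Hm_s M = mat_diag x.m x.h * e_s M * mat_diag N w1 * (e_s M)\<^sup>T"
  "Hm_n M = mat_diag x.m x.h * e_n M * mat_diag N w1 * (e_n M)\<^sup>T"
  by (simp_all add: Hm_w_def Hm_e_def Hm_s_def Hm_n_def W_eq x.H1_eq y.H1_eq)

lemma Hm_side_carrier:
  "Hm_w M \<in> carrier_mat y.m y.m" "Hm_e M \<in> carrier_mat y.m y.m"
  "Hm_s M \<in> carrier_mat x.m x.m" "Hm_n M \<in> carrier_mat x.m x.m"
  unfolding Hm_side_eq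
  by (rule w.side_norm_carrier e.side_norm_carrier s.side_norm_carrier n.side_norm_carrier)+

lemma dm_carrier:
  "dm_w M \<in> carrier_mat y.m N" "dm_e M \<in> carrier_mat y.m N"
  "dm_s M \<in> carrier_mat x.m N" "dm_n M \<in> carrier_mat x.m N"
  unfolding dm_w_def dm_e_def dm_s_def dm_n_def minv_W_eq coeff_eq
  by (intro uminus_carrier_mat w.conormal_carrier e.conormal_carrier s.conormal_carrier n.conormal_carrier
      hat_carrier D_fst_carrier D_snd_carrier)+

lemma flux_curv:
  assumes u: "u \<in> carrier_vec N" and v: "v \<in> carrier_vec N"
  shows "(e_w M *\<^sub>v u) \<bullet> (Hm_w M *\<^sub>v (dm_w M *\<^sub>v v)) = - xflux (grd a1) (grd b) 0 (grid_fn u) (grid_fn v)"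
    and "(e_e M *\<^sub>v u) \<bullet> (Hm_e M *\<^sub>v (dm_e M *\<^sub>v v)) = xflux (grd a1) (grd b) (x.m - 1) (grid_fn u) (grid_fn v)"
    and "(e_s M *\<^sub>v u) \<bullet> (Hm_s M *\<^sub>v (dm_s M *\<^sub>v v)) = - yflux (grd b) (grd a2) 0 (grid_fn u) (grid_fn v)"
    and "(e_n M *\<^sub>v u) \<bullet> (Hm_n M *\<^sub>v (dm_n M *\<^sub>v v)) = yflux (grd b) (grd a2) (y.m - 1) (grid_fn u) (grid_fn v)"
proof -
  note f = grid_fn_hat[OF v, unfolded grid_fn_def[of "_ *\<^sub>v _"]] grid_fn_D_fst[OF v, unfolded grid_fn_def[of "_ *\<^sub>v _"]]
    grid_fn_D_snd[OF v, unfolded grid_fn_def[of "_ *\<^sub>v _"]]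
  have l: "0 < x.m" "x.m - 1 < x.m" "0 < y.m" "y.m - 1 < y.m"
    using x.npts_pos y.npts_pos by auto
  note eu = w.e_carrier e.e_carrier s.e_carrier n.e_carrier
  note eu = eu[THEN mult_mat_vec_carrier, OF u]
  note neg = dm_carrier(1,3)[unfolded dm_w_def dm_s_def, THEN uminus_carrier_mat]
  show "(e_w M *\<^sub>v u) \<bullet> (Hm_w M *\<^sub>v (dm_w M *\<^sub>v v)) = - xflux (grd a1) (grd b) 0 (grid_fn u) (grid_fn v)"
    unfolding dm_w_def
    by (subst scalar_prod_uminus_mult_vec[OF Hm_side_carrier(1) _ eu(1) v])
       (use neg in simp, simp only: Hm_side_eq minv_W_eq coeff_eq
         w.flux_eq[OF hat_carrier(1) D_snd_carrier u v W_pos(2)] xflux_def grid_fn_def[of u],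
         simp add: f(1)[OF l(1), simplified] f(4)[OF l(1), simplified] del: index_mult_mat_vec)
  show "(e_e M *\<^sub>v u) \<bullet> (Hm_e M *\<^sub>v (dm_e M *\<^sub>v v)) = xflux (grd a1) (grd b) (x.m - 1) (grid_fn u) (grid_fn v)"
    unfolding dm_e_def Hm_side_eq minv_W_eq coeff_eq
      e.flux_eq[OF hat_carrier(1) D_snd_carrier u v W_pos(2)] xflux_def grid_fn_def[of u]
    by (intro sum.cong refl) (simp only: f(1)[OF l(2)] f(4)[OF l(2)] lessThan_iff)
  show "(e_s M *\<^sub>v u) \<bullet> (Hm_s M *\<^sub>v (dm_s M *\<^sub>v v)) = - yflux (grd b) (grd a2) 0 (grid_fn u) (grid_fn v)"
    unfolding dm_s_def
    by (subst scalar_prod_uminus_mult_vec[OF Hm_side_carrier(3) _ eu(3) v])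
       (use neg in simp, simp only: Hm_side_eq minv_W_eq coeff_eq
         s.flux_eq[OF hat_carrier(2) D_fst_carrier u v W_pos(1)] yflux_def grid_fn_def[of u],
         simp add: f(2)[OF _ l(3), simplified] f(3)[OF _ l(3), simplified] del: index_mult_mat_vec)
  show "(e_n M *\<^sub>v u) \<bullet> (Hm_n M *\<^sub>v (dm_n M *\<^sub>v v)) = yflux (grd b) (grd a2) (y.m - 1) (grid_fn u) (grid_fn v)"
    unfolding dm_n_def Hm_side_eq minv_W_eq coeff_eq
      n.flux_eq[OF hat_carrier(2) D_fst_carrier u v W_pos(1)] yflux_def grid_fn_def[of u]
    by (intro sum.cong refl) (simp only: f(2)[OF _ l(4)] f(3)[OF _ l(4)] lessThan_iff)
qed

lemma green_curv:
  assumes u: "u \<in> carrier_vec N" and v: "v \<in> carrier_vec N"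
  shows "ip (Hm M) u (DLm M *\<^sub>v v) = - curv_form u v
    + (e_w M *\<^sub>v u) \<bullet> (Hm_w M *\<^sub>v (dm_w M *\<^sub>v v)) + (e_e M *\<^sub>v u) \<bullet> (Hm_e M *\<^sub>v (dm_e M *\<^sub>v v))
    + (e_s M *\<^sub>v u) \<bullet> (Hm_s M *\<^sub>v (dm_s M *\<^sub>v v)) + (e_n M *\<^sub>v u) \<bullet> (Hm_n M *\<^sub>v (dm_n M *\<^sub>v v))"
proof -
  have "ip (Hm M) u (DLm M *\<^sub>v v) =
      grid_sum (\<lambda>i j. grid_fn u i j * elliptic (grd a1) (grd b) (grd a2) (grid_fn v) i j)"
    unfolding ip_Hm[OF u mult_mat_vec_carrier[OF DLm_carrier v]]
  proof (intro grid_sum_cong)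
    fix i j assume ij: "i < x.m" "j < y.m"
    show "grd J i j * (grid_fn u i j * grid_fn (DLm M *\<^sub>v v) i j) = grid_fn u i j * elliptic (grd a1) (grd b) (grd a2) (grid_fn v) i j"
      unfolding grid_fn_DLm[OF v ij] using J_pos_grid[OF ij] by simp
  qed
  thus ?thesis unfolding green flux_curv[OF u v] curv_form_eq[OF u v] by simp
qed

end

section \<open>Differentiating quadratic forms along a curve\<close>

text \<open>
A solution has the correct dimension only for positive times, and the index-wise derivative says nothing
about dimensions; so membership in the carrier is required in a neighbourhood of \<open>t\<close>.
\<close>

definition curve_deriv :: "nat \<Rightarrow> (real \<Rightarrow> real vec) \<Rightarrow> real vec \<Rightarrow> real \<Rightarrow> bool" where
  "curve_deriv n u u' t \<longleftrightarrow> (\<forall>\<^sub>F s in nhds t. u s \<in> carrier_vec n) \<and> has_vec_deriv n u u' t"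

lemma curve_derivD:
  assumes "curve_deriv n u u' t"
  shows "u t \<in> carrier_vec n" "u' \<in> carrier_vec n"
    and "i < n \<Longrightarrow> ((\<lambda>s. u s $ i) has_real_derivative u' $ i) (at t)"
  using assms eventually_nhds_x_imp_x[of "\<lambda>s. u s \<in> carrier_vec n" t]
  by (simp_all add: curve_deriv_def has_vec_deriv_def)

lemma curve_deriv_mult_mat_vec:
  assumes A: "A \<in> carrier_mat k n" and u: "curve_deriv n u u' t"
  shows "curve_deriv k (\<lambda>s. A *\<^sub>v u s) (A *\<^sub>v u') t"
  unfolding curve_deriv_def has_vec_deriv_def
proof (intro conjI allI impI)
  have ev: "\<forall>\<^sub>F s in nhds t. u s \<in> carrier_vec n" using u by (simp add: curve_deriv_def)
  show "\<forall>\<^sub>F s in nhds t. A *\<^sub>v u s \<in> carrier_vec k"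
    using ev by eventually_elim (rule mult_mat_vec_carrier[OF A])
  show "A *\<^sub>v u' \<in> carrier_vec k" using A curve_derivD[OF u] by simp
  fix i assume i: "i < k"
  have E: "(A *\<^sub>v x) $ i = (\<Sum>j<n. A $$ (i, j) * x $ j)" if "x \<in> carrier_vec n" for x
    using that A i by (simp add: scalar_prod_def lessThan_atLeast0)
  have "((\<lambda>s. \<Sum>j<n. A $$ (i, j) * u s $ j) has_real_derivative (\<Sum>j<n. A $$ (i, j) * u' $ j)) (at t)"
    using curve_derivD(3)[OF u] by (intro DERIV_sum DERIV_cmult) auto
  moreover have "\<forall>\<^sub>F s in nhds t. (A *\<^sub>v u s) $ i = (\<Sum>j<n. A $$ (i, j) * u s $ j)"
    using ev by eventually_elim (rule E)
  ultimately show "((\<lambda>s. (A *\<^sub>v u s) $ i) has_real_derivative (A *\<^sub>v u') $ i) (at t)"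
    unfolding E[OF curve_derivD(2)[OF u]] by (subst DERIV_cong_ev[OF refl _ refl])
qed

lemma curve_deriv_vec_first:
  assumes u: "curve_deriv (n + k) u u' t"
  shows "curve_deriv n (\<lambda>s. vec_first (u s) n) (vec_first u' n) t"
  using curve_derivD(3)[OF u] by (simp add: curve_deriv_def has_vec_deriv_def vec_first_def)

lemma curve_deriv_vec_last:
  assumes u: "curve_deriv (n + k) u u' t"
  shows "curve_deriv k (\<lambda>s. vec_last (u s) k) (vec_last u' k) t"
  unfolding curve_deriv_def has_vec_deriv_def
proof (intro conjI allI impI)
  fix i assume i: "i < k"
  have E: "vec_last x k $ i = x $ (n + i)" if "x \<in> carrier_vec (n + k)" for x
    using that i by (simp add: vec_last_def)
  have "\<forall>\<^sub>F s in nhds t. vec_last (u s) k $ i = u s $ (n + i)"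
    using u unfolding curve_deriv_def by (elim conjE eventually_mono) (rule E)
  thus "((\<lambda>s. vec_last (u s) k $ i) has_real_derivative vec_last u' k $ i) (at t)"
    unfolding E[OF curve_derivD(2)[OF u]] using curve_derivD(3)[OF u, of "n + i"] i
    by (subst DERIV_cong_ev[OF refl _ refl]) auto
qed auto

lemma scalar_prod_has_derivative:
  assumes u: "curve_deriv n u u' t" and v: "curve_deriv n v v' t"
  shows "((\<lambda>s. u s \<bullet> v s) has_real_derivative u' \<bullet> v t + u t \<bullet> v') (at t)"
proof -
  have E: "x \<bullet> y = (\<Sum>j<n. x $ j * y $ j)" if "y \<in> carrier_vec n" for x y :: "real vec"
    using that by (simp add: scalar_prod_def lessThan_atLeast0)
  have "((\<lambda>s. \<Sum>j<n. u s $ j * v s $ j) has_real_derivative (\<Sum>j<n. u t $ j * v' $ j + u' $ j * v t $ j)) (at t)"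
    using curve_derivD(3)[OF u] curve_derivD(3)[OF v] by (intro DERIV_sum DERIV_mult') auto
  moreover have "\<forall>\<^sub>F s in nhds t. u s \<bullet> v s = (\<Sum>j<n. u s $ j * v s $ j)"
    using v unfolding curve_deriv_def by (elim conjE eventually_mono) (rule E)
  moreover have "(\<Sum>j<n. u t $ j * v' $ j + u' $ j * v t $ j) = u' \<bullet> v t + u t \<bullet> v'"
    using E curve_derivD(1,2)[OF v] by (simp add: sum.distrib add.commute)
  ultimately show ?thesis by (subst DERIV_cong_ev[OF refl _ refl]) auto
qed

lemma sqnorm_has_derivative:
  assumes A: "A \<in> carrier_mat n n" and u: "curve_deriv n u u' t"
    and sym: "\<And>x y. x \<in> carrier_vec n \<Longrightarrow> y \<in> carrier_vec n \<Longrightarrow> ip A x y = ip A y x"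
  shows "((\<lambda>s. sqnorm A (u s)) has_real_derivative 2 * ip A (u t) u') (at t)"
  using scalar_prod_has_derivative[OF u curve_deriv_mult_mat_vec[OF A u]] sym[OF curve_derivD(2,1)[OF u]]
  by (simp add: sqnorm_def ip_def)

section \<open>Block vectors and boundary forms\<close>

lemma block_diag2_carrier:
  "A \<in> carrier_mat a a \<Longrightarrow> B \<in> carrier_mat b b \<Longrightarrow> block_diag2 A B \<in> carrier_mat (a + b) (a + b)"
  by (simp add: block_diag2_def)

lemma block_diag2_mult_vec:
  assumes "A \<in> carrier_mat a a" "B \<in> carrier_mat b b" "v \<in> carrier_vec a" "v' \<in> carrier_vec b"
  shows "block_diag2 A B *\<^sub>v (v @\<^sub>v v') = (A *\<^sub>v v) @\<^sub>v (B *\<^sub>v v')"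
  using mult_mat_vec_split[OF assms] assms by (simp add: block_diag2_def)

lemma block_diag2_form:
  assumes "A \<in> carrier_mat a a" "B \<in> carrier_mat b b" "v \<in> carrier_vec a" "v' \<in> carrier_vec b"
    "u \<in> carrier_vec a" "u' \<in> carrier_vec b"
  shows "(u @\<^sub>v u') \<bullet> (block_diag2 A B *\<^sub>v (v @\<^sub>v v')) = u \<bullet> (A *\<^sub>v v) + u' \<bullet> (B *\<^sub>v v')"
  unfolding block_diag2_mult_vec[OF assms(1-4)] using assms by (intro scalar_prod_append) auto

lemma block_diag2_mat_diag:
  "block_diag2 (mat_diag a f) (mat_diag b g) = mat_diag (a + b) (\<lambda>i. if i < a then f i else g (i - a))"
  by (rule eq_matI) (auto simp: block_diag2_def mat_diag_def)

lemma boundary_form_carrier: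
  fixes e H d :: "real mat"
  assumes "e \<in> carrier_mat k n" "H \<in> carrier_mat k k" "d \<in> carrier_mat k m"
  shows "e\<^sup>T * H * d \<in> carrier_mat n m"
  using mult_carrier_mat[OF mult_carrier_mat[of "e\<^sup>T", OF _ assms(2)] assms(3)] assms(1) by simp

lemma boundary_form:
  fixes e H d :: "real mat"
  assumes e: "e \<in> carrier_mat k n" and H: "H \<in> carrier_mat k k" and d: "d \<in> carrier_mat k m"
    and u: "u \<in> carrier_vec n" and v: "v \<in> carrier_vec m"
  shows "u \<bullet> ((e\<^sup>T * H * d) *\<^sub>v v) = (e *\<^sub>v u) \<bullet> (H *\<^sub>v (d *\<^sub>v v))"
proof -
  have eT: "e\<^sup>T \<in> carrier_mat n k" using e by simp
  show ?thesis
    unfolding mult_vec_assoc3[OF eT H d v]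
    by (rule transpose_mult_scalar_prod[OF e u mult_mat_vec_carrier[OF H mult_mat_vec_carrier[OF d v]]])
qed

lemma smult_mat_mult_vec:
  fixes A :: "real mat"
  assumes "A \<in> carrier_mat n m" "v \<in> carrier_vec m"
  shows "(k \<cdot>\<^sub>m A) *\<^sub>v v = k \<cdot>\<^sub>v (A *\<^sub>v v)"
  using assms by (intro eq_vecI) auto

section \<open>The coupled scheme\<close>

locale coupled_scheme = p: rect_grid P + m: curv_block M for P :: tensor_grid and M :: curv_grid +
  assumes conforming: "conforming P M"
begin

abbreviation k where "k \<equiv> n1 P"

lemma n1_eq: "n1 M = k" and interface_norm: "Hp_s P = Hm_n M"
  using conforming by (auto simp: conforming_def)

text \<open>
The diagonal of \<open>Hbar\<close>, by which both blocks enter a single norm.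
\<close>

definition hbar :: "nat \<Rightarrow> real" where
  "hbar i = (if i < p.N then p.x.h (i div p.y.m) * p.y.h (i mod p.y.m)
     else m.x.h ((i - p.N) div m.y.m) * m.y.h ((i - p.N) mod m.y.m) * m.J (i - p.N))"

lemma Hbar_eq: "Hbar P M = mat_diag (p.N + m.N) hbar"
  by (simp add: Hbar_def p.Hp_eq m.Hm_eq block_diag2_mat_diag hbar_def[abs_def])

lemma hbar_pos: "i < p.N + m.N \<Longrightarrow> 0 < hbar i"
  using p.norm_pos[of i] m.norm_pos[of "i - p.N"] m.J_pos[of "i - p.N"] by (auto simp: hbar_def)

lemma em_n_carrier: "e_n M \<in> carrier_mat k m.N"
  using m.e_carrier(4) n1_eq by simp

lemma L_carrier: "Lmat P M \<in> carrier_mat (k + k) (p.N + m.N)"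
  using four_block_carrier_mat[OF p.e_carrier(4), of "- e_n M" k m.N] em_n_carrier by (simp add: Lmat_def)

lemma L_mult_vec:
  assumes a: "a \<in> carrier_vec p.N" and b: "b \<in> carrier_vec m.N"
  shows "Lmat P M *\<^sub>v (a @\<^sub>v b) = (e_n P *\<^sub>v a) @\<^sub>v (e_s P *\<^sub>v a - e_n M *\<^sub>v b)"
proof -
  have "Lmat P M *\<^sub>v (a @\<^sub>v b) =
      (e_n P *\<^sub>v a + 0\<^sub>m k m.N *\<^sub>v b) @\<^sub>v (e_s P *\<^sub>v a + - e_n M *\<^sub>v b)"
    unfolding Lmat_def
    by (rule four_block_mat_mult_vec[OF p.e_carrier(4) zero_carrier_mat p.e_carrier(3) _ a b])
       (use em_n_carrier in simp)
  moreover have "e_n P *\<^sub>v a + 0\<^sub>m k m.N *\<^sub>v b = e_n P *\<^sub>v a"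
    using mult_mat_vec_carrier[OF p.e_carrier(4) a] by (simp add: zero_mat_mult_vec[OF b])
  moreover have "e_s P *\<^sub>v a + - e_n M *\<^sub>v b = e_s P *\<^sub>v a - e_n M *\<^sub>v b"
    using a b p.e_carrier(3) em_n_carrier by (intro eq_vecI) (auto simp: uminus_mult_mat_vec)
  ultimately show ?thesis by simp
qed

text \<open>
The constraints are solved one after the other: a function on the rectangle attains the value on its north
side, and the function on the curvilinear block then makes up for whatever trace this leaves at the
interface. The argument also covers a rectangle consisting of a single grid row, where the north and south traces
coincide.
\<close>

lemma L_surjective:
  assumes "z \<in> carrier_vec (k + k)"
  shows "\<exists>x\<in>carrier_vec (p.N + m.N). Lmat P M *\<^sub>v x = z"
proof -
  define z1 where "z1 = vec_first z k"
  define z2 where "z2 = vec_last z k"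
  have z: "z = z1 @\<^sub>v z2" "z1 \<in> carrier_vec k" "z2 \<in> carrier_vec k"
    using assms by (auto simp: z1_def z2_def)
  obtain a where a: "a \<in> carrier_vec p.N" "e_n P *\<^sub>v a = z1" using p.e_n_surjective[OF z(2)] by auto
  have es: "e_s P *\<^sub>v a \<in> carrier_vec k" by (rule mult_mat_vec_carrier[OF p.e_carrier(3) a(1)])
  obtain b where b: "b \<in> carrier_vec m.N" "e_n M *\<^sub>v b = e_s P *\<^sub>v a - z2"
    using m.e_n_surjective[of "e_s P *\<^sub>v a - z2"] es z n1_eq by auto
  have "e_s P *\<^sub>v a - (e_s P *\<^sub>v a - z2) = z2"
    using es z(3) by (intro eq_vecI) auto
  hence "Lmat P M *\<^sub>v (a @\<^sub>v b) = z" unfolding L_mult_vec[OF a(1) b(1)] a b z(1) by simp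
  thus ?thesis using a b by (intro bexI[of _ "a @\<^sub>v b"]) auto
qed

sublocale pr: constraint_projection "p.N + m.N" "k + k" hbar "Hbar P M" "Lmat P M"
  by standard (rule Hbar_eq hbar_pos L_carrier L_surjective | assumption)+

lemma Proj_eq: "Proj P M = pr.Pr"
  by (simp add: Proj_def pr.Pr_def Ntot_def)

lemma constraint_kernel:
  assumes a: "a \<in> carrier_vec p.N" and b: "b \<in> carrier_vec m.N" and L: "Lmat P M *\<^sub>v (a @\<^sub>v b) = 0\<^sub>v (k + k)"
  shows "e_n P *\<^sub>v a = 0\<^sub>v k" "e_s P *\<^sub>v a = e_n M *\<^sub>v b"
proof -
  have c: "e_n P *\<^sub>v a \<in> carrier_vec k" "e_s P *\<^sub>v a \<in> carrier_vec k" "e_n M *\<^sub>v b \<in> carrier_vec k"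
    using mult_mat_vec_carrier[OF p.e_carrier(4) a] mult_mat_vec_carrier[OF p.e_carrier(3) a]
      mult_mat_vec_carrier[OF em_n_carrier b] by auto
  have "0\<^sub>v (k + k) = 0\<^sub>v k @\<^sub>v (0\<^sub>v k :: real vec)" by (intro eq_vecI) auto
  hence E: "e_n P *\<^sub>v a = 0\<^sub>v k" "e_s P *\<^sub>v a - e_n M *\<^sub>v b = 0\<^sub>v k"
    using L append_vec_eq[OF c(1) zero_carrier_vec] unfolding L_mult_vec[OF a b] by auto
  show "e_n P *\<^sub>v a = 0\<^sub>v k" by (rule E)
  show "e_s P *\<^sub>v a = e_n M *\<^sub>v b"
  proof (rule eq_vecI)
    fix i assume "i < dim_vec (e_n M *\<^sub>v b)"
    hence i: "i < k" using em_n_carrier by simp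
    have "(e_s P *\<^sub>v a - e_n M *\<^sub>v b) $ i = 0" using E(2) i by simp
    thus "(e_s P *\<^sub>v a) $ i = (e_n M *\<^sub>v b) $ i"
      using i c em_n_carrier by (simp del: index_mult_mat_vec)
  qed (use c p.e_carrier(3) em_n_carrier in simp)
qed

lemma penalty_carrier:
  assumes "B \<in> carrier_mat (p.N + m.N) (p.N + m.N)"
  shows "- (minv (Hbar P M) * B) \<in> carrier_mat (p.N + m.N) (p.N + m.N)"
  using mult_carrier_mat[OF pr.H_carrier(2) assms] by simp

text \<open>
Every SAT term carries the inverse norm, so in the energy product it acts through its bare boundary form.
\<close>

lemma penalty_form:
  assumes B: "B \<in> carrier_mat (p.N + m.N) (p.N + m.N)"
    and u: "u \<in> carrier_vec (p.N + m.N)" and v: "v \<in> carrier_vec (p.N + m.N)"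
  shows "u \<bullet> (Hbar P M *\<^sub>v (- (minv (Hbar P M) * B) *\<^sub>v v)) = - (u \<bullet> (B *\<^sub>v v))"
  unfolding scalar_prod_uminus_mult_vec[OF pr.H_carrier(1) mult_carrier_mat[OF pr.H_carrier(2) B] u v]
  by (simp only: assoc_mult_mat_vec[OF pr.H_carrier(2) B v] pr.H_mult_minv_H[OF mult_mat_vec_carrier[OF B v]])

abbreviation west_penalty where "west_penalty \<equiv> block_diag2 ((e_w P)\<^sup>T * Hp_w P * dp_w P) ((e_w M)\<^sup>T * Hm_w M * dm_w M)"
abbreviation east_penalty where "east_penalty \<equiv> block_diag2 ((e_e P)\<^sup>T * Hp_e P * dp_e P) ((e_e M)\<^sup>T * Hm_e M * dm_e M)"
abbreviation south_penalty where "south_penalty \<equiv> block_diag2 (0\<^sub>m p.N p.N) ((e_s M)\<^sup>T * Hm_s M * dm_s M)"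
abbreviation interface_penalty where "interface_penalty \<equiv> four_block_mat ((e_s P)\<^sup>T * Hp_s P * dp_s P) ((e_s P)\<^sup>T * Hp_s P * dm_n M)
       (0\<^sub>m m.N p.N) (0\<^sub>m m.N m.N)"
abbreviation west_damping where "west_damping \<equiv> block_diag2 ((e_w P)\<^sup>T * Hp_w P * e_w P) ((e_w M)\<^sup>T * Hm_w M * e_w M)"
abbreviation east_damping where "east_damping \<equiv> block_diag2 ((e_e P)\<^sup>T * Hp_e P * e_e P) ((e_e M)\<^sup>T * Hm_e M * e_e M)"

definition spatial_op :: "real mat" where
  "spatial_op = block_diag2 (DLp P) (DLm M) + SAT_BC1 P M + SAT_IC P M"

lemma Hp_side_carrier:
  "Hp_w P \<in> carrier_mat p.y.m p.y.m" "Hp_e P \<in> carrier_mat p.y.m p.y.m"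
  "Hp_s P \<in> carrier_mat k k" "Hp_n P \<in> carrier_mat k k"
  by (simp_all add: Hp_w_def Hp_e_def Hp_s_def Hp_n_def p.x.H1_carrier p.y.H1_carrier)

lemma dm_n_carrier: "dm_n M \<in> carrier_mat k m.N"
  using m.dm_carrier(4) n1_eq by simp

lemma side_block_carrier:
  "(e_w P)\<^sup>T * Hp_w P * dp_w P \<in> carrier_mat p.N p.N" "(e_w M)\<^sup>T * Hm_w M * dm_w M \<in> carrier_mat m.N m.N"
  "(e_e P)\<^sup>T * Hp_e P * dp_e P \<in> carrier_mat p.N p.N" "(e_e M)\<^sup>T * Hm_e M * dm_e M \<in> carrier_mat m.N m.N"
  "(e_s M)\<^sup>T * Hm_s M * dm_s M \<in> carrier_mat m.N m.N"
  "(e_s P)\<^sup>T * Hp_s P * dp_s P \<in> carrier_mat p.N p.N" "(e_s P)\<^sup>T * Hp_s P * dm_n M \<in> carrier_mat p.N m.N"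
  "(e_w P)\<^sup>T * Hp_w P * e_w P \<in> carrier_mat p.N p.N" "(e_w M)\<^sup>T * Hm_w M * e_w M \<in> carrier_mat m.N m.N"
  "(e_e P)\<^sup>T * Hp_e P * e_e P \<in> carrier_mat p.N p.N" "(e_e M)\<^sup>T * Hm_e M * e_e M \<in> carrier_mat m.N m.N"
  by (rule boundary_form_carrier p.e_carrier m.e_carrier Hp_side_carrier m.Hm_side_carrier
      p.dp_carrier m.dm_carrier dm_n_carrier)+

lemma block_carrier:
  "west_penalty \<in> carrier_mat (p.N + m.N) (p.N + m.N)" "east_penalty \<in> carrier_mat (p.N + m.N) (p.N + m.N)"
  "south_penalty \<in> carrier_mat (p.N + m.N) (p.N + m.N)" "interface_penalty \<in> carrier_mat (p.N + m.N) (p.N + m.N)"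
  "west_damping \<in> carrier_mat (p.N + m.N) (p.N + m.N)" "east_damping \<in> carrier_mat (p.N + m.N) (p.N + m.N)"
  "block_diag2 (DLp P) (DLm M) \<in> carrier_mat (p.N + m.N) (p.N + m.N)"
  by (intro block_diag2_carrier four_block_carrier_mat side_block_carrier zero_carrier_mat p.DLp_carrier m.DLm_carrier)+

lemma SAT_carrier:
  "SAT_BC1 P M \<in> carrier_mat (p.N + m.N) (p.N + m.N)" "SAT_BC2 P M \<in> carrier_mat (p.N + m.N) (p.N + m.N)"
  "SAT_IC P M \<in> carrier_mat (p.N + m.N) (p.N + m.N)"
  unfolding SAT_BC1_def SAT_BC2_def SAT_IC_def
  by (intro penalty_carrier add_carrier_mat block_carrier)+

lemma spatial_op_carrier: "spatial_op \<in> carrier_mat (p.N + m.N) (p.N + m.N)"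
  unfolding spatial_op_def by (intro add_carrier_mat SAT_carrier)

text \<open>
The heart of the stability proof: for a test function satisfying the constraints all boundary fluxes cancel, and the
spatial operator acts as minus the energy form.
\<close>

lemma spatial_form:
  assumes u: "ua \<in> carrier_vec p.N" "ub \<in> carrier_vec m.N" and v: "va \<in> carrier_vec p.N" "vb \<in> carrier_vec m.N"
    and L: "Lmat P M *\<^sub>v (ua @\<^sub>v ub) = 0\<^sub>v (k + k)"
  shows "(ua @\<^sub>v ub) \<bullet> (Hbar P M *\<^sub>v (spatial_op *\<^sub>v (va @\<^sub>v vb))) = - (p.rect_form ua va + m.curv_form ub vb)"
proof -
  define U where "U = ua @\<^sub>v ub"
  define V where "V = va @\<^sub>v vb"
  have U: "U \<in> carrier_vec (p.N + m.N)" and V: "V \<in> carrier_vec (p.N + m.N)"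
    unfolding U_def V_def using u v by auto
  note mv = mult_mat_vec_carrier[OF _ V]
  have "spatial_op *\<^sub>v V = block_diag2 (DLp P) (DLm M) *\<^sub>v V + SAT_BC1 P M *\<^sub>v V + SAT_IC P M *\<^sub>v V"
    unfolding spatial_op_def
    by (simp only: add_mult_distrib_mat_vec[OF add_carrier_mat[OF SAT_carrier(1)] SAT_carrier(3) V]
      add_mult_distrib_mat_vec[OF block_carrier(7) SAT_carrier(1) V])
  hence split: "U \<bullet> (Hbar P M *\<^sub>v (spatial_op *\<^sub>v V)) = U \<bullet> (Hbar P M *\<^sub>v (block_diag2 (DLp P) (DLm M) *\<^sub>v V))
      + U \<bullet> (Hbar P M *\<^sub>v (SAT_BC1 P M *\<^sub>v V)) + U \<bullet> (Hbar P M *\<^sub>v (SAT_IC P M *\<^sub>v V))"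
    using form_add_vec[OF pr.H_carrier(1) U add_carrier_vec[OF mv[OF block_carrier(7)] mv[OF SAT_carrier(1)]] mv[OF SAT_carrier(3)]]
      form_add_vec[OF pr.H_carrier(1) U mv[OF block_carrier(7)] mv[OF SAT_carrier(1)]] by simp
  have Hc: "Hp P \<in> carrier_mat p.N p.N" "Hm M \<in> carrier_mat m.N m.N"
    by (simp_all add: p.Hp_eq m.Hm_eq)
  have lap: "U \<bullet> (Hbar P M *\<^sub>v (block_diag2 (DLp P) (DLm M) *\<^sub>v V)) = ip (Hp P) ua (DLp P *\<^sub>v va) + ip (Hm M) ub (DLm M *\<^sub>v vb)"
    unfolding U_def V_def Hbar_def block_diag2_mult_vec[OF p.DLp_carrier m.DLm_carrier v] ip_def
    by (rule block_diag2_form[OF Hc mult_mat_vec_carrier[OF p.DLp_carrier v(1)] mult_mat_vec_carrier[OF m.DLm_carrier v(2)] u])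
  have bc: "U \<bullet> (Hbar P M *\<^sub>v (SAT_BC1 P M *\<^sub>v V)) = - (U \<bullet> (west_penalty *\<^sub>v V) + U \<bullet> (east_penalty *\<^sub>v V) + U \<bullet> (south_penalty *\<^sub>v V))"
    unfolding SAT_BC1_def penalty_form[OF add_carrier_mat[OF block_carrier(3)] U V]
      form_add_mat[OF add_carrier_mat[OF block_carrier(2)] block_carrier(3) U V]
      form_add_mat[OF block_carrier(1) block_carrier(2) U V] ..
  have ic: "U \<bullet> (Hbar P M *\<^sub>v (SAT_IC P M *\<^sub>v V)) = - (U \<bullet> (interface_penalty *\<^sub>v V))"
    unfolding SAT_IC_def by (rule penalty_form[OF block_carrier(4) U V])
  have w: "U \<bullet> (west_penalty *\<^sub>v V) = (e_w P *\<^sub>v ua) \<bullet> (Hp_w P *\<^sub>v (dp_w P *\<^sub>v va)) + (e_w M *\<^sub>v ub) \<bullet> (Hm_w M *\<^sub>v (dm_w M *\<^sub>v vb))"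
    unfolding U_def V_def block_diag2_form[OF side_block_carrier(1,2) v u]
    by (simp only: boundary_form[OF p.e_carrier(1) Hp_side_carrier(1) p.dp_carrier(1) u(1) v(1)]
      boundary_form[OF m.e_carrier(1) m.Hm_side_carrier(1) m.dm_carrier(1) u(2) v(2)])
  have e: "U \<bullet> (east_penalty *\<^sub>v V) = (e_e P *\<^sub>v ua) \<bullet> (Hp_e P *\<^sub>v (dp_e P *\<^sub>v va)) + (e_e M *\<^sub>v ub) \<bullet> (Hm_e M *\<^sub>v (dm_e M *\<^sub>v vb))"
    unfolding U_def V_def block_diag2_form[OF side_block_carrier(3,4) v u]
    by (simp only: boundary_form[OF p.e_carrier(2) Hp_side_carrier(2) p.dp_carrier(2) u(1) v(1)]
      boundary_form[OF m.e_carrier(2) m.Hm_side_carrier(2) m.dm_carrier(2) u(2) v(2)])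
  have s: "U \<bullet> (south_penalty *\<^sub>v V) = (e_s M *\<^sub>v ub) \<bullet> (Hm_s M *\<^sub>v (dm_s M *\<^sub>v vb))"
    unfolding U_def V_def block_diag2_form[OF zero_carrier_mat side_block_carrier(5) v u]
      boundary_form[OF m.e_carrier(3) m.Hm_side_carrier(3) m.dm_carrier(3) u(2) v(2)]
    using u(1) by (simp add: zero_mat_mult_vec[OF v(1)])
  have i: "U \<bullet> (interface_penalty *\<^sub>v V) = (e_s P *\<^sub>v ua) \<bullet> (Hp_s P *\<^sub>v (dp_s P *\<^sub>v va)) + (e_s P *\<^sub>v ua) \<bullet> (Hp_s P *\<^sub>v (dm_n M *\<^sub>v vb))"
  proof -
    have c: "((e_s P)\<^sup>T * Hp_s P * dp_s P) *\<^sub>v va \<in> carrier_vec p.N" "((e_s P)\<^sup>T * Hp_s P * dm_n M) *\<^sub>v vb \<in> carrier_vec p.N"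
      by (rule mult_mat_vec_carrier[OF side_block_carrier(6) v(1)] mult_mat_vec_carrier[OF side_block_carrier(7) v(2)])+
    have "interface_penalty *\<^sub>v V = (((e_s P)\<^sup>T * Hp_s P * dp_s P) *\<^sub>v va + ((e_s P)\<^sup>T * Hp_s P * dm_n M) *\<^sub>v vb) @\<^sub>v 0\<^sub>v m.N"
      unfolding V_def four_block_mat_mult_vec[OF side_block_carrier(6,7) zero_carrier_mat zero_carrier_mat v]
      using v(1,2) by (simp add: zero_mat_mult_vec)
    hence "U \<bullet> (interface_penalty *\<^sub>v V) = ua \<bullet> (((e_s P)\<^sup>T * Hp_s P * dp_s P) *\<^sub>v va + ((e_s P)\<^sup>T * Hp_s P * dm_n M) *\<^sub>v vb) + ub \<bullet> 0\<^sub>v m.N"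
      unfolding U_def using scalar_prod_append[OF u add_carrier_vec[OF c] zero_carrier_vec] by simp
    thus ?thesis
      unfolding scalar_prod_add_distrib[OF u(1) c]
        boundary_form[OF p.e_carrier(3) Hp_side_carrier(3) p.dp_carrier(3) u(1) v(1)]
        boundary_form[OF p.e_carrier(3) Hp_side_carrier(3) dm_n_carrier u(1) v(2)]
      using u(2) by simp
  qed
  \<comment> \<open>No SAT term acts on the north side of the rectangle: its flux meets a vanishing trace.\<close>
  have "(e_n P *\<^sub>v ua) \<bullet> (Hp_n P *\<^sub>v (dp_n P *\<^sub>v va)) = 0"
    unfolding constraint_kernel(1)[OF u L]
    by (rule scalar_prod_left_zero[OF mult_mat_vec_carrier[OF Hp_side_carrier(4) mult_mat_vec_carrier[OF p.dp_carrier(4) v(1)]]])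
  thus ?thesis
    using split[unfolded lap bc ic w e s i p.green_rect[OF u(1) v(1)] m.green_curv[OF u(2) v(2)]
        constraint_kernel(2)[OF u L], unfolded interface_norm]
    unfolding U_def[symmetric] V_def[symmetric] by simp
qed

text \<open>
The damping term is minus a sum of squares of the west and east boundary values, with positive weights.
\<close>

lemma damping_form:
  assumes u: "ua \<in> carrier_vec p.N" "ub \<in> carrier_vec m.N"
  shows "(ua @\<^sub>v ub) \<bullet> (Hbar P M *\<^sub>v (SAT_BC2 P M *\<^sub>v (ua @\<^sub>v ub))) \<le> 0"
proof -
  define U where "U = ua @\<^sub>v ub"
  have U: "U \<in> carrier_vec (p.N + m.N)" unfolding U_def using u by auto
  have "U \<bullet> (Hbar P M *\<^sub>v (SAT_BC2 P M *\<^sub>v U)) = - (U \<bullet> (west_damping *\<^sub>v U) + U \<bullet> (east_damping *\<^sub>v U))"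
    unfolding SAT_BC2_def penalty_form[OF add_carrier_mat[OF block_carrier(6)] U U]
      form_add_mat[OF block_carrier(5) block_carrier(6) U U] ..
  moreover have "U \<bullet> (west_damping *\<^sub>v U) = (e_w P *\<^sub>v ua) \<bullet> (Hp_w P *\<^sub>v (e_w P *\<^sub>v ua)) + (e_w M *\<^sub>v ub) \<bullet> (Hm_w M *\<^sub>v (e_w M *\<^sub>v ub))"
    unfolding U_def block_diag2_form[OF side_block_carrier(8,9) u u]
    by (simp only: boundary_form[OF p.e_carrier(1) Hp_side_carrier(1) p.e_carrier(1) u(1) u(1)]
      boundary_form[OF m.e_carrier(1) m.Hm_side_carrier(1) m.e_carrier(1) u(2) u(2)])
  moreover have "U \<bullet> (east_damping *\<^sub>v U) = (e_e P *\<^sub>v ua) \<bullet> (Hp_e P *\<^sub>v (e_e P *\<^sub>v ua)) + (e_e M *\<^sub>v ub) \<bullet> (Hm_e M *\<^sub>v (e_e M *\<^sub>v ub))"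
    unfolding U_def block_diag2_form[OF side_block_carrier(10,11) u u]
    by (simp only: boundary_form[OF p.e_carrier(2) Hp_side_carrier(2) p.e_carrier(2) u(1) u(1)]
      boundary_form[OF m.e_carrier(2) m.Hm_side_carrier(2) m.e_carrier(2) u(2) u(2)])
  moreover have "0 \<le> z \<bullet> (Hp_w P *\<^sub>v z)" "0 \<le> z \<bullet> (Hp_e P *\<^sub>v z)" if "z \<in> carrier_vec p.y.m" for z
    unfolding Hp_w_def Hp_e_def p.H1_scalar_prod_y[OF that that]
    by (auto intro!: sum_nonneg mult_nonneg_nonneg[OF less_imp_le[OF p.y.norm_weight_pos]])
  moreover have "0 \<le> z \<bullet> (Hm_w M *\<^sub>v z)" "0 \<le> z \<bullet> (Hm_e M *\<^sub>v z)" if "z \<in> carrier_vec m.y.m" for z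
    unfolding m.Hm_side_eq m.w.scalar_prod_side_norm[OF that that] m.e.scalar_prod_side_norm[OF that that]
    by (intro sum_nonneg mult_nonneg_nonneg[OF less_imp_le[OF m.y.norm_weight_pos]]
        mult_nonneg_nonneg[OF less_imp_le[OF m.w_pos(2)[OF m.w.q_less]]]
        mult_nonneg_nonneg[OF less_imp_le[OF m.w_pos(2)[OF m.e.q_less]]]; simp)+
  ultimately show ?thesis
    unfolding U_def
    using mult_mat_vec_carrier[OF p.e_carrier(1) u(1)] mult_mat_vec_carrier[OF p.e_carrier(2) u(1)]
      mult_mat_vec_carrier[OF m.e_carrier(1) u(2)] mult_mat_vec_carrier[OF m.e_carrier(2) u(2)]
    by (smt (verit))
qed

lemma energy_p_nonneg: "0 \<le> energy_p c P M w wt"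
  unfolding energy_p_def Let_def
  by (intro add_nonneg_nonneg mult_nonneg_nonneg p.sqnorm_Hp_nonneg p.sqnorm_Rp_nonneg p.D_mult_carrier
      vec_first_carrier zero_le_power2)

lemma energy_m_nonneg: "0 \<le> energy_m c P M w wt"
  unfolding energy_m_def Let_def
  by (intro add_nonneg_nonneg mult_nonneg_nonneg m.sqnorm_Hm_nonneg m.sqnorm_Rm_nonneg vec_last_carrier
      mult_mat_vec_carrier[OF m.gradient_carrier(1)] mult_mat_vec_carrier[OF m.gradient_carrier(2)] zero_le_power2)

lemma energy_p_derivative:
  assumes w: "curve_deriv (p.N + m.N) w (wt t) t" and wt: "curve_deriv (p.N + m.N) wt wtt t"
  shows "((\<lambda>s. energy_p c P M (w s) (wt s)) has_real_derivative
    2 * (ip (Hp P) (vec_first (wt t) p.N) (vec_first wtt p.N)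
      + c\<^sup>2 * p.rect_form (vec_first (Proj P M *\<^sub>v w t) p.N) (vec_first (Proj P M *\<^sub>v wt t) p.N))) (at t)"
proof -
  have Hc: "Hp P \<in> carrier_mat p.N p.N" by (simp add: p.Hp_eq)
  have Pc: "Proj P M \<in> carrier_mat (p.N + m.N) (p.N + m.N)" by (simp add: Proj_eq pr.Pr_carrier)
  note v = curve_deriv_vec_first[OF curve_deriv_mult_mat_vec[OF Pc w]]
  note d = sqnorm_has_derivative[OF Hc curve_deriv_vec_first[OF wt] p.ip_Hp_symmetric]
    sqnorm_has_derivative[OF Hc curve_deriv_mult_mat_vec[OF p.D_fst_carrier v] p.ip_Hp_symmetric]
    sqnorm_has_derivative[OF Hc curve_deriv_mult_mat_vec[OF p.D_snd_carrier v] p.ip_Hp_symmetric]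
    sqnorm_has_derivative[OF p.Rp_carrier v p.ip_Rp_symmetric]
  show ?thesis
    unfolding energy_p_def Let_def
    by (rule DERIV_cong[OF DERIV_add[OF DERIV_add[OF DERIV_add[OF d(1) DERIV_cmult[OF d(2)]] DERIV_cmult[OF d(3)]] DERIV_cmult[OF d(4)]]])
       (simp_all add: p.rect_form_def algebra_simps)
qed

lemma energy_m_derivative:
  assumes w: "curve_deriv (p.N + m.N) w (wt t) t" and wt: "curve_deriv (p.N + m.N) wt wtt t"
  shows "((\<lambda>s. energy_m c P M (w s) (wt s)) has_real_derivative
    2 * (ip (Hm M) (vec_last (wt t) m.N) (vec_last wtt m.N)
      + c\<^sup>2 * m.curv_form (vec_last (Proj P M *\<^sub>v w t) m.N) (vec_last (Proj P M *\<^sub>v wt t) m.N))) (at t)"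
proof -
  have Hc: "Hm M \<in> carrier_mat m.N m.N" by (simp add: m.Hm_eq)
  have Pc: "Proj P M \<in> carrier_mat (p.N + m.N) (p.N + m.N)" by (simp add: Proj_eq pr.Pr_carrier)
  note v = curve_deriv_vec_last[OF curve_deriv_mult_mat_vec[OF Pc w]]
  note d = sqnorm_has_derivative[OF Hc curve_deriv_vec_last[OF wt] m.ip_Hm_symmetric]
    sqnorm_has_derivative[OF Hc curve_deriv_mult_mat_vec[OF m.gradient_carrier(1) v] m.ip_Hm_symmetric]
    sqnorm_has_derivative[OF Hc curve_deriv_mult_mat_vec[OF m.gradient_carrier(2) v] m.ip_Hm_symmetric]
    sqnorm_has_derivative[OF m.Rm_carrier v m.ip_Rm_symmetric]
  show ?thesis
    unfolding energy_m_def Let_def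
    by (rule DERIV_cong[OF DERIV_add[OF DERIV_add[OF DERIV_add[OF d(1) DERIV_cmult[OF d(2)]] DERIV_cmult[OF d(3)]] DERIV_cmult[OF d(4)]]])
       (simp_all add: m.curv_form_def algebra_simps)
qed

lemma rect_form_symmetric: "u \<in> carrier_vec p.N \<Longrightarrow> v \<in> carrier_vec p.N \<Longrightarrow> p.rect_form u v = p.rect_form v u"
  by (simp add: p.rect_form_def p.ip_Hp_symmetric p.ip_Rp_symmetric p.D_mult_carrier)

lemma curv_form_symmetric: "u \<in> carrier_vec m.N \<Longrightarrow> v \<in> carrier_vec m.N \<Longrightarrow> m.curv_form u v = m.curv_form v u"
  using mult_mat_vec_carrier[OF m.gradient_carrier(1)] mult_mat_vec_carrier[OF m.gradient_carrier(2)]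
  by (simp add: m.curv_form_def m.ip_Hm_symmetric m.ip_Rm_symmetric)

text \<open>
The rate of change is exactly \<open>2 c (Y, SAT_BC2 Y)\<close> in the norm of \<open>Hbar\<close>, where \<open>Y\<close> is the projected velocity.
\<close>

lemma energy_rate:
  assumes c: "0 < c" and w: "curve_deriv (p.N + m.N) w (wt t) t"
    and wt: "curve_deriv (p.N + m.N) wt (Dmat c P M *\<^sub>v w t + Emat c P M *\<^sub>v wt t) t"
  shows "\<exists>d\<le>0. ((\<lambda>s. energy_p c P M (w s) (wt s) + energy_m c P M (w s) (wt s)) has_real_derivative d) (at t)"
proof -
  define n where "n = p.N + m.N"
  define X where "X = Proj P M *\<^sub>v w t"
  define Y where "Y = Proj P M *\<^sub>v wt t"
  define wtt where "wtt = Dmat c P M *\<^sub>v w t + Emat c P M *\<^sub>v wt t"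
  have Pc: "Proj P M \<in> carrier_mat n n" by (simp add: Proj_eq pr.Pr_carrier n_def)
  have Ac: "spatial_op \<in> carrier_mat n n" and Sc: "SAT_BC2 P M \<in> carrier_mat n n" and Hc: "Hbar P M \<in> carrier_mat n n"
    unfolding n_def by (rule spatial_op_carrier SAT_carrier pr.H_carrier)+
  have x: "w t \<in> carrier_vec n" and y: "wt t \<in> carrier_vec n"
    unfolding n_def by (rule curve_derivD(1)[OF w] curve_derivD(1)[OF wt])+
  have X: "X \<in> carrier_vec n" and Y: "Y \<in> carrier_vec n"
    unfolding X_def Y_def using Pc x y by auto
  have AX: "spatial_op *\<^sub>v X \<in> carrier_vec n" and SY: "SAT_BC2 P M *\<^sub>v Y \<in> carrier_vec n"
    using Ac Sc X Y by auto
  have wtt_eq: "wtt = c\<^sup>2 \<cdot>\<^sub>v (Proj P M *\<^sub>v (spatial_op *\<^sub>v X)) + c \<cdot>\<^sub>v (Proj P M *\<^sub>v (SAT_BC2 P M *\<^sub>v Y))"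
    unfolding wtt_def Dmat_def Emat_def spatial_op_def[symmetric] X_def Y_def
      mult_vec_assoc3[OF Pc Ac Pc x, symmetric] mult_vec_assoc3[OF Pc Sc Pc y, symmetric]
    by (simp only: smult_mat_mult_vec[OF mult_carrier_mat[OF mult_carrier_mat[OF Pc Ac] Pc] x]
      smult_mat_mult_vec[OF mult_carrier_mat[OF mult_carrier_mat[OF Pc Sc] Pc] y])
  have PAX: "Proj P M *\<^sub>v (spatial_op *\<^sub>v X) \<in> carrier_vec n" and PSY: "Proj P M *\<^sub>v (SAT_BC2 P M *\<^sub>v Y) \<in> carrier_vec n"
    by (rule mult_mat_vec_carrier[OF Pc AX] mult_mat_vec_carrier[OF Pc SY])+
  have wtt: "wtt \<in> carrier_vec n" unfolding wtt_eq using PAX PSY by simp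
  have "wt t \<bullet> (Hbar P M *\<^sub>v wtt) =
      c\<^sup>2 * (wt t \<bullet> (Hbar P M *\<^sub>v (Proj P M *\<^sub>v (spatial_op *\<^sub>v X)))) + c * (wt t \<bullet> (Hbar P M *\<^sub>v (Proj P M *\<^sub>v (SAT_BC2 P M *\<^sub>v Y))))"
    unfolding wtt_eq form_add_vec[OF Hc y smult_carrier_vec[THEN iffD2, OF PAX] smult_carrier_vec[THEN iffD2, OF PSY]]
      mult_mat_vec[OF Hc PAX] mult_mat_vec[OF Hc PSY]
      scalar_prod_smult_distrib[OF y mult_mat_vec_carrier[OF Hc PAX]] scalar_prod_smult_distrib[OF y mult_mat_vec_carrier[OF Hc PSY]] ..
  also have "\<dots> = c\<^sup>2 * (Y \<bullet> (Hbar P M *\<^sub>v (spatial_op *\<^sub>v X))) + c * (Y \<bullet> (Hbar P M *\<^sub>v (SAT_BC2 P M *\<^sub>v Y)))"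
    using pr.Pr_self_adjoint[OF y[unfolded n_def] AX[unfolded n_def]] pr.Pr_self_adjoint[OF y[unfolded n_def] SY[unfolded n_def]] by (simp add: Proj_eq Y_def)
  finally have kin: "wt t \<bullet> (Hbar P M *\<^sub>v wtt) =
      c\<^sup>2 * (Y \<bullet> (Hbar P M *\<^sub>v (spatial_op *\<^sub>v X))) + c * (Y \<bullet> (Hbar P M *\<^sub>v (SAT_BC2 P M *\<^sub>v Y)))" .
  have parts: "z = vec_first z p.N @\<^sub>v vec_last z m.N" if "z \<in> carrier_vec n" for z :: "real vec"
    using that by (simp add: n_def)
  have LY: "Lmat P M *\<^sub>v (vec_first Y p.N @\<^sub>v vec_last Y m.N) = 0\<^sub>v (k + k)"
    using pr.L_Pr[OF y[unfolded n_def]] parts[OF Y] by (simp add: Proj_eq Y_def)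
  have pot: "Y \<bullet> (Hbar P M *\<^sub>v (spatial_op *\<^sub>v X)) =
      - (p.rect_form (vec_first Y p.N) (vec_first X p.N) + m.curv_form (vec_last Y m.N) (vec_last X m.N))"
    using spatial_form[OF vec_first_carrier vec_last_carrier vec_first_carrier vec_last_carrier LY, of X X]
      parts[OF X] parts[OF Y] by simp
  have damp: "Y \<bullet> (Hbar P M *\<^sub>v (SAT_BC2 P M *\<^sub>v Y)) \<le> 0"
    using damping_form[OF vec_first_carrier vec_last_carrier, of Y Y] parts[OF Y] by simp
  \<comment> \<open>The kinetic part uses the unprojected velocity, which is why the projection inside \<open>wtt\<close> has to be moved over.\<close>
  have "ip (Hp P) (vec_first (wt t) p.N) (vec_first wtt p.N) + ip (Hm M) (vec_last (wt t) m.N) (vec_last wtt m.N)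
      = wt t \<bullet> (Hbar P M *\<^sub>v wtt)"
  proof -
    have "Hp P \<in> carrier_mat p.N p.N" "Hm M \<in> carrier_mat m.N m.N" by (simp_all add: p.Hp_eq m.Hm_eq)
    from block_diag2_form[OF this vec_first_carrier vec_last_carrier vec_first_carrier vec_last_carrier, of "wt t" "wt t" wtt wtt]
    show ?thesis using parts[OF y] parts[OF wtt] by (simp add: ip_def Hbar_def)
  qed
  moreover have "p.rect_form (vec_first X p.N) (vec_first Y p.N) = p.rect_form (vec_first Y p.N) (vec_first X p.N)"
    "m.curv_form (vec_last X m.N) (vec_last Y m.N) = m.curv_form (vec_last Y m.N) (vec_last X m.N)"
    by (simp_all add: rect_form_symmetric curv_form_symmetric)
  ultimately have rate: "2 * (ip (Hp P) (vec_first (wt t) p.N) (vec_first wtt p.N) + c\<^sup>2 * p.rect_form (vec_first X p.N) (vec_first Y p.N))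
      + 2 * (ip (Hm M) (vec_last (wt t) m.N) (vec_last wtt m.N) + c\<^sup>2 * m.curv_form (vec_last X m.N) (vec_last Y m.N))
      = 2 * c * (Y \<bullet> (Hbar P M *\<^sub>v (SAT_BC2 P M *\<^sub>v Y)))"
    using kin pot by (simp add: algebra_simps)
  have "((\<lambda>s. energy_p c P M (w s) (wt s) + energy_m c P M (w s) (wt s)) has_real_derivative
      2 * c * (Y \<bullet> (Hbar P M *\<^sub>v (SAT_BC2 P M *\<^sub>v Y)))) (at t)"
    using DERIV_add[OF energy_p_derivative[OF w wt] energy_m_derivative[OF w wt], of c c] rate
    unfolding X_def Y_def wtt_def by simp
  moreover have "2 * c * (Y \<bullet> (Hbar P M *\<^sub>v (SAT_BC2 P M *\<^sub>v Y))) \<le> 0"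
    using c damp by (simp add: mult_nonneg_nonpos)
  ultimately show ?thesis by blast
qed

lemma homogeneous_solution_curve_deriv:
  assumes sol: "scheme_solution c P M (\<lambda>_. 0) ds w wt" and t: "0 < t" and ds: "ds \<in> carrier_vec (Ntot P M)"
  shows "curve_deriv (p.N + m.N) w (wt t) t"
    and "curve_deriv (p.N + m.N) wt (Dmat c P M *\<^sub>v w t + Emat c P M *\<^sub>v wt t) t"
proof -
  have ev: "\<forall>\<^sub>F s in nhds t. 0 < s" using eventually_nhds_in_open[of "{0<..}" t] t by simp
  have s: "w s \<in> carrier_vec (p.N + m.N)" "wt s \<in> carrier_vec (p.N + m.N)"
    "has_vec_deriv (p.N + m.N) w (wt s) s"
    "has_vec_deriv (p.N + m.N) wt (Dmat c P M *\<^sub>v w s + Emat c P M *\<^sub>v wt s + 0 \<cdot>\<^sub>v ds) s"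
    if "0 < s" for s
    using sol that by (auto simp: scheme_solution_def Ntot_def has_vec_deriv_def)
  have "Emat c P M \<in> carrier_mat (p.N + m.N) (p.N + m.N)"
    unfolding Emat_def Proj_eq
    by (intro smult_carrier_mat mult_carrier_mat[OF mult_carrier_mat[OF pr.Pr_carrier SAT_carrier(2)] pr.Pr_carrier])
  hence "Dmat c P M *\<^sub>v w t + Emat c P M *\<^sub>v wt t + 0 \<cdot>\<^sub>v ds = Dmat c P M *\<^sub>v w t + Emat c P M *\<^sub>v wt t"
    using ds by (intro eq_vecI) (auto simp: Ntot_def)
  thus "curve_deriv (p.N + m.N) w (wt t) t"
    "curve_deriv (p.N + m.N) wt (Dmat c P M *\<^sub>v w t + Emat c P M *\<^sub>v wt t) t"
    using s(3,4)[OF t] ev s(1,2) by (auto simp: curve_deriv_def elim!: eventually_mono)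
qed

end

theorem lemma1:
  fixes c :: real and P :: tensor_grid and M :: curv_grid and ds :: "real vec"
  assumes "0 < c"
    and "is_rect_grid P"
    and "is_curv_grid M"
    and "conforming P M"
    and "ds \<in> carrier_vec (Ntot P M)"
  shows "energy_stable c P M ds \<and>
    (\<forall>w wt t. scheme_solution c P M (\<lambda>_. 0) ds w wt \<longrightarrow> 0 < t \<longrightarrow>
      (\<exists>d\<le>0. ((\<lambda>s. energy_p c P M (w s) (wt s) + energy_m c P M (w s) (wt s))
                 has_real_derivative d) (at t)))"
proof -
  interpret coupled_scheme P M
    using assms by unfold_locales (auto simp: is_rect_grid_def is_curv_grid_def)
  have rate: "\<exists>d\<le>0. ((\<lambda>s. energy_p c P M (w s) (wt s) + energy_m c P M (w s) (wt s))
      has_real_derivative d) (at t)"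
    if "scheme_solution c P M (\<lambda>_. 0) ds w wt" "0 < t" for w wt t
    using energy_rate[OF assms(1) homogeneous_solution_curve_deriv[OF that assms(5)]] .
  have "antimono_on {0<..} (\<lambda>t. energy_p c P M (w t) (wt t) + energy_m c P M (w t) (wt t))"
    if sol: "scheme_solution c P M (\<lambda>_. 0) ds w wt" for w wt
  proof (rule monotone_onI)
    fix r s :: real assume "r \<in> {0<..}" "r \<le> s"
    thus "energy_p c P M (w s) (wt s) + energy_m c P M (w s) (wt s) \<le>
        energy_p c P M (w r) (wt r) + energy_m c P M (w r) (wt r)"
      using rate[OF sol]
      by (intro DERIV_nonpos_imp_nonincreasing[of r s "\<lambda>s. energy_p c P M (w s) (wt s) + energy_m c P M (w s) (wt s)"])
        (simp_all, meson less_le_trans)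
  qed
  thus ?thesis
    using rate energy_p_nonneg energy_m_nonneg by (auto simp: energy_stable_def)
qed

end
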